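(* Let $d\ge 1$ and let $(\Omega,\mathcal F,\mathbb P)$ be a probability space supporting, for each $N\in\mathbb N$ and $1\le i\le d$, a random matrix $A_i^N:\Omega\to\mathcal M_N(\mathbb C)$. Assume: (i) for every $k\in\mathbb N$ there is a finite constant $c_A(k)$ with $\sup_{N\in\mathbb N}\sup_{1\le i\le d}\sup_{1\le m,l\le N}\mathbb E\big[|A_i^N(m,l)|^k\big]\le c_A(k)<\infty$; (ii) $\mathbb E[A_i^N(m,l)]=0$ and $\mathbb E[|A_i^N(m,l)|^2]=1$ for all $N$, $1\le i\le d$ and $1\le m,l\le N$; (iii) there is $\kappa>0$ such that for every $p\in\mathbb N$, $\sup_{N\in\mathbb N}\sup_{1\le i\le d}\mathbb E\big[N^{-p/2}\|A_i^N\|_{\mathrm{op}}^p\big]\le \kappa^p\,\Gamma(\tfrac p2+1)$; (iv) for each $N$, the $\sigma$-algebras $\bigvee_{i=1}^d\sigma\big(A_i^N(m,l)\big)$, $1\le m,l\le N$, are independent; (v) $\mathbb E\big[\overline{A_i^N(m,l)}\,A_j^N(m,l)\big]=0$ for all $i\ne j$, all $N$ and all $1\le m,l\le N$. Let $\gamma,\sigma\in\mathcal X$ and let $Z_\gamma^N(t),Z_\sigma^N(t)$ be the $\mathrm{GL}(N;\mathbb C)$-valued solutions on $[0,T]$ of $$dZ_\gamma^N(t)=\frac1{\sqrt N}\sum_{i=1}^d Z_\gamma^N(t)A_i^N\,d\gamma_t^i,\quad Z_\gamma^N(0)=I_N,\qquad dZ_\sigma^N(t)=\frac1{\sqrt N}\sum_{i=1}^d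 Z_\sigma^N(t)A_i^N\,d\sigma_t^i,\quad Z_\sigma^N(0)=I_N.$$ Then for every $s,t\in[0,T]$, $$\lim_{N\to\infty}\frac1N\,\mathbb E\big[\langle Z_\gamma^N(s),Z_\sigma^N(t)\rangle_{\mathrm{HS}}\big]=K_{\mathrm{sig}}^{\gamma,\sigma}(s,t).$$
   Context: $V=\mathbb R^d$ carries its standard inner product, with norm $\|\cdot\|$; coordinates are with respect to the standard basis. Fix $T>0$. $\mathcal X$ is the set of continuous paths $\gamma:[0,T]\to V$ with $\gamma_0=0$ and finite 1-variation $\|\gamma\|_1=\sup_{\{t_i\}}\sum_i\|\gamma_{t_{i+1}}-\gamma_{t_i}\|<\infty$ (supremum over partitions of $[0,T]$). The signature of $\gamma\in\mathcal X$ over $[s,t]$ is $\mathcal S_{s,t}(\gamma)=(\mathcal S_{s,t}(\gamma)^m)_{m\ge0}\in\prod_{m\ge0}V^{\otimes m}$, with $\mathcal S_{s,t}(\gamma)^0=1$ and $\mathcal S_{s,t}(\gamma)^m=\int_{s\le t_1\le\dots\le t_m\le t}d\gamma_{t_1}\otimes\dots\otimes d\gamma_{t_m}$ for $m\ge1$. The signature kernel is $K_{\mathrm{sig}}^{\gamma,\sigma}(s,t)=\sum_{m=0}^\infty\langle\mathcal S_{0,s}(\gamma)^m,\mathcal S_{0,t}(\sigma)^m\rangle_{\mathrm{HS}}$, where $\langle\cdot,\cdot\rangle_{\mathrm{HS}}$ is the Hilbert–Schmidt inner product on $V^{\otimes m}$. $\mathcal M_N(\mathbb C)$ is the space of $N\times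 N$ complex matrices, $A(m,l)$ denotes the $(m,l)$ entry of $A$, $\|\cdot\|_{\mathrm{op}}$ is the operator norm, $A^*$ is the conjugate transpose, and $\langle A,B\rangle_{\mathrm{HS}}=\mathrm{tr}(A^*B)$ on $\mathcal M_N(\mathbb C)$. $\Gamma$ is the Gamma function. *)

theory Defs
  imports "HOL-Probability.Probability" "Jordan_Normal_Form.Schur_Decomposition"
begin

text \<open>
  The postfix \<open>$\<close> is used by two libraries; here it always means \<open>Matrix.vec_index\<close>, and the
  coordinates of a point of \<open>real ^ 'd\<close> are written with \<open>vec_nth\<close>.
\<close>

unbundle no vec_syntax

subsection \<open>Paths of finite 1-variation\<close>

definition one_variation :: "real \<Rightarrow> (real \<Rightarrow> 'a::real_normed_vector) \<Rightarrow> ennreal" where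
  "one_variation T \<gamma> =
     (SUP D \<in> {D. D division_of {0..T}}. ennreal (\<Sum>K\<in>D. norm (\<gamma> (Sup K) - \<gamma> (Inf K))))"

definition path_space :: "real \<Rightarrow> (real \<Rightarrow> real ^ 'd) set" where
  "path_space T =
     {\<gamma>. continuous_on {0..T} \<gamma> \<and> \<gamma> 0 = 0 \<and> one_variation T \<gamma> < \<infinity>}"

subsection \<open>Riemann--Stieltjes integrals\<close>

text \<open>
  Limit of the tagged Riemann--Stieltjes sums as the mesh tends to \<open>0\<close> (the gauge is a constant
  radius). The value is unspecified if the limit does not exist; below, the integrand is always
  continuous and the integrator is always continuous of finite variation.
\<close>

definition has_rs_integral ::
  "(real \<Rightarrow> 'a::real_normed_vector) \<Rightarrow> (real \<Rightarrow> real) \<Rightarrow> 'a \<Rightarrow> real \<Rightarrow> real \<Rightarrow> bool" where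
  "has_rs_integral f g I a b \<longleftrightarrow>
     (\<forall>e>0. \<exists>\<delta>>0. \<forall>p. p tagged_division_of {a..b} \<and> (\<lambda>x. ball x \<delta>) fine p \<longrightarrow>
        norm ((\<Sum>(x, K)\<in>p. (g (Sup K) - g (Inf K)) *\<^sub>R f x) - I) < e)"

definition rs_integral ::
  "real \<Rightarrow> real \<Rightarrow> (real \<Rightarrow> 'a::real_normed_vector) \<Rightarrow> (real \<Rightarrow> real) \<Rightarrow> 'a" where
  "rs_integral a b f g = (THE I. has_rs_integral f g I a b)"

subsection \<open>Signature and signature kernel\<close>

text \<open>
  A tensor of degree \<open>m\<close> over \<open>real ^ 'd\<close> is given by its coordinates in the standard basis, that is,
  by a function on the words \<open>w = [i\<^sub>1, \<dots>, i\<^sub>m]\<close>; its values on words of other lengths are irrelevant.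
  The integral over the simplex \<open>s \<le> t\<^sub>1 \<le> \<dots> \<le> t\<^sub>m \<le> t\<close> is the iterated integral whose outermost
  variable is \<open>t\<^sub>m\<close>.
\<close>

primrec signature :: "nat \<Rightarrow> (real \<Rightarrow> real ^ 'd) \<Rightarrow> real \<Rightarrow> real \<Rightarrow> 'd list \<Rightarrow> real" where
  "signature 0 \<gamma> s t = (\<lambda>w. 1)"
| "signature (Suc m) \<gamma> s t =
     (\<lambda>w. rs_integral s t (\<lambda>u. signature m \<gamma> s u (butlast w)) (\<lambda>u. vec_nth (\<gamma> u) (last w)))"

definition tensor_hs :: "nat \<Rightarrow> ('d::finite list \<Rightarrow> real) \<Rightarrow> ('d list \<Rightarrow> real) \<Rightarrow> real" where
  "tensor_hs m a b = (\<Sum>w | length w = m. a w * b w)"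

definition sig_kernel ::
  "(real \<Rightarrow> real ^ 'd::finite) \<Rightarrow> (real \<Rightarrow> real ^ 'd) \<Rightarrow> real \<Rightarrow> real \<Rightarrow> real" where
  "sig_kernel \<gamma> \<sigma> s t = (\<Sum>m. tensor_hs m (signature m \<gamma> 0 s) (signature m \<sigma> 0 t))"

subsection \<open>Complex matrices\<close>

definition cvec_norm :: "complex vec \<Rightarrow> real" where
  "cvec_norm v = L2_set (\<lambda>j. cmod (v $ j)) {..<dim_vec v}"

definition op_norm :: "complex mat \<Rightarrow> real" where
  "op_norm A = (SUP v \<in> {v \<in> carrier_vec (dim_col A). cvec_norm v \<le> 1}. cvec_norm (A *\<^sub>v v))"

definition mat_trace :: "complex mat \<Rightarrow> complex" where
  "mat_trace A = (\<Sum>j<dim_row A. A $$ (j, j))"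

definition mat_hs :: "complex mat \<Rightarrow> complex mat \<Rightarrow> complex" where
  "mat_hs A B = mat_trace (mat_adjoint A * B)"

subsection \<open>The linear controlled differential equation\<close>

text \<open>
  The equation \<open>dZ = N\<^sup>-\<^sup>1\<^sup>/\<^sup>2 \<Sum>\<^sub>i Z A\<^sub>i d\<gamma>\<^sup>i\<close>, \<open>Z 0 = 1\<close>, in integrated form and entry by entry, for
  continuous \<open>Z\<close> with values in the invertible matrices.
\<close>

definition solves_cde ::
  "real \<Rightarrow> nat \<Rightarrow> ('d::finite \<Rightarrow> complex mat) \<Rightarrow> (real \<Rightarrow> real ^ 'd) \<Rightarrow> (real \<Rightarrow> complex mat) \<Rightarrow> bool"
where
  "solves_cde T N A \<gamma> Z \<longleftrightarrow>
     (\<forall>t\<in>{0..T}. Z t \<in> carrier_mat N N \<and> invertible_mat (Z t)) \<and>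
     (\<forall>m<N. \<forall>l<N. continuous_on {0..T} (\<lambda>t. Z t $$ (m, l))) \<and>
     Z 0 = 1\<^sub>m N \<and>
     (\<forall>t\<in>{0..T}. \<forall>m<N. \<forall>l<N.
        Z t $$ (m, l) = Z 0 $$ (m, l) +
          1 / complex_of_real (sqrt (real N)) *
          (\<Sum>i\<in>UNIV. rs_integral 0 t (\<lambda>u. (Z u * A i) $$ (m, l)) (\<lambda>u. vec_nth (\<gamma> u) i)))"

subsection \<open>The \<open>\<sigma>\<close>-algebra of the entries at a fixed position\<close>

definition entry_sigma ::
  "'w measure \<Rightarrow> ('d \<Rightarrow> 'w \<Rightarrow> complex mat) \<Rightarrow> nat \<times> nat \<Rightarrow> 'w set set" where
  "entry_sigma P A ml = sigma_sets (space P)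
     (\<Union>i. sets (vimage_algebra (space P) (\<lambda>\<omega>. A i \<omega> $$ ml) borel))"

end

theory Submission
  imports Defs
begin

text \<open>
  Iterating the integral equation expands the solution over words,
  \<open>Z\<^sub>\<gamma>(s) = \<Sum>\<^sub>w S(\<gamma>)\<^sup>w N\<^sup>-\<^sup>m\<^sup>/\<^sup>2 A\<^sub>w\<close>, where \<open>m\<close> is the length of \<open>w\<close> and \<open>A\<^sub>w\<close> is the product of the matrices
  along \<open>w\<close> (\<open>picard_series\<close>). Therefore \<open>\<langle>Z\<^sub>\<gamma>(s), Z\<^sub>\<sigma>(t)\<rangle> / N\<close> is the double series over words \<open>w\<close> and \<open>v\<close>
  of \<open>S(\<gamma>)\<^sup>w S(\<sigma>)\<^sup>v\<close> times the Hilbert--Schmidt product of \<open>A\<^sub>w\<close> and \<open>A\<^sub>v\<close>, suitably normalised. The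
  signature kernel is the sum of the diagonal terms \<open>w = v\<close>, so it is enough that the normalised products
  converge to \<open>\<delta>\<^sub>w\<^sub>v\<close> in expectation and that the limit may be taken term by term.

  For the convergence, the Hilbert--Schmidt product is a sum over pairs of vertex paths \<open>p\<close>, \<open>q\<close> in
  \<open>{..<N}\<close> with common end points, of a product of entries along the edges of \<open>p\<close> and \<open>q\<close>. By
  independence and centring, only pairs in which every directed edge is repeated contribute. Walking
  along \<open>p\<close> and back along \<open>q\<close> visits a connected graph with at most \<open>(n + m) / 2\<close> edges, hence with at
  most \<open>(n + m) / 2 + 1\<close> vertices; this number is attained only if \<open>p = q\<close> has no repeated vertex
  (\<open>repeated_edges_dichotomy\<close>). All other pairs are too few by a factor \<open>\<surd>N\<close>, and for \<open>p = q\<close> the expectation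
  is a product of covariances, which is \<open>\<delta>\<^sub>w\<^sub>v\<close> (\<open>expectation_word_hs_approx\<close>).

  For the exchange of limits, the terms of total degree \<open>k\<close> are collected in \<open>hs_term\<close>. The factorial decay
  of the signature and the bound of a product by operator norms dominate them by
  \<open>x\<^sup>k / k!\<close> times \<open>k\<close>-th moments of the operator norms (\<open>hs_term_le\<close>), and these moments grow only like
  \<open>\<kappa>\<^sup>k \<Gamma>(k/2 + 1) \<le> \<kappa>\<^sup>k \<surd>(k!)\<close>. The resulting series converges and does not depend on \<open>N\<close>, so Tannery's theorem
  applies.
\<close>

section \<open>Riemann--Stieltjes integration against paths of bounded variation\<close>

abbreviation rs_sum :: "(real \<Rightarrow> 'a::real_normed_vector) \<Rightarrow> (real \<Rightarrow> real) \<Rightarrow> (real \<times> real set) set \<Rightarrow> 'a"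
  where "rs_sum f g p \<equiv> (\<Sum>(x, K)\<in>p. (g (Sup K) - g (Inf K)) *\<^sub>R f x)"

text \<open>
  \<open>L\<close> stands for a variation function: its increments dominate those of \<open>g\<close>, and in particular \<open>L\<close> is
  increasing. Keeping \<open>L\<close> abstract allows one control to serve all coordinates of a path.
\<close>

definition controlled_by :: "real \<Rightarrow> real \<Rightarrow> (real \<Rightarrow> real) \<Rightarrow> (real \<Rightarrow> real) \<Rightarrow> bool" where
  "controlled_by a b L g \<longleftrightarrow> (\<forall>u v. a \<le> u \<and> u \<le> v \<and> v \<le> b \<longrightarrow> \<bar>g v - g u\<bar> \<le> L v - L u)"

lemma controlled_byD:
  "controlled_by a b L g \<Longrightarrow> a \<le> u \<Longrightarrow> u \<le> v \<Longrightarrow> v \<le> b \<Longrightarrow> \<bar>g v - g u\<bar> \<le> L v - L u"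
  by (auto simp: controlled_by_def)

lemma controlled_by_mono:
  "controlled_by a b L g \<Longrightarrow> a \<le> u \<Longrightarrow> u \<le> v \<Longrightarrow> v \<le> b \<Longrightarrow> L u \<le> L v"
  using controlled_byD[of a b L g u v] by linarith

lemma controlled_by_subinterval:
  "controlled_by a b L g \<Longrightarrow> a \<le> a' \<Longrightarrow> b' \<le> b \<Longrightarrow> controlled_by a' b' L g"
  by (auto simp: controlled_by_def)

lemma tagged_division_real_interval:
  assumes "p tagged_division_of {a..b::real}" "(x, K) \<in> p"
  obtains c d where "K = {c..d}" "c \<le> x" "x \<le> d" "a \<le> c" "d \<le> b" "Inf K = c" "Sup K = d"
proof -
  obtain c d where K: "K = {c..d}"
    using tagged_division_ofD(4)[OF assms] by (auto simp: cbox_interval)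
  have "x \<in> K" "K \<subseteq> {a..b}"
    using tagged_division_ofD(2,3)[OF assms] by auto
  with K show ?thesis using that[of c d] by auto
qed

text \<open>
  Clamping to an interval \<open>K = {c..d}\<close> turns an increment of \<open>g\<close> over \<open>J = {u..v}\<close> into the increment
  over \<open>K \<inter> J\<close>, which is symmetric in \<open>K\<close> and \<open>J\<close>. This makes the common refinement of two tagged
  divisions available through plain telescoping sums.
\<close>

definition clamp_inc :: "(real \<Rightarrow> real) \<Rightarrow> real set \<Rightarrow> real set \<Rightarrow> real" where
  "clamp_inc g K J = g (max (Inf K) (min (Sup K) (Sup J))) - g (max (Inf K) (min (Sup K) (Inf J)))"

lemma clamp_inc_commute:
  assumes "c \<le> d" "u \<le> v"
  shows "clamp_inc g {c..d} {u..v} = clamp_inc g {u..v} {c..d}"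
  using assms by (auto simp: clamp_inc_def max_def min_def)

lemma sum_clamp_inc:
  assumes q: "q tagged_division_of {a..b}" and "a \<le> c" "c \<le> d" "d \<le> b"
  shows "(\<Sum>(y, J)\<in>q. clamp_inc g {c..d} J) = g d - g c"
proof -
  have "(\<Sum>(y, J)\<in>q. clamp_inc g {c..d} J) =
      g (max c (min d b)) - g (max c (min d a))"
    using additive_tagged_division_1[OF _ q, of "\<lambda>x. g (max c (min d x))"] assms
    by (simp add: clamp_inc_def)
  moreover have "max c (min d b) = d" "max c (min d a) = c" using assms by auto
  ultimately show ?thesis by simp
qed

lemma rs_sum_refine:
  assumes p: "p tagged_division_of {a..b}" and q: "q tagged_division_of {a..b}"
  shows "rs_sum f g p = (\<Sum>(x, K)\<in>p. \<Sum>(y, J)\<in>q. clamp_inc g K J *\<^sub>R f x)"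
proof (rule sum.cong[OF refl], clarify)
  fix x K assume "(x, K) \<in> p"
  then obtain c d where K: "K = {c..d}" "c \<le> d" "a \<le> c" "d \<le> b"
    using tagged_division_real_interval[OF p] by (metis order_trans)
  show "(g (Sup K) - g (Inf K)) *\<^sub>R f x = (\<Sum>(y, J)\<in>q. clamp_inc g K J *\<^sub>R f x)"
    using sum_clamp_inc[OF q, of c d g] K
    by (simp add: scaleR_sum_left[symmetric] case_prod_unfold)
qed

lemma clamp_inc_bound:
  assumes "controlled_by a b L g" "a \<le> c" "c \<le> d" "d \<le> b" "u \<le> v"
  shows "\<bar>clamp_inc g {c..d} {u..v}\<bar> \<le> clamp_inc L {c..d} {u..v}"
  using assms unfolding clamp_inc_def by (auto intro!: controlled_byD)

lemma rs_sum_diff_le: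
  fixes f :: "real \<Rightarrow> 'a::real_normed_vector"
  assumes L: "controlled_by a b L g" and ab: "a \<le> b" and e: "e \<ge> 0"
    and p: "p tagged_division_of {a..b}" "(\<lambda>x. ball x \<delta>) fine p"
    and q: "q tagged_division_of {a..b}" "(\<lambda>x. ball x \<delta>) fine q"
    and osc: "\<And>x y. x \<in> {a..b} \<Longrightarrow> y \<in> {a..b} \<Longrightarrow> dist x y < 2 * \<delta> \<Longrightarrow> norm (f x - f y) \<le> e"
  shows "norm (rs_sum f g p - rs_sum f g q) \<le> e * (L b - L a)"
proof -
  have "rs_sum f g q = (\<Sum>(y, J)\<in>q. \<Sum>(x, K)\<in>p. clamp_inc g J K *\<^sub>R f y)"
    by (rule rs_sum_refine[OF q(1) p(1)])
  also have "\<dots> = (\<Sum>(y, J)\<in>q. \<Sum>(x, K)\<in>p. clamp_inc g K J *\<^sub>R f y)"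
  proof (intro sum.cong refl, clarify, intro sum.cong refl, clarify)
    fix y J x K assume "(y, J) \<in> q" "(x, K) \<in> p"
    then show "clamp_inc g J K *\<^sub>R f y = clamp_inc g K J *\<^sub>R f y"
      by (elim tagged_division_real_interval[OF p(1)] tagged_division_real_interval[OF q(1)])
        (auto simp: clamp_inc_commute)
  qed
  also have "\<dots> = (\<Sum>(x, K)\<in>p. \<Sum>(y, J)\<in>q. clamp_inc g K J *\<^sub>R f y)"
    unfolding case_prod_unfold by (rule sum.swap)
  finally have "rs_sum f g p - rs_sum f g q =
      (\<Sum>(x, K)\<in>p. \<Sum>(y, J)\<in>q. clamp_inc g K J *\<^sub>R (f x - f y))"
    unfolding rs_sum_refine[OF p(1) q(1)]
    by (simp add: case_prod_unfold sum_subtractf[symmetric] scaleR_diff_right)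
  also have "norm \<dots> \<le> (\<Sum>(x, K)\<in>p. \<Sum>(y, J)\<in>q. clamp_inc L K J * e)"
  proof (intro sum_norm_le, clarify, intro sum_norm_le, clarify)
    fix x K y J assume *: "(x, K) \<in> p" "(y, J) \<in> q"
    obtain c d where K: "K = {c..d}" "c \<le> x" "x \<le> d" "a \<le> c" "d \<le> b"
      using tagged_division_real_interval[OF p(1) *(1)] by metis
    obtain u v where J: "J = {u..v}" "u \<le> y" "y \<le> v" "a \<le> u" "v \<le> b"
      using tagged_division_real_interval[OF q(1) *(2)] by metis
    have bd: "\<bar>clamp_inc g K J\<bar> \<le> clamp_inc L K J"
      unfolding K(1) J(1) using K J by (intro clamp_inc_bound[OF L]) auto
    show "norm (clamp_inc g K J *\<^sub>R (f x - f y)) \<le> clamp_inc L K J * e"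
    proof (cases "max c u \<le> min d v")
      case True
      then have "max c u \<in> K" "max c u \<in> J" using K J by auto
      then have "max c u \<in> ball x \<delta>" "max c u \<in> ball y \<delta>"
        using fineD[OF p(2) *(1)] fineD[OF q(2) *(2)] by auto
      then have "dist x y < 2 * \<delta>" by (auto simp: dist_real_def)
      then have "norm (f x - f y) \<le> e" using K J by (intro osc) auto
      with bd e show ?thesis by (simp add: mult_mono)
    next
      case False
      then have "clamp_inc L K J = 0"
        using K J by (auto simp: clamp_inc_def max_def min_def split: if_splits)
      with bd show ?thesis by simp
    qed
  qed
  also have "\<dots> = rs_sum (\<lambda>_. e) L p"
    using rs_sum_refine[OF p(1) q(1), where f = "\<lambda>_. e" and g = L] by simp
  also have "\<dots> = e * (L b - L a)"
    using additive_tagged_division_1[OF ab p(1), of L]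
    by (simp add: sum_distrib_left[symmetric] case_prod_unfold mult.commute)
  finally show ?thesis .
qed

lemma fine_ball_mono:
  "(\<lambda>x. ball x d) fine p \<Longrightarrow> d \<le> r \<Longrightarrow> (\<lambda>x. ball x r) fine p"
  by (force simp: fine_def)

lemma has_rs_integral_unique:
  assumes "has_rs_integral f g I a b" "has_rs_integral f g J a b"
  shows "I = J"
proof (rule ccontr)
  assume "I \<noteq> J"
  define e where "e = norm (I - J) / 2"
  have e: "e > 0" using \<open>I \<noteq> J\<close> by (simp add: e_def)
  obtain d1 where d1: "d1 > 0"
    "\<And>p. p tagged_division_of {a..b} \<Longrightarrow> (\<lambda>x. ball x d1) fine p \<Longrightarrow> norm (rs_sum f g p - I) < e"
    using assms(1) e unfolding has_rs_integral_def by meson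
  obtain d2 where d2: "d2 > 0"
    "\<And>p. p tagged_division_of {a..b} \<Longrightarrow> (\<lambda>x. ball x d2) fine p \<Longrightarrow> norm (rs_sum f g p - J) < e"
    using assms(2) e unfolding has_rs_integral_def by meson
  obtain p where p: "p tagged_division_of {a..b}" "(\<lambda>x. ball x (min d1 d2)) fine p"
    using fine_division_exists_real[of "\<lambda>x. ball x (min d1 d2)" a b] d1(1) d2(1)
    by (metis gauge_ball min_less_iff_conj)
  have "norm (rs_sum f g p - I) < e" "norm (rs_sum f g p - J) < e"
    using p by (auto intro!: d1(2) d2(2) elim!: fine_ball_mono)
  then have "norm (I - J) < e + e"
    by (metis norm_minus_commute norm_diff_triangle_less)
  then show False by (simp add: e_def)
qed

lemma rs_integral_eq: "has_rs_integral f g I a b \<Longrightarrow> rs_integral a b f g = I"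
  unfolding rs_integral_def by (metis has_rs_integral_unique the_equality)

text \<open>
  Existence is the Cauchy criterion: two fine Riemann--Stieltjes sums are compared on their common
  refinement, where the difference is at most the oscillation of \<open>f\<close> times the total variation.
\<close>

lemma has_rs_integral_exists:
  fixes f :: "real \<Rightarrow> 'a::banach"
  assumes L: "controlled_by a b L g" and ab: "a \<le> b" and f: "continuous_on {a..b} f"
  shows "has_rs_integral f g (rs_integral a b f g) a b"
proof -
  have Lab: "L b - L a \<ge> 0" using controlled_by_mono[OF L, of a b] ab by simp
  define close where "close e \<delta> \<longleftrightarrow> \<delta> > 0 \<and> (\<forall>p q. p tagged_division_of {a..b} \<longrightarrow> (\<lambda>x. ball x \<delta>) fine p \<longrightarrow>
      q tagged_division_of {a..b} \<longrightarrow> (\<lambda>x. ball x \<delta>) fine q \<longrightarrow>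
      norm (rs_sum f g p - rs_sum f g q) < e)" for e \<delta>
  have "\<exists>\<delta>. close e \<delta>" if e: "e > 0" for e
  proof -
    define e' where "e' = e / (L b - L a + 1)"
    have e': "e' > 0" "e' * (L b - L a) < e"
      using e Lab by (auto simp: e'_def field_simps)
    have "uniformly_continuous_on {a..b} f"
      by (intro compact_uniformly_continuous f) auto
    then obtain d where d: "d > 0" "\<And>x y. x \<in> {a..b} \<Longrightarrow> y \<in> {a..b} \<Longrightarrow> dist x y < d \<Longrightarrow> norm (f x - f y) \<le> e'"
      using e'(1) unfolding uniformly_continuous_on_def by (metis dist_norm dist_commute less_imp_le)
    show ?thesis
      unfolding close_def
    proof (intro exI[of _ "d/2"] conjI allI impI)
      \<comment> \<open>The tags of two overlapping intervals are less than twice the radius apart.\<close>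
      fix p q assume "p tagged_division_of {a..b}" "(\<lambda>x. ball x (d/2)) fine p"
        "q tagged_division_of {a..b}" "(\<lambda>x. ball x (d/2)) fine q"
      then have "norm (rs_sum f g p - rs_sum f g q) \<le> e' * (L b - L a)"
        using e' d by (intro rs_sum_diff_le[OF L ab]) auto
      with e' show "norm (rs_sum f g p - rs_sum f g q) < e" by simp
    qed (use d in auto)
  qed
  then have "\<forall>e. \<exists>\<delta>. e > 0 \<longrightarrow> close e \<delta>" by blast
  then obtain D where "\<And>e. e > 0 \<Longrightarrow> close e (D e)" using choice[of "\<lambda>e \<delta>. e > 0 \<longrightarrow> close e \<delta>"] by blast
  then have D: "\<And>e. e > 0 \<Longrightarrow> D e > 0"
    "\<And>e p q. e > 0 \<Longrightarrow> p tagged_division_of {a..b} \<Longrightarrow> (\<lambda>x. ball x (D e)) fine p \<Longrightarrow>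
      q tagged_division_of {a..b} \<Longrightarrow> (\<lambda>x. ball x (D e)) fine q \<Longrightarrow>
      norm (rs_sum f g p - rs_sum f g q) < e"
    by (simp_all add: close_def)
  define r where "r n = Min ((\<lambda>k. D (inverse (real (Suc k)))) ` {..n})" for n
  have r: "r n > 0" for n unfolding r_def by (subst Min_gr_iff) (auto intro!: D(1))
  have r_le: "r n \<le> D (inverse (real (Suc k)))" if "k \<le> n" for k n
    unfolding r_def using that by (intro Min_le) auto
  have "\<exists>p. p tagged_division_of {a..b} \<and> (\<lambda>x. ball x (r n)) fine p" for n
    using fine_division_exists_real[of "\<lambda>x. ball x (r n)" a b] r[of n] by (metis gauge_ball)
  then obtain P where P: "\<And>n. P n tagged_division_of {a..b}" "\<And>n. (\<lambda>x. ball x (r n)) fine (P n)"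
    by metis
  have P_fine: "(\<lambda>x. ball x (D (inverse (real (Suc k))))) fine (P n)" if "k \<le> n" for k n
    by (rule fine_ball_mono[OF P(2) r_le[OF that]])
  have "Cauchy (\<lambda>n. rs_sum f g (P n))"
  proof (rule metric_CauchyI)
    fix e :: real assume "e > 0"
    then obtain k where k: "inverse (real (Suc k)) < e" using reals_Archimedean by blast
    have "dist (rs_sum f g (P m)) (rs_sum f g (P n)) < e" if "m \<ge> k" "n \<ge> k" for m n
      using D(2)[OF _ P(1) P_fine[OF that(1)] P(1) P_fine[OF that(2)]] k
      by (simp add: dist_norm)
    then show "\<exists>M. \<forall>m\<ge>M. \<forall>n\<ge>M. dist (rs_sum f g (P m)) (rs_sum f g (P n)) < e" by blast
  qed
  then obtain I where I: "(\<lambda>n. rs_sum f g (P n)) \<longlonglongrightarrow> I"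
    using convergent_eq_Cauchy by blast
  have "has_rs_integral f g I a b"
    unfolding has_rs_integral_def
  proof (intro allI impI)
    fix e :: real assume "e > 0"
    then obtain k where k: "inverse (real (Suc k)) < e / 2" using reals_Archimedean half_gt_zero by blast
    show "\<exists>\<delta>>0. \<forall>p. p tagged_division_of {a..b} \<and> (\<lambda>x. ball x \<delta>) fine p \<longrightarrow> norm (rs_sum f g p - I) < e"
    proof (intro exI[of _ "D (inverse (real (Suc k)))"] conjI allI impI)
      fix p assume p: "p tagged_division_of {a..b} \<and> (\<lambda>x. ball x (D (inverse (real (Suc k))))) fine p"
      have "\<forall>n\<ge>k. norm (rs_sum f g p - rs_sum f g (P n)) \<le> inverse (real (Suc k))"
        using D(2)[of "inverse (real (Suc k))" p "P _"] p P(1) P_fine by (auto intro!: less_imp_le)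
      moreover have "(\<lambda>n. norm (rs_sum f g p - rs_sum f g (P n))) \<longlonglongrightarrow> norm (rs_sum f g p - I)"
        by (intro tendsto_intros I)
      ultimately have "norm (rs_sum f g p - I) \<le> inverse (real (Suc k))"
        by (intro tendsto_upperbound[of _ _ sequentially]) (auto simp: eventually_sequentially)
      with k \<open>e > 0\<close> show "norm (rs_sum f g p - I) < e" by linarith
    qed (auto intro!: D(1))
  qed
  then show ?thesis using rs_integral_eq by metis
qed

lemma has_rs_integral_bounded_linear:
  assumes h: "bounded_linear h" and "has_rs_integral f g I a b"
  shows "has_rs_integral (\<lambda>x. h (f x)) g (h I) a b"
  unfolding has_rs_integral_def
proof (intro allI impI)
  interpret bounded_linear h by fact
  fix e :: real assume "e > 0"
  obtain B where B: "B > 0" "\<And>x. norm (h x) \<le> norm x * B" using pos_bounded by auto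
  have "e / B > 0" using \<open>e > 0\<close> B by simp
  then obtain d where d: "d > 0"
    "\<And>p. p tagged_division_of {a..b} \<Longrightarrow> (\<lambda>x. ball x d) fine p \<Longrightarrow> norm (rs_sum f g p - I) < e / B"
    using assms(2) unfolding has_rs_integral_def by meson
  show "\<exists>\<delta>>0. \<forall>p. p tagged_division_of {a..b} \<and> (\<lambda>x. ball x \<delta>) fine p \<longrightarrow>
      norm (rs_sum (\<lambda>x. h (f x)) g p - h I) < e"
  proof (intro exI[of _ d] conjI allI impI)
    fix p assume p: "p tagged_division_of {a..b} \<and> (\<lambda>x. ball x d) fine p"
    have "rs_sum (\<lambda>x. h (f x)) g p - h I = h (rs_sum f g p - I)"
      by (simp add: diff sum scaleR case_prod_unfold)
    also have "norm \<dots> \<le> norm (rs_sum f g p - I) * B" by (rule B)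
    also have "\<dots> < e" using d(2)[of p] p B(1) by (simp add: pos_less_divide_eq)
    finally show "norm (rs_sum (\<lambda>x. h (f x)) g p - h I) < e" .
  qed (fact d)
qed

lemma has_rs_integral_add:
  assumes "has_rs_integral f g I a b" "has_rs_integral f' g J a b"
  shows "has_rs_integral (\<lambda>x. f x + f' x) g (I + J) a b"
  unfolding has_rs_integral_def
proof (intro allI impI)
  fix e :: real assume "e > 0"
  then have e: "e / 2 > 0" by simp
  obtain d1 where d1: "d1 > 0"
    "\<And>p. p tagged_division_of {a..b} \<Longrightarrow> (\<lambda>x. ball x d1) fine p \<Longrightarrow> norm (rs_sum f g p - I) < e / 2"
    using assms(1) e unfolding has_rs_integral_def by meson
  obtain d2 where d2: "d2 > 0"
    "\<And>p. p tagged_division_of {a..b} \<Longrightarrow> (\<lambda>x. ball x d2) fine p \<Longrightarrow> norm (rs_sum f' g p - J) < e / 2"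
    using assms(2) e unfolding has_rs_integral_def by meson
  show "\<exists>\<delta>>0. \<forall>p. p tagged_division_of {a..b} \<and> (\<lambda>x. ball x \<delta>) fine p \<longrightarrow>
      norm (rs_sum (\<lambda>x. f x + f' x) g p - (I + J)) < e"
  proof (intro exI[of _ "min d1 d2"] conjI allI impI)
    fix p assume p: "p tagged_division_of {a..b} \<and> (\<lambda>x. ball x (min d1 d2)) fine p"
    have "rs_sum (\<lambda>x. f x + f' x) g p - (I + J) = (rs_sum f g p - I) + (rs_sum f' g p - J)"
      by (simp add: scaleR_add_right sum.distrib case_prod_unfold)
    also have "norm \<dots> < e / 2 + e / 2"
      using p by (intro norm_add_less d1(2) d2(2)) (auto elim!: fine_ball_mono)
    finally show "norm (rs_sum (\<lambda>x. f x + f' x) g p - (I + J)) < e" by simp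
  qed (use d1 d2 in auto)
qed

lemma has_rs_integral_const:
  assumes "a \<le> b"
  shows "has_rs_integral (\<lambda>_. c) g ((g b - g a) *\<^sub>R c) a b"
  unfolding has_rs_integral_def
proof (intro allI impI exI[of _ 1] conjI)
  fix e :: real and p assume "e > 0" and p: "p tagged_division_of {a..b} \<and> (\<lambda>x. ball x 1) fine p"
  have "rs_sum (\<lambda>_. c) g p = (g b - g a) *\<^sub>R c"
    using additive_tagged_division_1[OF assms, of p g] p
    by (simp add: scaleR_sum_left[symmetric] case_prod_unfold)
  then show "norm (rs_sum (\<lambda>_. c) g p - (g b - g a) *\<^sub>R c) < e" using \<open>e > 0\<close> by simp
qed simp

lemma has_rs_integral_sum:
  assumes "finite S" "a \<le> b" "\<And>i. i \<in> S \<Longrightarrow> has_rs_integral (f i) g (I i) a b"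
  shows "has_rs_integral (\<lambda>x. \<Sum>i\<in>S. f i x) g (\<Sum>i\<in>S. I i) a b"
  using assms(1,3)
proof (induction S rule: finite_induct)
  case empty
  show ?case using has_rs_integral_const[OF assms(2), of 0 g] by simp
next
  case (insert i S)
  then show ?case by (simp add: has_rs_integral_add)
qed

text \<open>
  The limit may be taken along left-tagged divisions, for which the estimate only has to compare
  \<open>f u\<close> with the increments of \<open>L\<close> to the right of \<open>u\<close>; such a bound telescopes through \<open>H\<close>. With
  \<open>H = L\<^sup>m\<^sup>+\<^sup>1 / (m + 1)!\<close> this replaces the substitution rule for \<open>\<integral> L\<^sup>m / m! dL\<close>.
\<close>

lemma has_rs_integral_bound:
  fixes f :: "real \<Rightarrow> 'a::real_normed_vector"
  assumes I: "has_rs_integral f g I a b" and L: "controlled_by a b L g" and ab: "a \<le> b"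
    and H: "\<And>u v. a \<le> u \<Longrightarrow> u \<le> v \<Longrightarrow> v \<le> b \<Longrightarrow> norm (f u) * (L v - L u) \<le> H v - H u"
  shows "norm I \<le> H b - H a"
proof (rule field_le_epsilon)
  fix e :: real assume e: "e > 0"
  obtain d where d: "d > 0"
    "\<And>p. p tagged_division_of {a..b} \<Longrightarrow> (\<lambda>x. ball x d) fine p \<Longrightarrow> norm (rs_sum f g p - I) < e"
    using I e unfolding has_rs_integral_def by meson
  obtain q where q: "q tagged_division_of {a..b}" "(\<lambda>x. ball x (d/2)) fine q"
    using fine_division_exists_real[of "\<lambda>x. ball x (d/2)" a b] d(1) by (metis gauge_ball half_gt_zero)
  define p where "p = (\<lambda>(x, K). (Inf K, K)) ` q"
  have pq: "\<exists>y. (y, K) \<in> q \<and> x = Inf K" if "(x, K) \<in> p" for x K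
    using that by (auto simp: p_def)
  have p: "p tagged_division_of {a..b}"
  proof (rule tagged_division_ofI)
    show "finite p" using q by (auto simp: p_def)
    fix x K assume "(x, K) \<in> p"
    then obtain y where y: "(y, K) \<in> q" "x = Inf K" using pq by blast
    then show "x \<in> K" "K \<subseteq> {a..b}"
      by (auto elim!: tagged_division_real_interval[OF q(1)])
    show "\<exists>a b. K = cbox a b" using y q(1) by blast
  next
    fix x1 K1 x2 K2 assume *: "(x1, K1) \<in> p" "(x2, K2) \<in> p" "(x1, K1) \<noteq> (x2, K2)"
    then have "K1 \<noteq> K2" using pq by blast
    with * show "interior K1 \<inter> interior K2 = {}"
      using tagged_division_ofD(5)[OF q(1)] pq by (metis Pair_inject)
  next
    have "{K. \<exists>x. (x, K) \<in> p} = {K. \<exists>x. (x, K) \<in> q}" by (force simp: p_def)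
    then show "\<Union>{K. \<exists>x. (x, K) \<in> p} = {a..b}"
      using tagged_division_ofD(6)[OF q(1)] by simp
  qed
  have "(\<lambda>x. ball x d) fine p"
  proof (rule fineI)
    fix x K assume "(x, K) \<in> p"
    then obtain y where y: "(y, K) \<in> q" "x = Inf K" using pq by blast
    then have "K \<subseteq> ball y (d/2)" "x \<in> K"
      using fineD[OF q(2)] by (auto elim!: tagged_division_real_interval[OF q(1)])
    then have "dist y z < d / 2" if "z \<in> K" for z
      using that by (auto simp: subset_iff)
    then have "dist x z < d" if "z \<in> K" for z
      using that \<open>x \<in> K\<close> dist_triangle_half_r by blast
    then show "K \<subseteq> ball x d" by auto
  qed
  with p d(2) have "norm (rs_sum f g p - I) < e" by blast
  moreover have "norm (rs_sum f g p) \<le> H b - H a"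
  proof -
    have "norm (rs_sum f g p) \<le> (\<Sum>(x, K)\<in>p. H (Sup K) - H (Inf K))"
    proof (rule sum_norm_le, clarify)
      fix x K assume *: "(x, K) \<in> p"
      then obtain c d where K: "Inf K = c" "Sup K = d" "a \<le> c" "c \<le> d" "d \<le> b"
        by (elim tagged_division_real_interval[OF p]) auto
      have "x = c" using pq[OF *] K by auto
      then have "norm ((g (Sup K) - g (Inf K)) *\<^sub>R f x) = norm (f c) * \<bar>g d - g c\<bar>" using K by simp
      also have "\<dots> \<le> norm (f c) * (L d - L c)"
        using K by (intro mult_left_mono controlled_byD[OF L]) auto
      also have "\<dots> \<le> H d - H c" using K by (intro H)
      finally show "norm ((g (Sup K) - g (Inf K)) *\<^sub>R f x) \<le> H (Sup K) - H (Inf K)" using K by simp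
    qed
    also have "\<dots> = H b - H a" by (rule additive_tagged_division_1[OF ab p])
    finally show ?thesis .
  qed
  ultimately show "norm I \<le> H b - H a + e"
    using norm_triangle_ineq2[of I "rs_sum f g p"] by (simp add: norm_minus_commute)
qed

lemma has_rs_integral_combine:
  assumes I: "has_rs_integral f g I a b" and J: "has_rs_integral f g J b c"
    and M: "has_rs_integral f g M a c" and le: "a \<le> b" "b \<le> c"
  shows "M = I + J"
proof (rule ccontr)
  assume "M \<noteq> I + J"
  define e where "e = norm (M - (I + J)) / 3"
  have e: "e > 0" using \<open>M \<noteq> I + J\<close> by (simp add: e_def)
  obtain d1 where d1: "d1 > 0"
    "\<And>p. p tagged_division_of {a..b} \<Longrightarrow> (\<lambda>x. ball x d1) fine p \<Longrightarrow> norm (rs_sum f g p - I) < e"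
    using I e unfolding has_rs_integral_def by meson
  obtain d2 where d2: "d2 > 0"
    "\<And>p. p tagged_division_of {b..c} \<Longrightarrow> (\<lambda>x. ball x d2) fine p \<Longrightarrow> norm (rs_sum f g p - J) < e"
    using J e unfolding has_rs_integral_def by meson
  obtain d3 where d3: "d3 > 0"
    "\<And>p. p tagged_division_of {a..c} \<Longrightarrow> (\<lambda>x. ball x d3) fine p \<Longrightarrow> norm (rs_sum f g p - M) < e"
    using M e unfolding has_rs_integral_def by meson
  define d where "d = min d1 (min d2 d3)"
  have d: "d > 0" "d \<le> d1" "d \<le> d2" "d \<le> d3" using d1 d2 d3 by (auto simp: d_def)
  obtain p where p: "p tagged_division_of {a..b}" "(\<lambda>x. ball x d) fine p"
    using fine_division_exists_real[of "\<lambda>x. ball x d" a b] d(1) by (metis gauge_ball)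
  obtain q where q: "q tagged_division_of {b..c}" "(\<lambda>x. ball x d) fine q"
    using fine_division_exists_real[of "\<lambda>x. ball x d" b c] d(1) by (metis gauge_ball)
  have pq: "(p \<union> q) tagged_division_of {a..c}"
    using tagged_division_Un[OF p(1) q(1)] le by (auto simp: ivl_disj_un_two_touch)
  have "rs_sum f g (p \<union> q) = rs_sum f g p + rs_sum f g q"
  proof (rule sum.union_inter_neutral)
    \<comment> \<open>A tagged interval belonging to both divisions is \<open>{b}\<close>, on which \<open>g\<close> has no increment.\<close>
    show "\<forall>z\<in>p \<inter> q. (case z of (x, K) \<Rightarrow> (g (Sup K) - g (Inf K)) *\<^sub>R f x) = 0"
    proof clarify
      fix x K assume "(x, K) \<in> p" "(x, K) \<in> q"
      then have "Inf K = Sup K"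
        by (elim tagged_division_real_interval[OF p(1)] tagged_division_real_interval[OF q(1)]) auto
      then show "(g (Sup K) - g (Inf K)) *\<^sub>R f x = 0" by simp
    qed
  qed (use p q in auto)
  moreover have "norm (rs_sum f g p - I) < e"
    by (rule d1(2)[OF p(1) fine_ball_mono[OF p(2) d(2)]])
  moreover have "norm (rs_sum f g q - J) < e"
    by (rule d2(2)[OF q(1) fine_ball_mono[OF q(2) d(3)]])
  moreover have "norm (rs_sum f g (p \<union> q) - M) < e"
    by (rule d3(2)[OF pq fine_ball_mono[OF fine_Un[OF p(2) q(2)] d(4)]])
  moreover have "norm (M - (I + J)) \<le> norm (rs_sum f g p - I) + norm (rs_sum f g q - J)
      + norm (rs_sum f g p + rs_sum f g q - M)"
  proof -
    have "norm (M - (I + J)) =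
        norm ((rs_sum f g p - I) + (rs_sum f g q - J) - (rs_sum f g p + rs_sum f g q - M))"
      by (rule arg_cong[where f = norm]) simp
    also have "\<dots> \<le> norm ((rs_sum f g p - I) + (rs_sum f g q - J)) + norm (rs_sum f g p + rs_sum f g q - M)"
      by (rule norm_triangle_ineq4)
    also have "\<dots> \<le> norm (rs_sum f g p - I) + norm (rs_sum f g q - J) + norm (rs_sum f g p + rs_sum f g q - M)"
      by (intro add_right_mono norm_triangle_ineq)
    finally show ?thesis .
  qed
  ultimately show False by (simp add: e_def)
qed

text \<open>
  Over a short interval \<open>{u..v}\<close> the integral differs from \<open>(g v - g u) *\<^sub>R f u\<close> by at most the
  oscillation of \<open>f\<close> times the total variation, and \<open>(g v - g u) *\<^sub>R f u\<close> is small because \<open>g\<close> is continuous.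
\<close>

lemma continuous_on_rs_integral:
  fixes f :: "real \<Rightarrow> 'a::banach"
  assumes L: "controlled_by a b L g" and f: "continuous_on {a..b} f" and g: "continuous_on {a..b} g"
  shows "continuous_on {a..b} (\<lambda>t. rs_integral a t f g)"
proof (cases "a \<le> b")
  case ab: True
  have Lab: "L b - L a \<ge> 0" using controlled_by_mono[OF L, of a b] ab by simp
  obtain B where B: "B > 0" "\<And>x. x \<in> {a..b} \<Longrightarrow> norm (f x) \<le> B"
    using compact_imp_bounded[OF compact_continuous_image[OF f]]
    by (metis bounded_pos compact_Icc imageI)
  have key: "\<exists>d>0. \<forall>u v. a \<le> u \<and> u \<le> v \<and> v \<le> b \<and> v - u < d \<longrightarrow>
      norm (rs_integral a v f g - rs_integral a u f g) < e" if e: "e > 0" for e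
  proof -
    define e1 where "e1 = e / (2 * (L b - L a + 1))"
    have e1: "e1 > 0" "e1 * (L b - L a) < e / 2"
      using e Lab by (auto simp: e1_def field_simps add_pos_nonneg)
    have "uniformly_continuous_on {a..b} f" "uniformly_continuous_on {a..b} g"
      by (intro compact_uniformly_continuous f g; simp)+
    moreover have "e / (2 * B) > 0" using e B by simp
    ultimately obtain d1 d2 where
      d1: "d1 > 0" "\<And>x y. x \<in> {a..b} \<Longrightarrow> y \<in> {a..b} \<Longrightarrow> dist y x < d1 \<Longrightarrow> dist (f y) (f x) < e1"
      and d2: "d2 > 0" "\<And>x y. x \<in> {a..b} \<Longrightarrow> y \<in> {a..b} \<Longrightarrow> dist y x < d2 \<Longrightarrow> dist (g y) (g x) < e / (2 * B)"
      using e1(1) unfolding uniformly_continuous_on_def by metis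
    show ?thesis
    proof (intro exI[of _ "min d1 d2"] conjI allI impI)
      fix u v assume *: "a \<le> u \<and> u \<le> v \<and> v \<le> b \<and> v - u < min d1 d2"
      have ex: "has_rs_integral f g (rs_integral x y f g) x y" if "a \<le> x" "x \<le> y" "y \<le> b" for x y
        using that by (intro has_rs_integral_exists[OF controlled_by_subinterval[OF L]]
            continuous_on_subset[OF f]) auto
      have split: "rs_integral a v f g = rs_integral a u f g + rs_integral u v f g"
        using * by (intro has_rs_integral_combine[OF ex ex ex]) auto
      have "has_rs_integral (\<lambda>x. f x + - f u) g (rs_integral u v f g + (g v - g u) *\<^sub>R (- f u)) u v"
        using * by (intro has_rs_integral_add ex has_rs_integral_const) auto
      then have "norm (rs_integral u v f g + (g v - g u) *\<^sub>R (- f u)) \<le> e1 * L v - e1 * L u"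
      proof (rule has_rs_integral_bound)
        show "controlled_by u v L g" using * by (intro controlled_by_subinterval[OF L]) auto
        fix x y assume xy: "u \<le> x" "x \<le> y" "y \<le> v"
        have "norm (f x + - f u) \<le> e1"
          using d1(2)[of u x] xy * by (simp add: dist_norm dist_real_def less_imp_le)
        then have "norm (f x + - f u) * (L y - L x) \<le> e1 * (L y - L x)"
          using controlled_by_mono[OF L, of x y] xy * by (intro mult_right_mono) auto
        then show "norm (f x + - f u) * (L y - L x) \<le> e1 * L y - e1 * L x"
          by (simp add: right_diff_distrib)
      qed (use * in auto)
      moreover have "e1 * L v - e1 * L u \<le> e1 * (L b - L a)"
        using controlled_by_mono[OF L, of v b] controlled_by_mono[OF L, of a u] * e1(1)
        by (simp add: right_diff_distrib[symmetric])
      moreover have "norm ((g v - g u) *\<^sub>R f u) < e / 2"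
      proof -
        have "\<bar>g v - g u\<bar> < e / (2 * B)"
          using d2(2)[of u v] * by (simp add: dist_real_def)
        then have "\<bar>g v - g u\<bar> * norm (f u) \<le> \<bar>g v - g u\<bar> * B" "\<bar>g v - g u\<bar> * B < e / 2"
          using B(2)[of u] * B(1) by (auto simp: mult_left_mono mult_right_mono field_simps)
        then show ?thesis by simp
      qed
      moreover have "norm (rs_integral u v f g) \<le>
          norm (rs_integral u v f g + (g v - g u) *\<^sub>R (- f u)) + norm ((g v - g u) *\<^sub>R f u)"
        using norm_triangle_ineq[of "rs_integral u v f g + (g v - g u) *\<^sub>R (- f u)" "(g v - g u) *\<^sub>R f u"] by simp
      ultimately show "norm (rs_integral a v f g - rs_integral a u f g) < e"
        using split e1(2) by simp
    qed (use d1 d2 in auto)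
  qed
  show ?thesis
    unfolding continuous_on_iff
  proof (intro ballI allI impI)
    fix x e :: real assume x: "x \<in> {a..b}" and e: "e > 0"
    from key[OF e] obtain d where d: "d > 0" "\<And>u v. a \<le> u \<Longrightarrow> u \<le> v \<Longrightarrow> v \<le> b \<Longrightarrow> v - u < d \<Longrightarrow>
      norm (rs_integral a v f g - rs_integral a u f g) < e" by blast
    have "dist (rs_integral a y f g) (rs_integral a x f g) < e" if "y \<in> {a..b}" "dist y x < d" for y
      using d(2)[of x y] d(2)[of y x] x that
      by (cases "x \<le> y") (auto simp: dist_norm dist_real_def norm_minus_commute)
    with d(1) show "\<exists>d>0. \<forall>y\<in>{a..b}. dist y x < d \<longrightarrow>
        dist (rs_integral a y f g) (rs_integral a x f g) < e" by blast
  qed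
qed simp

section \<open>Paths, signatures and the Picard expansion\<close>

lemma path_space_division_sum_le:
  assumes "\<gamma> \<in> path_space T"
  obtains V where "\<And>D. D division_of {0..T} \<Longrightarrow> (\<Sum>K\<in>D. norm (\<gamma> (Sup K) - \<gamma> (Inf K))) \<le> V"
proof
  fix D assume D: "D division_of {0..T}"
  have "ennreal (\<Sum>K\<in>D. norm (\<gamma> (Sup K) - \<gamma> (Inf K))) \<le> one_variation T \<gamma>"
    unfolding one_variation_def using D by (intro SUP_upper) auto
  moreover have "one_variation T \<gamma> < \<infinity>" using assms by (simp add: path_space_def)
  ultimately have "enn2real (ennreal (\<Sum>K\<in>D. norm (\<gamma> (Sup K) - \<gamma> (Inf K)))) \<le> enn2real (one_variation T \<gamma>)"
    by (intro enn2real_mono) auto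
  then show "(\<Sum>K\<in>D. norm (\<gamma> (Sup K) - \<gamma> (Inf K))) \<le> enn2real (one_variation T \<gamma>)"
    by (simp add: sum_nonneg)
qed

text \<open>
  The control is the variation of \<open>\<gamma>\<close> on \<open>{0..t}\<close> as a function of \<open>t\<close>. Its increments dominate those of \<open>\<gamma>\<close>
  because a division of \<open>{0..u}\<close> together with \<open>{u..v}\<close> is a division of \<open>{0..v}\<close>.
\<close>

lemma path_space_controlled:
  fixes \<gamma> :: "real \<Rightarrow> real ^ 'd::finite"
  assumes \<gamma>: "\<gamma> \<in> path_space T"
  obtains L where "L 0 = 0" "\<And>i. controlled_by 0 T L (\<lambda>u. vec_nth (\<gamma> u) i)"
proof -
  define vs where "vs D = (\<Sum>K\<in>D. norm (\<gamma> (Sup K) - \<gamma> (Inf K)))" for D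
  define V where "V t = (SUP D\<in>{D. D division_of {0..t}}. vs D)" for t
  obtain B where B: "\<And>D. D division_of {0..T} \<Longrightarrow> vs D \<le> B"
    using path_space_division_sum_le[OF \<gamma>] unfolding vs_def by blast
  have extend: "insert {u..v} D division_of {0..v} \<and> vs (insert {u..v} D) = vs D + norm (\<gamma> v - \<gamma> u)"
    if D: "D division_of {0..u}" and uv: "0 \<le> u" "u < v" for D u v
  proof
    have new: "{u..v} \<notin> D"
      using division_ofD(2)[OF D, of "{u..v}"] uv by auto
    have "D \<union> {{u..v}} division_of {0..u} \<union> {u..v}"
      using uv by (intro division_disjoint_union[OF D] division_of_self[of u v, unfolded cbox_interval]) auto
    then show "insert {u..v} D division_of {0..v}"
      using uv by (simp add: ivl_disj_un_two_touch)
    show "vs (insert {u..v} D) = vs D + norm (\<gamma> v - \<gamma> u)"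
      unfolding vs_def using new division_ofD(1)[OF D] uv by simp
  qed
  have bdd: "bdd_above (vs ` {D. D division_of {0..t}})" if "0 \<le> t" "t \<le> T" for t
  proof (rule bdd_aboveI2)
    fix D assume "D \<in> {D. D division_of {0..t}}"
    then have D: "D division_of {0..t}" by simp
    show "vs D \<le> B"
    proof (cases "t = T")
      case True
      then show ?thesis using B D by simp
    next
      case False
      then have "vs D + norm (\<gamma> T - \<gamma> t) \<le> B"
        using extend[OF D, of T] B that by fastforce
      then show ?thesis using norm_ge_zero[of "\<gamma> T - \<gamma> t"] by linarith
    qed
  qed
  have ne: "{D. D division_of {0..t}} \<noteq> {}" for t :: real
  proof -
    obtain p where "p division_of cbox 0 t" by (rule elementary_interval)
    then have "p division_of {0..t}" by (simp only: box_real)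
    then show ?thesis by blast
  qed
  have step: "V u + norm (\<gamma> v - \<gamma> u) \<le> V v" if "0 \<le> u" "u \<le> v" "v \<le> T" for u v
  proof (cases "u = v")
    case False
    have "V u \<le> V v - norm (\<gamma> v - \<gamma> u)"
      unfolding V_def[of u]
    proof (rule cSUP_least[OF ne])
      fix D assume "D \<in> {D. D division_of {0..u}}"
      with extend[of D u v] that False have "insert {u..v} D division_of {0..v}"
        "vs (insert {u..v} D) = vs D + norm (\<gamma> v - \<gamma> u)" by auto
      moreover have "vs (insert {u..v} D) \<le> V v"
        unfolding V_def using that calculation(1) by (intro cSUP_upper bdd) auto
      ultimately show "vs D \<le> V v - norm (\<gamma> v - \<gamma> u)" by simp
    qed
    then show ?thesis by simp
  qed simp
  show ?thesis
  proof (rule that[of "\<lambda>t. V t - V 0"])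
    fix i
    show "controlled_by 0 T (\<lambda>t. V t - V 0) (\<lambda>u. vec_nth (\<gamma> u) i)"
      unfolding controlled_by_def
    proof clarify
      fix u v assume uv: "0 \<le> u" "u \<le> v" "v \<le> T"
      have "\<bar>vec_nth (\<gamma> v) i - vec_nth (\<gamma> u) i\<bar> \<le> norm (\<gamma> v - \<gamma> u)"
        using component_le_norm_cart[of "\<gamma> v - \<gamma> u" i] by simp
      with step[OF uv] show "\<bar>vec_nth (\<gamma> v) i - vec_nth (\<gamma> u) i\<bar> \<le> V v - V 0 - (V u - V 0)" by linarith
    qed
  qed simp
qed

lemma power_increment_le:
  fixes x y :: real
  assumes "0 \<le> x" "x \<le> y"
  shows "real (Suc m) * x ^ m * (y - x) \<le> y ^ Suc m - x ^ Suc m"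
proof (induction m)
  case (Suc m)
  have "real (Suc (Suc m)) * x ^ Suc m * (y - x)
      = x * (real (Suc m) * x ^ m * (y - x)) + x ^ Suc m * (y - x)"
    by (simp add: algebra_simps)
  also have "\<dots> \<le> x * (y ^ Suc m - x ^ Suc m) + y ^ Suc m * (y - x)"
    using assms Suc by (intro add_mono mult_left_mono mult_right_mono power_mono) auto
  also have "\<dots> = y ^ Suc (Suc m) - x ^ Suc (Suc m)" by (simp add: algebra_simps)
  finally show ?case .
qed simp

lemma has_rs_integral_power_bound:
  fixes f :: "real \<Rightarrow> 'a::real_normed_vector"
  assumes I: "has_rs_integral f g I 0 t" and L: "controlled_by 0 t L g" "L 0 = 0" and t: "0 \<le> t"
    and f: "\<And>u. 0 \<le> u \<Longrightarrow> u \<le> t \<Longrightarrow> norm (f u) \<le> C * (L u ^ m / fact m)" and C: "C \<ge> 0"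
  shows "norm I \<le> C * (L t ^ Suc m / fact (Suc m))"
proof -
  have "norm I \<le> C * (L t ^ Suc m / fact (Suc m)) - C * (L 0 ^ Suc m / fact (Suc m))"
  proof (rule has_rs_integral_bound[OF I L(1) t])
    fix u v assume uv: "0 \<le> u" "u \<le> v" "v \<le> t"
    have Lu: "0 \<le> L u" "L u \<le> L v"
      using controlled_by_mono[OF L(1), of 0 u] controlled_by_mono[OF L(1), of u v] uv L(2) by auto
    have "norm (f u) * (L v - L u) \<le> C * (L u ^ m / fact m) * (L v - L u)"
      using Lu uv by (intro mult_right_mono f) auto
    also have "\<dots> = C * ((real (Suc m) * L u ^ m * (L v - L u)) / fact (Suc m))"
      by (simp add: divide_simps) 
    also have "\<dots> \<le> C * ((L v ^ Suc m - L u ^ Suc m) / fact (Suc m))"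
      using Lu C by (intro mult_left_mono divide_right_mono power_increment_le) auto
    finally show "norm (f u) * (L v - L u) \<le>
        C * (L v ^ Suc m / fact (Suc m)) - C * (L u ^ Suc m / fact (Suc m))"
      by (simp only: diff_divide_distrib right_diff_distrib)
  qed
  then show ?thesis using L(2) by simp
qed

locale controlled_path =
  fixes T :: real and L :: "real \<Rightarrow> real" and \<gamma> :: "real \<Rightarrow> real ^ 'd::finite"
  assumes L0: "L 0 = 0" and L: "\<And>i. controlled_by 0 T L (\<lambda>u. vec_nth (\<gamma> u) i)"
    and \<gamma>_cont: "continuous_on {0..T} \<gamma>"
begin

lemma continuous_on_signature: "continuous_on {0..T} (\<lambda>t. signature m \<gamma> 0 t w)"
proof (induction m arbitrary: w)
  case (Suc m)
  have "continuous_on {0..T} (\<lambda>t. rs_integral 0 t (\<lambda>u. signature m \<gamma> 0 u (butlast w)) (\<lambda>u. vec_nth (\<gamma> u) (last w)))"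
    by (intro continuous_on_rs_integral[OF L] Suc continuous_intros \<gamma>_cont)
  then show ?case by simp
qed simp

lemma has_rs_integral_on_initial_segment:
  fixes f :: "real \<Rightarrow> 'a::banach"
  assumes "continuous_on {0..T} f" "0 \<le> t" "t \<le> T"
  shows "has_rs_integral f (\<lambda>u. vec_nth (\<gamma> u) i) (rs_integral 0 t f (\<lambda>u. vec_nth (\<gamma> u) i)) 0 t"
  using assms by (intro has_rs_integral_exists[OF controlled_by_subinterval[OF L]]
      continuous_on_subset[OF assms(1)]) auto

lemma control_nonneg: "0 \<le> t \<Longrightarrow> t \<le> T \<Longrightarrow> 0 \<le> L t"
  using controlled_by_mono[OF L, of 0 t] L0 by simp

lemma signature_bound:
  assumes "0 \<le> t" "t \<le> T"
  shows "\<bar>signature m \<gamma> 0 t w\<bar> \<le> L t ^ m / fact m"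
  using assms
proof (induction m arbitrary: w t)
  case (Suc m)
  have "norm (signature (Suc m) \<gamma> 0 t w) \<le> 1 * (L t ^ Suc m / fact (Suc m))"
    unfolding signature.simps(2)
  proof (rule has_rs_integral_power_bound[where L = L])
    show "has_rs_integral (\<lambda>u. signature m \<gamma> 0 u (butlast w)) (\<lambda>u. vec_nth (\<gamma> u) (last w))
        (rs_integral 0 t (\<lambda>u. signature m \<gamma> 0 u (butlast w)) (\<lambda>u. vec_nth (\<gamma> u) (last w))) 0 t"
      by (intro has_rs_integral_on_initial_segment continuous_on_signature Suc.prems)
    show "controlled_by 0 t L (\<lambda>u. vec_nth (\<gamma> u) (last w))"
      using Suc.prems by (intro controlled_by_subinterval[OF L]) auto
  qed (use Suc L0 in auto)
  then show ?case by simp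
qed simp

end

lemma finite_words: "finite {w :: 'd::finite list. length w = m}"
  using finite_lists_length_eq[of "UNIV :: 'd set" m] by simp

lemma card_words: "card {w :: 'd::finite list. length w = m} = CARD('d) ^ m"
  using card_lists_length_eq[of "UNIV :: 'd set" m] by simp

lemma sum_words_snoc:
  "(\<Sum>w :: 'd::finite list | length w = Suc m. f w) = (\<Sum>i\<in>UNIV. \<Sum>w | length w = m. f (w @ [i]))"
proof -
  have "(\<Sum>w :: 'd list | length w = Suc m. f w)
      = (\<Sum>(i, w)\<in>UNIV \<times> {w. length w = m}. f (w @ [i]))"
    by (rule sum.reindex_bij_witness[of _ "\<lambda>(i, w). w @ [i]" "\<lambda>w. (last w, butlast w)"])
      (auto intro!: arg_cong[of _ _ f] append_butlast_last_id)
  then show ?thesis by (simp add: sum.cartesian_product)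
qed

text \<open>The entries of the product \<open>M i\<^sub>1 \<cdots> M i\<^sub>m\<close> of \<open>N \<times> N\<close> matrices along a word.\<close>

primrec word_entry :: "nat \<Rightarrow> ('d \<Rightarrow> nat \<Rightarrow> nat \<Rightarrow> complex) \<Rightarrow> 'd list \<Rightarrow> nat \<Rightarrow> nat \<Rightarrow> complex" where
  "word_entry N M [] = (\<lambda>j k. if j = k then 1 else 0)"
| "word_entry N M (i # w) = (\<lambda>j k. \<Sum>l<N. M i j l * word_entry N M w l k)"

lemma word_entry_snoc:
  assumes "j < N" "k < N"
  shows "word_entry N M (w @ [i]) j k = (\<Sum>l<N. word_entry N M w j l * M i l k)"
  using assms(1)
proof (induction w arbitrary: j)
  case Nil
  have "(\<Sum>l<N. M i j l * (if l = k then 1 else 0)) = M i j k"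
    using assms(2) by (subst sum.remove[of _ k]) auto
  moreover have "(\<Sum>l<N. (if j = l then 1 else 0) * M i l k) = M i j k"
    using Nil by (subst sum.remove[of _ j]) auto
  ultimately show ?case by simp
next
  case (Cons a w)
  have "word_entry N M ((a # w) @ [i]) j k =
      (\<Sum>l<N. \<Sum>l'<N. M a j l * (word_entry N M w l l' * M i l' k))"
    using Cons.IH by (simp add: sum_distrib_left)
  also have "\<dots> = (\<Sum>l'<N. (\<Sum>l<N. M a j l * word_entry N M w l l') * M i l' k)"
    by (subst sum.swap) (simp add: sum_distrib_right mult.assoc)
  finally show ?case by simp
qed

text \<open>The term of degree \<open>m\<close> in the series solution of \<open>dZ = \<Sum>\<^sub>i Z M\<^sub>i d\<gamma>\<^sup>i\<close>.\<close>

definition picard_term ::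
  "(real \<Rightarrow> real ^ 'd::finite) \<Rightarrow> nat \<Rightarrow> ('d \<Rightarrow> nat \<Rightarrow> nat \<Rightarrow> complex) \<Rightarrow> real \<Rightarrow> nat \<Rightarrow> nat \<Rightarrow> nat \<Rightarrow> complex"
where
  "picard_term \<gamma> N M t m j k =
     (\<Sum>w | length w = m. of_real (signature m \<gamma> 0 t w) * word_entry N M w j k)"

context controlled_path
begin

lemma continuous_on_picard_term: "continuous_on {0..T} (\<lambda>t. picard_term \<gamma> N M t m j k)"
  unfolding picard_term_def
  by (intro continuous_intros continuous_on_signature)

lemma picard_term_Suc:
  assumes t: "0 \<le> t" "t \<le> T" and jk: "j < N" "k < N"
  shows "picard_term \<gamma> N M t (Suc m) j k =
    (\<Sum>i\<in>UNIV. rs_integral 0 t (\<lambda>u. \<Sum>l<N. picard_term \<gamma> N M u m j l * M i l k) (\<lambda>u. vec_nth (\<gamma> u) i))"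
proof -
  have "rs_integral 0 t (\<lambda>u. \<Sum>l<N. picard_term \<gamma> N M u m j l * M i l k) (\<lambda>u. vec_nth (\<gamma> u) i)
      = (\<Sum>w | length w = m. of_real (signature (Suc m) \<gamma> 0 t (w @ [i])) * word_entry N M (w @ [i]) j k)" for i
  proof (rule rs_integral_eq)
    have "has_rs_integral (\<lambda>u. \<Sum>w | length w = m. of_real (signature m \<gamma> 0 u w) * word_entry N M (w @ [i]) j k)
        (\<lambda>u. vec_nth (\<gamma> u) i)
        (\<Sum>w | length w = m. of_real (signature (Suc m) \<gamma> 0 t (w @ [i])) * word_entry N M (w @ [i]) j k) 0 t"
    proof (intro has_rs_integral_sum finite_words t)
      fix w :: "'d list"
      have "has_rs_integral (\<lambda>u. signature m \<gamma> 0 u w) (\<lambda>u. vec_nth (\<gamma> u) i) (signature (Suc m) \<gamma> 0 t (w @ [i])) 0 t"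
        using has_rs_integral_on_initial_segment[OF continuous_on_signature t, of m w i] by simp
      then show "has_rs_integral (\<lambda>u. of_real (signature m \<gamma> 0 u w) * word_entry N M (w @ [i]) j k)
          (\<lambda>u. vec_nth (\<gamma> u) i) (of_real (signature (Suc m) \<gamma> 0 t (w @ [i])) * word_entry N M (w @ [i]) j k) 0 t"
        by (intro has_rs_integral_bounded_linear[where h = "\<lambda>x. of_real x * word_entry N M (w @ [i]) j k"]
          bounded_linear_mult_const[OF bounded_linear_of_real])
    qed
    also have "(\<lambda>u. \<Sum>w | length w = m. of_real (signature m \<gamma> 0 u w) * word_entry N M (w @ [i]) j k)
        = (\<lambda>u. \<Sum>l<N. picard_term \<gamma> N M u m j l * M i l k)"
    proof
      fix u
      show "(\<Sum>w | length w = m. of_real (signature m \<gamma> 0 u w) * word_entry N M (w @ [i]) j k)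
          = (\<Sum>l<N. picard_term \<gamma> N M u m j l * M i l k)"
        unfolding picard_term_def
        by (simp add: word_entry_snoc[OF jk] sum_distrib_left sum_distrib_right mult.assoc sum.swap[of _ "{..<N}"])
    qed
    finally show "has_rs_integral (\<lambda>u. \<Sum>l<N. picard_term \<gamma> N M u m j l * M i l k) (\<lambda>u. vec_nth (\<gamma> u) i)
        (\<Sum>w | length w = m. of_real (signature (Suc m) \<gamma> 0 t (w @ [i])) * word_entry N M (w @ [i]) j k) 0 t" .
  qed
  then show ?thesis by (simp add: picard_term_def sum_words_snoc del: signature.simps)
qed

text \<open>
  Picard iteration applied to a given solution: the remainder \<open>R m\<close> after the terms of degree \<open>< m\<close> is an
  \<open>m\<close>-fold iterated integral of the bounded function \<open>Z\<close>, hence of size \<open>C (c L(t))\<^sup>m / m!\<close>. Every solution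
  is thus the sum of the series.
\<close>

lemma picard_series:
  assumes Z_cont: "\<And>j k. j < N \<Longrightarrow> k < N \<Longrightarrow> continuous_on {0..T} (\<lambda>t. Z t j k)"
    and Z_eq: "\<And>t j k. 0 \<le> t \<Longrightarrow> t \<le> T \<Longrightarrow> j < N \<Longrightarrow> k < N \<Longrightarrow> Z t j k = (if j = k then 1 else 0) +
      (\<Sum>i\<in>UNIV. rs_integral 0 t (\<lambda>u. \<Sum>l<N. Z u j l * M i l k) (\<lambda>u. vec_nth (\<gamma> u) i))"
    and t: "0 \<le> t" "t \<le> T" and jk: "j < N" "k < N"
  shows "(\<lambda>m. picard_term \<gamma> N M t m j k) sums Z t j k"
proof -
  define R where "R m t j k = Z t j k - (\<Sum>n<m. picard_term \<gamma> N M t n j k)" for m t j k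
  define c where "c = (\<Sum>i\<in>UNIV. \<Sum>l<N. \<Sum>k<N. cmod (M i l k))"
  have R_cont: "continuous_on {0..T} (\<lambda>t. R m t j k)" if "j < N" "k < N" for m j k
    unfolding R_def by (intro continuous_intros continuous_on_picard_term Z_cont that)
  have R_Suc: "R (Suc m) t j k =
      (\<Sum>i\<in>UNIV. rs_integral 0 t (\<lambda>u. \<Sum>l<N. R m u j l * M i l k) (\<lambda>u. vec_nth (\<gamma> u) i))"
    if t: "0 \<le> t" "t \<le> T" and jk: "j < N" "k < N" for m t j k
  proof (induction m)
    case 0
    have "picard_term \<gamma> N M t 0 j k = (if j = k then 1 else 0)" by (simp add: picard_term_def)
    then show ?case using Z_eq[OF t jk] by (simp add: R_def)
  next
    case (Suc m)
    have "rs_integral 0 t (\<lambda>u. \<Sum>l<N. R m u j l * M i l k) (\<lambda>u. vec_nth (\<gamma> u) i) =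
        rs_integral 0 t (\<lambda>u. \<Sum>l<N. R (Suc m) u j l * M i l k) (\<lambda>u. vec_nth (\<gamma> u) i) +
        rs_integral 0 t (\<lambda>u. \<Sum>l<N. picard_term \<gamma> N M u m j l * M i l k) (\<lambda>u. vec_nth (\<gamma> u) i)" for i
    proof (rule rs_integral_eq)
      have "has_rs_integral (\<lambda>u. (\<Sum>l<N. R (Suc m) u j l * M i l k) + (\<Sum>l<N. picard_term \<gamma> N M u m j l * M i l k))
        (\<lambda>u. vec_nth (\<gamma> u) i)
        (rs_integral 0 t (\<lambda>u. \<Sum>l<N. R (Suc m) u j l * M i l k) (\<lambda>u. vec_nth (\<gamma> u) i) +
         rs_integral 0 t (\<lambda>u. \<Sum>l<N. picard_term \<gamma> N M u m j l * M i l k) (\<lambda>u. vec_nth (\<gamma> u) i)) 0 t"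
        using jk by (intro has_rs_integral_add has_rs_integral_on_initial_segment[OF _ t] continuous_intros R_cont
            continuous_on_picard_term) auto
      then show "has_rs_integral (\<lambda>u. \<Sum>l<N. R m u j l * M i l k) (\<lambda>u. vec_nth (\<gamma> u) i)
        (rs_integral 0 t (\<lambda>u. \<Sum>l<N. R (Suc m) u j l * M i l k) (\<lambda>u. vec_nth (\<gamma> u) i) +
         rs_integral 0 t (\<lambda>u. \<Sum>l<N. picard_term \<gamma> N M u m j l * M i l k) (\<lambda>u. vec_nth (\<gamma> u) i)) 0 t"
        by (simp add: R_def sum.distrib[symmetric] algebra_simps)
    qed
    moreover have "R (Suc (Suc m)) t j k = R (Suc m) t j k - picard_term \<gamma> N M t (Suc m) j k"
      by (simp add: R_def)
    ultimately show ?case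
      using Suc picard_term_Suc[OF t jk, where m = m] by (simp add: sum.distrib)
  qed
  have "\<exists>B. \<forall>t\<in>{0..T}. cmod (Z t j k) \<le> B" if "j < N" "k < N" for j k
    using compact_imp_bounded[OF compact_continuous_image[OF Z_cont[OF that]]]
    unfolding bounded_iff by auto
  then obtain B where B: "\<And>t j k. t \<in> {0..T} \<Longrightarrow> j < N \<Longrightarrow> k < N \<Longrightarrow> cmod (Z t j k) \<le> B j k"
    using that[of "\<lambda>j k. SOME B. \<forall>t\<in>{0..T}. cmod (Z t j k) \<le> B"] someI_ex by (metis (no_types, lifting))
  define C where "C = (\<Sum>j<N. \<Sum>k<N. \<bar>B j k\<bar>)"
  have Z_le: "cmod (Z t j k) \<le> C" if "0 \<le> t" "t \<le> T" "j < N" "k < N" for t j k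
  proof -
    have "cmod (Z t j k) \<le> \<bar>B j k\<bar>" using B[of t j k] that by simp
    also have "\<dots> \<le> (\<Sum>k<N. \<bar>B j k\<bar>)" using that by (intro member_le_sum) auto
    also have "\<dots> \<le> C" unfolding C_def using that
      by (intro member_le_sum[of j "{..<N}" "\<lambda>j. \<Sum>k<N. \<bar>B j k\<bar>"]) (auto intro: sum_nonneg)
    finally show ?thesis .
  qed
  have C: "C \<ge> 0" and c: "c \<ge> 0" unfolding C_def c_def by (intro sum_nonneg; simp)+
  have R_le: "cmod (R m t j k) \<le> C * c ^ m * (L t ^ m / fact m)"
    if "0 \<le> t" "t \<le> T" "j < N" "k < N" for m t j k
    using that
  proof (induction m arbitrary: t j k)
    case 0
    then show ?case using Z_le by (simp add: R_def)
  next
    case (Suc m)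
    have int: "cmod (rs_integral 0 t (\<lambda>u. \<Sum>l<N. R m u j l * M i l k) (\<lambda>u. vec_nth (\<gamma> u) i))
        \<le> C * c ^ m * (\<Sum>l<N. cmod (M i l k)) * (L t ^ Suc m / fact (Suc m))" for i
    proof (rule has_rs_integral_power_bound[where L = L])
      show "has_rs_integral (\<lambda>u. \<Sum>l<N. R m u j l * M i l k) (\<lambda>u. vec_nth (\<gamma> u) i)
          (rs_integral 0 t (\<lambda>u. \<Sum>l<N. R m u j l * M i l k) (\<lambda>u. vec_nth (\<gamma> u) i)) 0 t"
        using Suc.prems
        by (intro has_rs_integral_on_initial_segment continuous_intros R_cont) auto
      show "controlled_by 0 t L (\<lambda>u. vec_nth (\<gamma> u) i)"
        using Suc.prems by (intro controlled_by_subinterval[OF L]) auto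
      fix u assume u: "0 \<le> u" "u \<le> t"
      have "cmod (\<Sum>l<N. R m u j l * M i l k) \<le> (\<Sum>l<N. C * c ^ m * (L u ^ m / fact m) * cmod (M i l k))"
      proof (rule sum_norm_le)
        fix l assume "l \<in> {..<N}"
        then have "cmod (R m u j l) \<le> C * c ^ m * (L u ^ m / fact m)"
          using Suc.prems u by (intro Suc.IH) auto
        then show "cmod (R m u j l * M i l k) \<le> C * c ^ m * (L u ^ m / fact m) * cmod (M i l k)"
          unfolding norm_mult by (rule mult_right_mono) simp
      qed
      also have "\<dots> = C * c ^ m * (\<Sum>l<N. cmod (M i l k)) * (L u ^ m / fact m)"
        by (simp add: sum_distrib_left sum_distrib_right mult_ac)
      finally show "cmod (\<Sum>l<N. R m u j l * M i l k)
          \<le> C * c ^ m * (\<Sum>l<N. cmod (M i l k)) * (L u ^ m / fact m)" .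
    qed (use C c L0 Suc.prems in \<open>auto intro!: mult_nonneg_nonneg sum_nonneg\<close>)
    have "cmod (R (Suc m) t j k) \<le>
        (\<Sum>i\<in>UNIV. C * c ^ m * (\<Sum>l<N. cmod (M i l k)) * (L t ^ Suc m / fact (Suc m)))"
      unfolding R_Suc[OF Suc.prems] by (intro sum_norm_le int)
    also have "\<dots> = C * c ^ m * (L t ^ Suc m / fact (Suc m)) * (\<Sum>i\<in>UNIV. \<Sum>l<N. cmod (M i l k))"
      by (simp only: sum_distrib_left sum_distrib_right mult_ac)
    also have "\<dots> \<le> C * c ^ m * (L t ^ Suc m / fact (Suc m)) * c"
    proof (rule mult_left_mono)
      show "(\<Sum>i\<in>UNIV. \<Sum>l<N. cmod (M i l k)) \<le> c"
        unfolding c_def using Suc.prems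
        by (intro sum_mono member_le_sum[of k "{..<N}" "\<lambda>k. cmod (M _ _ k)"]) auto
      show "0 \<le> C * c ^ m * (L t ^ Suc m / fact (Suc m))"
        using C c control_nonneg[OF Suc.prems(1,2)] by simp
    qed
    finally show ?case by (simp add: mult_ac)
  qed
  have "(\<lambda>m. (c * L t) ^ m / fact m) \<longlonglongrightarrow> 0"
    using summable_LIMSEQ_zero[OF summable_exp[of "c * L t"]] by (simp add: divide_inverse mult.commute)
  then have lim: "(\<lambda>m. C * ((c * L t) ^ m / fact m)) \<longlonglongrightarrow> 0"
    by (rule tendsto_mult_right_zero)
  have bd: "norm (R m t j k) \<le> C * ((c * L t) ^ m / fact m)" for m
    using R_le[OF t jk, of m] by (simp add: power_mult_distrib mult.assoc)
  have "(\<lambda>m. R m t j k) \<longlonglongrightarrow> 0"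
    by (rule Lim_null_comparison[OF always_eventually[OF allI[OF bd]] lim])
  then have "(\<lambda>m. Z t j k - R m t j k) \<longlonglongrightarrow> Z t j k - 0" by (intro tendsto_intros)
  then show ?thesis by (simp add: sums_def R_def)
qed

end

section \<open>Operator norms and the series for the inner product\<close>

lemma cvec_norm_mult_entries_le:
  assumes A: "A \<in> carrier_mat N N" and v: "v \<in> carrier_vec N" "cvec_norm v \<le> 1"
  shows "cvec_norm (A *\<^sub>v v) \<le> (\<Sum>j<N. \<Sum>l<N. cmod (A $$ (j, l)))"
proof -
  have v1: "cmod (v $ l) \<le> 1" if "l < N" for l
    using member_le_L2_set[of "{..<N}" l "\<lambda>j. cmod (v $ j)"] that v by (simp add: cvec_norm_def)
  have "cvec_norm (A *\<^sub>v v) \<le> (\<Sum>j<N. cmod ((A *\<^sub>v v) $ j))"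
    unfolding cvec_norm_def using A by (intro order_trans[OF L2_set_le_sum]) auto
  also have "\<dots> \<le> (\<Sum>j<N. \<Sum>l<N. cmod (A $$ (j, l)))"
  proof (rule sum_mono)
    fix j assume j: "j \<in> {..<N}"
    then have "cmod ((A *\<^sub>v v) $ j) = cmod (\<Sum>l<N. A $$ (j, l) * v $ l)"
      using A v by (simp add: scalar_prod_def lessThan_atLeast0)
    also have "\<dots> \<le> (\<Sum>l<N. cmod (A $$ (j, l)) * 1)"
      by (intro sum_norm_le) (auto simp: norm_mult intro!: mult_left_le v1)
    finally show "cmod ((A *\<^sub>v v) $ j) \<le> (\<Sum>l<N. cmod (A $$ (j, l)))" by simp
  qed
  finally show ?thesis .
qed

lemma op_norm_upper:
  assumes A: "A \<in> carrier_mat N N" and v: "v \<in> carrier_vec N" "cvec_norm v \<le> 1"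
  shows "cvec_norm (A *\<^sub>v v) \<le> op_norm A"
  unfolding op_norm_def
proof (rule cSUP_upper)
  show "bdd_above ((\<lambda>v. cvec_norm (A *\<^sub>v v)) ` {v \<in> carrier_vec (dim_col A). cvec_norm v \<le> 1})"
    using A cvec_norm_mult_entries_le[OF A] by (intro bdd_aboveI2) auto
qed (use assms in auto)

lemma cvec_norm_zero: "cvec_norm (0\<^sub>v N) = 0"
  by (simp add: cvec_norm_def L2_set_0')

lemma cvec_norm_nonneg: "0 \<le> cvec_norm v"
  by (simp add: cvec_norm_def)

lemma op_norm_least:
  assumes "A \<in> carrier_mat N N" "\<And>v. v \<in> carrier_vec N \<Longrightarrow> cvec_norm v \<le> 1 \<Longrightarrow> cvec_norm (A *\<^sub>v v) \<le> c"
  shows "op_norm A \<le> c"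
  unfolding op_norm_def using assms cvec_norm_zero[of N]
  by (intro cSUP_least) (auto intro: exI[of _ "0\<^sub>v N"])

lemma op_norm_nonneg: "A \<in> carrier_mat N N \<Longrightarrow> 0 \<le> op_norm A"
  using op_norm_upper[of A N "0\<^sub>v N"] cvec_norm_nonneg[of "A *\<^sub>v 0\<^sub>v N"] cvec_norm_zero[of N]
  by (metis order_trans zero_carrier_vec zero_le_one)

lemma L2_set_mult_vec_le:
  assumes A: "A \<in> carrier_mat N N"
  shows "L2_set (\<lambda>j. cmod (\<Sum>l<N. A $$ (j, l) * x l)) {..<N} \<le> op_norm A * L2_set (\<lambda>l. cmod (x l)) {..<N}"
proof (cases "L2_set (\<lambda>l. cmod (x l)) {..<N} = 0")
  case True
  then have "x l = 0" if "l < N" for l using that by (simp add: L2_set_eq_0_iff)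
  then show ?thesis using True by (simp add: L2_set_0')
next
  case False
  define r where "r = L2_set (\<lambda>l. cmod (x l)) {..<N}"
  have r: "r > 0" using False by (simp add: r_def less_le)
  have scale: "L2_set (\<lambda>l. f l * (1 / r)) {..<N} = L2_set f {..<N} / r" for f
    using L2_set_left_distrib[of "1 / r" f "{..<N}"] r by simp
  define v where "v = vec N (\<lambda>l. x l / of_real r)"
  have v: "v \<in> carrier_vec N" by (simp add: v_def)
  have "cvec_norm v = L2_set (\<lambda>l. cmod (x l) * (1 / r)) {..<N}"
    using r by (auto simp: cvec_norm_def v_def norm_divide intro!: L2_set_cong)
  also have "\<dots> = 1" unfolding scale using r by (simp add: r_def[symmetric])
  finally have "cvec_norm (A *\<^sub>v v) \<le> op_norm A" using op_norm_upper[OF A v] by simp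
  moreover have "cvec_norm (A *\<^sub>v v) = L2_set (\<lambda>j. cmod (\<Sum>l<N. A $$ (j, l) * x l) * (1 / r)) {..<N}"
    unfolding cvec_norm_def
  proof (rule L2_set_cong)
    show "{..<dim_vec (A *\<^sub>v v)} = {..<N}" using A by simp
    fix j assume "j \<in> {..<N}"
    then have "(A *\<^sub>v v) $ j = (\<Sum>l<N. A $$ (j, l) * (x l / of_real r))"
      using A by (simp add: scalar_prod_def v_def lessThan_atLeast0)
    also have "\<dots> = (\<Sum>l<N. A $$ (j, l) * x l) / of_real r" by (simp add: sum_divide_distrib)
    finally show "cmod ((A *\<^sub>v v) $ j) = cmod (\<Sum>l<N. A $$ (j, l) * x l) * (1 / r)"
      using r by (simp add: norm_divide)
  qed
  ultimately show ?thesis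
    using r unfolding scale by (simp add: r_def[symmetric] field_simps)
qed

lemma op_norm_diff_le:
  assumes A: "A \<in> carrier_mat N N" and B: "B \<in> carrier_mat N N"
  shows "op_norm A \<le> op_norm B + (\<Sum>j<N. \<Sum>l<N. cmod (A $$ (j, l) - B $$ (j, l)))"
proof (rule op_norm_least[OF A])
  fix v :: "complex vec" assume v: "v \<in> carrier_vec N" "cvec_norm v \<le> 1"
  have AB: "A - B \<in> carrier_mat N N" by (rule minus_carrier_mat[OF B])
  have "cvec_norm (A *\<^sub>v v) = L2_set (\<lambda>j. cmod ((B *\<^sub>v v) $ j + ((A - B) *\<^sub>v v) $ j)) {..<N}"
    unfolding cvec_norm_def
  proof (rule L2_set_cong)
    show "{..<dim_vec (A *\<^sub>v v)} = {..<N}" using A by simp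
    fix j assume "j \<in> {..<N}"
    then have "(A *\<^sub>v v) $ j = (B *\<^sub>v v) $ j + ((A - B) *\<^sub>v v) $ j"
      using A B v by (simp add: scalar_prod_def sum.distrib[symmetric] left_diff_distrib)
    then show "cmod ((A *\<^sub>v v) $ j) = cmod ((B *\<^sub>v v) $ j + ((A - B) *\<^sub>v v) $ j)" by simp
  qed
  also have "\<dots> \<le> L2_set (\<lambda>j. cmod ((B *\<^sub>v v) $ j) + cmod (((A - B) *\<^sub>v v) $ j)) {..<N}"
    by (intro L2_set_mono norm_triangle_ineq) auto
  also have "\<dots> \<le> L2_set (\<lambda>j. cmod ((B *\<^sub>v v) $ j)) {..<N} + L2_set (\<lambda>j. cmod (((A - B) *\<^sub>v v) $ j)) {..<N}"
    by (rule L2_set_triangle_ineq)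
  also have "\<dots> = cvec_norm (B *\<^sub>v v) + cvec_norm ((A - B) *\<^sub>v v)"
    using B by (simp add: cvec_norm_def)
  also have "\<dots> \<le> op_norm B + (\<Sum>j<N. \<Sum>l<N. cmod ((A - B) $$ (j, l)))"
    by (intro add_mono op_norm_upper[OF B v] cvec_norm_mult_entries_le[OF AB v])
  also have "\<dots> = op_norm B + (\<Sum>j<N. \<Sum>l<N. cmod (A $$ (j, l) - B $$ (j, l)))"
    using A B by simp
  finally show "cvec_norm (A *\<^sub>v v) \<le> op_norm B + (\<Sum>j<N. \<Sum>l<N. cmod (A $$ (j, l) - B $$ (j, l)))" .
qed

text \<open>
  Lower integrals are not additive, so summing the moment bounds over the letters requires the operator
  norm to be measurable. It is, being a Lipschitz function of the entries.
\<close>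

lemma borel_measurable_op_norm:
  assumes dim: "\<And>\<omega>. \<omega> \<in> space P \<Longrightarrow> A \<omega> \<in> carrier_mat N N"
    and meas: "\<And>m l. m < N \<Longrightarrow> l < N \<Longrightarrow> (\<lambda>\<omega>. A \<omega> $$ (m, l)) \<in> borel_measurable P"
  shows "(\<lambda>\<omega>. op_norm (A \<omega>)) \<in> borel_measurable P"
proof -
  define F where "F x = op_norm (mat N N x)" for x :: "nat \<times> nat \<Rightarrow> complex"
  have F_diff: "\<bar>F y - F x\<bar> \<le> (\<Sum>j<N. \<Sum>l<N. cmod (y (j, l) - x (j, l)))" for x y
    using op_norm_diff_le[of "mat N N x" N "mat N N y"] op_norm_diff_le[of "mat N N y" N "mat N N x"]
    by (simp add: F_def norm_minus_commute)
  have "continuous_on UNIV F"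
    unfolding continuous_on_def
  proof
    fix x :: "nat \<times> nat \<Rightarrow> complex"
    have coord: "((\<lambda>y. y p) \<longlongrightarrow> x p) (at x within UNIV)" for p
      using continuous_on_product_coordinates[of p] unfolding continuous_on_def by blast
    have "((\<lambda>y. \<Sum>j<N. \<Sum>l<N. cmod (y (j, l) - x (j, l))) \<longlongrightarrow> (\<Sum>j<N. \<Sum>l<N. cmod (x (j, l) - x (j, l)))) (at x within UNIV)"
      by (intro tendsto_intros coord)
    then have lim: "((\<lambda>y. \<Sum>j<N. \<Sum>l<N. cmod (y (j, l) - x (j, l))) \<longlongrightarrow> 0) (at x within UNIV)"
      by simp
    have "norm (F y - F x) \<le> (\<Sum>j<N. \<Sum>l<N. cmod (y (j, l) - x (j, l)))" for y
      using F_diff[of y x] by simp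
    then have "((\<lambda>y. F y - F x) \<longlongrightarrow> 0) (at x within UNIV)"
      by (intro Lim_null_comparison[OF always_eventually[OF allI] lim])
    then show "(F \<longlongrightarrow> F x) (at x within UNIV)" by (rule LIM_zero_cancel)
  qed
  then have F: "F \<in> borel_measurable borel" by (rule borel_measurable_continuous_onI)
  define X where "X \<omega> p = (if fst p < N \<and> snd p < N then A \<omega> $$ p else 0)" for \<omega> p
  have "X \<in> borel_measurable P"
  proof (rule measurable_coordinatewise_then_product)
    fix p
    show "(\<lambda>\<omega>. X \<omega> p) \<in> borel_measurable P"
      using meas[of "fst p" "snd p"] by (cases "fst p < N \<and> snd p < N") (auto simp: X_def)
  qed
  then have "(\<lambda>\<omega>. F (X \<omega>)) \<in> borel_measurable P" using F by (rule measurable_compose)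
  moreover have "F (X \<omega>) = op_norm (A \<omega>)" if "\<omega> \<in> space P" for \<omega>
  proof -
    have "mat N N (X \<omega>) = A \<omega>" using dim[OF that] by (intro eq_matI) (auto simp: X_def)
    then show ?thesis by (simp add: F_def)
  qed
  ultimately show ?thesis by (subst measurable_cong[symmetric]) auto
qed

lemma prod_list_map_nonneg:
  fixes b :: "'d \<Rightarrow> real"
  shows "(\<And>i. b i \<ge> 0) \<Longrightarrow> 0 \<le> prod_list (map b w)"
  by (induction w) auto

text \<open>
  A maximum over the letters, bounded by the sum over the letters, takes the place of Hoelder's
  inequality: it leaves only moments of single operator norms to be estimated.
\<close>

lemma prod_list_le_sum_power:
  fixes b :: "'d::finite \<Rightarrow> real"
  assumes b: "\<And>i. b i \<ge> 0"
  shows "prod_list (map b w) \<le> (\<Sum>i\<in>UNIV. b i ^ length w)"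
proof -
  obtain i where i: "\<And>j. b j \<le> b i"
  proof -
    have "Max (range b) \<in> range b" by (intro Max_in) auto
    then obtain i where "Max (range b) = b i" by (rule imageE)
    then have "b j \<le> b i" for j using Max_ge[of "range b" "b j"] by simp
    then show ?thesis by (rule that)
  qed
  have "prod_list (map b w) \<le> b i ^ length w"
  proof (induction w)
    case (Cons j w)
    have "b j * prod_list (map b w) \<le> b i * b i ^ length w"
      using Cons i b by (intro mult_mono prod_list_map_nonneg) auto
    then show ?case by simp
  qed simp
  also have "\<dots> \<le> (\<Sum>i\<in>UNIV. b i ^ length w)"
    using b by (intro member_le_sum[of i UNIV "\<lambda>i. b i ^ length w"]) auto
  finally show ?thesis .
qed

text \<open>The Hilbert--Schmidt inner product of the matrix products along two words.\<close>

definition word_hs :: "nat \<Rightarrow> ('d \<Rightarrow> nat \<Rightarrow> nat \<Rightarrow> complex) \<Rightarrow> 'd list \<Rightarrow> 'd list \<Rightarrow> complex" where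
  "word_hs N M w v = (\<Sum>j<N. \<Sum>k<N. cnj (word_entry N M w j k) * word_entry N M v j k)"

context
  fixes N :: nat and M :: "'d::finite \<Rightarrow> nat \<Rightarrow> nat \<Rightarrow> complex" and b :: "'d \<Rightarrow> real"
  assumes b: "\<And>i. b i \<ge> 0"
    and M_le: "\<And>i x. L2_set (\<lambda>j. cmod (\<Sum>l<N. M i j l * x l)) {..<N} \<le> b i * L2_set (\<lambda>l. cmod (x l)) {..<N}"
begin

text \<open>
  Column by column, each matrix of the product contributes a factor \<open>b i\<close>.
\<close>

lemma L2_set_word_entry_le:
  assumes k: "k < N"
  shows "L2_set (\<lambda>j. cmod (word_entry N M w j k)) {..<N} \<le> prod_list (map b w)"
proof (induction w)
  case Nil
  have "L2_set (\<lambda>j. cmod (if j = k then 1 else 0)) {..<N} = sqrt (\<Sum>j<N. if j = k then 1 else 0)"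
    unfolding L2_set_def by (intro arg_cong[of _ _ sqrt] sum.cong) auto
  then show ?case using k by simp
next
  case (Cons i w)
  have "L2_set (\<lambda>j. cmod (word_entry N M (i # w) j k)) {..<N}
      \<le> b i * L2_set (\<lambda>j. cmod (word_entry N M w j k)) {..<N}"
    using M_le[of i "\<lambda>l. word_entry N M w l k"] by simp
  also have "\<dots> \<le> b i * prod_list (map b w)" using b Cons by (intro mult_left_mono) auto
  finally show ?case by simp
qed

lemma word_entry_le:
  assumes "j < N" "k < N"
  shows "cmod (word_entry N M w j k) \<le> (\<Sum>i\<in>UNIV. b i) ^ length w"
proof -
  have "cmod (word_entry N M w j k) \<le> prod_list (map b w)"
    using member_le_L2_set[of "{..<N}" j "\<lambda>j. cmod (word_entry N M w j k)"] assms
      L2_set_word_entry_le[of k w] by simp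
  also have "\<dots> \<le> (\<Sum>i\<in>UNIV. b i) ^ length w"
  proof (induction w)
    case (Cons i w)
    have "b i \<le> (\<Sum>i\<in>UNIV. b i)" using b by (intro member_le_sum) auto
    with Cons b show ?case by (auto intro!: mult_mono prod_list_map_nonneg sum_nonneg)
  qed simp
  finally show ?thesis .
qed

text \<open>
  Cauchy--Schwarz in each of the \<open>N\<close> columns; the factor \<open>N\<close> is compensated by the normalisation of the
  trace.
\<close>

lemma word_hs_le: "cmod (word_hs N M w v) \<le> real N * (\<Sum>i\<in>UNIV. b i ^ (length w + length v))"
proof -
  have "cmod (word_hs N M w v) = cmod (\<Sum>k<N. \<Sum>j<N. cnj (word_entry N M w j k) * word_entry N M v j k)"
    unfolding word_hs_def by (subst sum.swap) simp
  also have "\<dots> \<le> (\<Sum>k<N. prod_list (map b (w @ v)))"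
  proof (rule sum_norm_le)
    fix k assume "k \<in> {..<N}"
    then have k: "k < N" by simp
    have "cmod (\<Sum>j<N. cnj (word_entry N M w j k) * word_entry N M v j k)
        \<le> (\<Sum>j<N. \<bar>cmod (word_entry N M w j k)\<bar> * \<bar>cmod (word_entry N M v j k)\<bar>)"
      by (rule sum_norm_le) (simp add: norm_mult)
    also have "\<dots> \<le> L2_set (\<lambda>j. cmod (word_entry N M w j k)) {..<N} * L2_set (\<lambda>j. cmod (word_entry N M v j k)) {..<N}"
      by (rule L2_set_mult_ineq)
    also have "\<dots> \<le> prod_list (map b w) * prod_list (map b v)"
      using b by (intro mult_mono L2_set_word_entry_le k) (auto intro!: prod_list_map_nonneg)
    finally show "cmod (\<Sum>j<N. cnj (word_entry N M w j k) * word_entry N M v j k) \<le> prod_list (map b (w @ v))"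
      by simp
  qed
  also have "\<dots> \<le> real N * (\<Sum>i\<in>UNIV. b i ^ (length w + length v))"
    using prod_list_le_sum_power[OF b, where w = "w @ v"] by (simp add: mult_left_mono)
  finally show ?thesis .
qed

end

lemma mat_hs_eq:
  assumes "A \<in> carrier_mat N N" "B \<in> carrier_mat N N"
  shows "mat_hs A B = (\<Sum>j<N. \<Sum>k<N. cnj (A $$ (j, k)) * B $$ (j, k))"
proof -
  have "(mat_adjoint A * B) $$ (k, k) = (\<Sum>j<N. cnj (A $$ (j, k)) * B $$ (j, k))" if "k < N" for k
    using that assms by (simp add: mat_adjoint_def scalar_prod_def mat_of_rows_row lessThan_atLeast0)
  then have "mat_hs A B = (\<Sum>k<N. \<Sum>j<N. cnj (A $$ (j, k)) * B $$ (j, k))"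
    using assms by (simp add: mat_hs_def mat_trace_def mat_adjoint_def)
  then show ?thesis by (subst sum.swap) simp
qed

text \<open>
  The part of total degree \<open>k\<close> of \<open>\<langle>Z\<^sub>\<gamma>(s), Z\<^sub>\<sigma>(t)\<rangle>\<close> in the matrices \<open>M\<close>.
\<close>

definition hs_term ::
  "(real \<Rightarrow> real ^ 'd::finite) \<Rightarrow> (real \<Rightarrow> real ^ 'd) \<Rightarrow> real \<Rightarrow> real \<Rightarrow> nat \<Rightarrow> ('d \<Rightarrow> nat \<Rightarrow> nat \<Rightarrow> complex) \<Rightarrow> nat \<Rightarrow> complex"
where
  "hs_term \<gamma> \<sigma> s t N M k = (\<Sum>n\<le>k. \<Sum>w | length w = n. \<Sum>v | length v = k - n.
     of_real (signature n \<gamma> 0 s w * signature (k - n) \<sigma> 0 t v) * word_hs N M w v)"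

lemma sum_swap_three:
  "(\<Sum>x\<in>A. \<Sum>y\<in>B. \<Sum>z\<in>C. f x y z) = (\<Sum>y\<in>B. \<Sum>z\<in>C. \<Sum>x\<in>A. f x y z)"
  by (subst sum.swap) (rule sum.cong[OF refl], rule sum.swap)

lemma sum_swap_pairs:
  "(\<Sum>x\<in>A. \<Sum>y\<in>B. \<Sum>z\<in>C. \<Sum>u\<in>D. f x y z u) = (\<Sum>z\<in>C. \<Sum>u\<in>D. \<Sum>x\<in>A. \<Sum>y\<in>B. f x y z u)"
proof -
  have "(\<Sum>x\<in>A. \<Sum>y\<in>B. \<Sum>z\<in>C. \<Sum>u\<in>D. f x y z u) = (\<Sum>x\<in>A. \<Sum>z\<in>C. \<Sum>u\<in>D. \<Sum>y\<in>B. f x y z u)"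
    by (rule sum.cong[OF refl], rule sum_swap_three)
  also have "\<dots> = (\<Sum>z\<in>C. \<Sum>u\<in>D. \<Sum>x\<in>A. \<Sum>y\<in>B. f x y z u)" by (rule sum_swap_three)
  finally show ?thesis .
qed

lemma hs_term_picard:
  "hs_term \<gamma> \<sigma> s t N M k =
    (\<Sum>j<N. \<Sum>l<N. \<Sum>n\<le>k. cnj (picard_term \<gamma> N M s n j l) * picard_term \<sigma> N M t (k - n) j l)"
proof -
  have "cnj (picard_term \<gamma> N M s n j l) * picard_term \<sigma> N M t m j l =
      (\<Sum>w | length w = n. \<Sum>v | length v = m. of_real (signature n \<gamma> 0 s w * signature m \<sigma> 0 t v) *
        (cnj (word_entry N M w j l) * word_entry N M v j l))" for n m j l
    unfolding picard_term_def cnj_sum sum_product by (intro sum.cong refl) (simp add: mult_ac)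
  note pq = this
  have "hs_term \<gamma> \<sigma> s t N M k = (\<Sum>n\<le>k. \<Sum>w | length w = n. \<Sum>v | length v = k - n. \<Sum>j<N. \<Sum>l<N.
      of_real (signature n \<gamma> 0 s w * signature (k - n) \<sigma> 0 t v) *
      (cnj (word_entry N M w j l) * word_entry N M v j l))"
    unfolding hs_term_def word_hs_def sum_distrib_left ..
  also have "\<dots> = (\<Sum>n\<le>k. \<Sum>j<N. \<Sum>l<N. cnj (picard_term \<gamma> N M s n j l) * picard_term \<sigma> N M t (k - n) j l)"
    unfolding pq by (rule sum.cong[OF refl], rule sum_swap_pairs)
  also have "\<dots> = (\<Sum>j<N. \<Sum>l<N. \<Sum>n\<le>k. cnj (picard_term \<gamma> N M s n j l) * picard_term \<sigma> N M t (k - n) j l)"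
    by (rule sum_swap_three)
  finally show ?thesis .
qed

lemma binomial_fact_sum:
  fixes a b :: real
  shows "(\<Sum>n\<le>k. a ^ n / fact n * (b ^ (k - n) / fact (k - n))) = (a + b) ^ k / fact k"
proof -
  have "a ^ n / fact n * (b ^ (k - n) / fact (k - n)) = real (k choose n) * a ^ n * b ^ (k - n) / fact k"
    if "n \<le> k" for n
    using that by (simp add: binomial_fact)
  then show ?thesis by (simp add: binomial_ring sum_divide_distrib)
qed

context controlled_path
begin

lemma sum_signature_le:
  assumes "0 \<le> t" "t \<le> T"
  shows "(\<Sum>w | length w = m. \<bar>signature m \<gamma> 0 t w\<bar>) \<le> (real CARD('d) * L t) ^ m / fact m"
proof -
  have "(\<Sum>w | length w = m. \<bar>signature m \<gamma> 0 t w\<bar>) \<le> (\<Sum>w :: 'd list | length w = m. L t ^ m / fact m)"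
    by (intro sum_mono signature_bound[OF assms])
  also have "\<dots> = (real CARD('d) * L t) ^ m / fact m"
    by (simp add: card_words power_mult_distrib)
  finally show ?thesis .
qed

lemma summable_picard_term:
  fixes b :: "'d \<Rightarrow> real"
  assumes b: "\<And>i. b i \<ge> 0"
    and M_le: "\<And>i x. L2_set (\<lambda>j. cmod (\<Sum>l<N. M i j l * x l)) {..<N} \<le> b i * L2_set (\<lambda>l. cmod (x l)) {..<N}"
    and t: "0 \<le> t" "t \<le> T" and jl: "j < N" "l < N"
  shows "summable (\<lambda>m. cmod (picard_term \<gamma> N M t m j l))"
proof (rule summable_comparison_test')
  let ?x = "real CARD('d) * L t" and ?c = "\<Sum>i\<in>UNIV. b i"
  show "summable (\<lambda>m. (?x * ?c) ^ m / fact m)"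
    using summable_exp[of "?x * ?c"] by (simp add: divide_inverse mult.commute)
  fix m
  have "cmod (picard_term \<gamma> N M t m j l) \<le> (\<Sum>w | length w = m. \<bar>signature m \<gamma> 0 t w\<bar> * ?c ^ m)"
    unfolding picard_term_def
    using word_entry_le[OF b M_le jl] by (intro sum_norm_le) (auto simp: norm_mult intro!: mult_left_mono)
  also have "\<dots> \<le> ?x ^ m / fact m * ?c ^ m"
    unfolding sum_distrib_right[symmetric] using b
    by (intro mult_right_mono sum_signature_le t) (auto intro!: sum_nonneg zero_le_power)
  finally show "norm (cmod (picard_term \<gamma> N M t m j l)) \<le> (?x * ?c) ^ m / fact m"
    by (simp add: power_mult_distrib)
qed

end

context
  fixes T :: real and L K :: "real \<Rightarrow> real" and \<gamma> \<sigma> :: "real \<Rightarrow> real ^ 'd::finite"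
    and N :: nat and M :: "'d \<Rightarrow> nat \<Rightarrow> nat \<Rightarrow> complex" and b :: "'d \<Rightarrow> real"
  assumes \<gamma>: "controlled_path T L \<gamma>" and \<sigma>: "controlled_path T K \<sigma>"
    and b: "\<And>i. b i \<ge> 0"
    and M_le: "\<And>i x. L2_set (\<lambda>j. cmod (\<Sum>l<N. M i j l * x l)) {..<N} \<le> b i * L2_set (\<lambda>l. cmod (x l)) {..<N}"
begin

lemma hs_term_le:
  assumes s: "0 \<le> s" "s \<le> T" and t: "0 \<le> t" "t \<le> T"
  shows "cmod (hs_term \<gamma> \<sigma> s t N M k) \<le>
    real N * ((real CARD('d) * (L s + K t)) ^ k / fact k) * (\<Sum>i\<in>UNIV. b i ^ k)"
proof -
  let ?x = "real CARD('d) * L s" and ?y = "real CARD('d) * K t"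
  let ?B = "real N * (\<Sum>i\<in>UNIV. b i ^ k)"
  have B: "?B \<ge> 0" using b by (intro mult_nonneg_nonneg sum_nonneg) auto
  have "cmod (hs_term \<gamma> \<sigma> s t N M k) \<le> (\<Sum>n\<le>k. (?x ^ n / fact n * (?y ^ (k - n) / fact (k - n))) * ?B)"
    unfolding hs_term_def
  proof (rule sum_norm_le)
    fix n assume n: "n \<in> {..k}"
    have "cmod (\<Sum>w | length w = n. \<Sum>v | length v = k - n.
        of_real (signature n \<gamma> 0 s w * signature (k - n) \<sigma> 0 t v) * word_hs N M w v)
      \<le> (\<Sum>w | length w = n. \<Sum>v | length v = k - n.
        \<bar>signature n \<gamma> 0 s w\<bar> * \<bar>signature (k - n) \<sigma> 0 t v\<bar> * ?B)"
    proof (intro sum_norm_le)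
      fix w v :: "'d list" assume "w \<in> {w. length w = n}" "v \<in> {v. length v = k - n}"
      then have "length w + length v = k" using n by simp
      then show "cmod (of_real (signature n \<gamma> 0 s w * signature (k - n) \<sigma> 0 t v) * word_hs N M w v)
          \<le> \<bar>signature n \<gamma> 0 s w\<bar> * \<bar>signature (k - n) \<sigma> 0 t v\<bar> * ?B"
        using word_hs_le[OF b M_le, where w = w and v = v] by (auto simp: norm_mult abs_mult intro!: mult_left_mono)
    qed
    also have "\<dots> = (\<Sum>w | length w = n. \<bar>signature n \<gamma> 0 s w\<bar>) *
        (\<Sum>v | length v = k - n. \<bar>signature (k - n) \<sigma> 0 t v\<bar>) * ?B"
      unfolding sum_product unfolding sum_distrib_right ..
    also have "\<dots> \<le> (?x ^ n / fact n * (?y ^ (k - n) / fact (k - n))) * ?B"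
      using B s t controlled_path.control_nonneg[OF \<gamma> s]
      by (intro mult_right_mono mult_mono controlled_path.sum_signature_le[OF \<gamma>] controlled_path.sum_signature_le[OF \<sigma>]) (auto intro: sum_nonneg)
    finally show "cmod (\<Sum>w | length w = n. \<Sum>v | length v = k - n.
        of_real (signature n \<gamma> 0 s w * signature (k - n) \<sigma> 0 t v) * word_hs N M w v)
      \<le> (?x ^ n / fact n * (?y ^ (k - n) / fact (k - n))) * ?B" .
  qed
  also have "\<dots> = (?x + ?y) ^ k / fact k * ?B"
    by (simp only: sum_distrib_right[symmetric] binomial_fact_sum)
  finally show ?thesis by (simp add: distrib_left mult_ac)
qed

text \<open>
  The Cauchy product of the two Picard series, entry by entry.
\<close>

lemma hs_term_sums:
  assumes s: "0 \<le> s" "s \<le> T" and t: "0 \<le> t" "t \<le> T"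
    and Y: "\<And>j l. j < N \<Longrightarrow> l < N \<Longrightarrow> (\<lambda>m. picard_term \<gamma> N M s m j l) sums Y j l"
    and Z: "\<And>j l. j < N \<Longrightarrow> l < N \<Longrightarrow> (\<lambda>m. picard_term \<sigma> N M t m j l) sums Z j l"
  shows "hs_term \<gamma> \<sigma> s t N M sums (\<Sum>j<N. \<Sum>l<N. cnj (Y j l) * Z j l)"
proof -
  have "(\<lambda>k. \<Sum>n\<le>k. cnj (picard_term \<gamma> N M s n j l) * picard_term \<sigma> N M t (k - n) j l)
      sums (cnj (Y j l) * Z j l)" if jl: "j < N" "l < N" for j l
  proof -
    have "(\<lambda>m. cnj (picard_term \<gamma> N M s m j l)) sums cnj (Y j l)"
      using Y[OF jl] by (simp add: sums_cnj)
    then have "(\<Sum>m. cnj (picard_term \<gamma> N M s m j l)) = cnj (Y j l)" by (simp add: sums_iff)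
    moreover have "(\<Sum>m. picard_term \<sigma> N M t m j l) = Z j l" using Z[OF jl] by (simp add: sums_iff)
    ultimately show ?thesis
      using Cauchy_product_sums[of "\<lambda>m. cnj (picard_term \<gamma> N M s m j l)" "\<lambda>m. picard_term \<sigma> N M t m j l"]
        controlled_path.summable_picard_term[OF \<gamma> b M_le s jl] controlled_path.summable_picard_term[OF \<sigma> b M_le t jl] by simp
  qed
  then have "(\<lambda>k. \<Sum>j<N. \<Sum>l<N. \<Sum>n\<le>k. cnj (picard_term \<gamma> N M s n j l) * picard_term \<sigma> N M t (k - n) j l)
      sums (\<Sum>j<N. \<Sum>l<N. cnj (Y j l) * Z j l)"
    by (intro sums_sum) auto
  then show ?thesis by (simp only: hs_term_picard[symmetric])
qed

end

section \<open>Counting pairs of paths all of whose edges are repeated\<close>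

text \<open>
  The steps at which a walk reaches a vertex for the first time.
\<close>

definition discoveries :: "(nat \<Rightarrow> 'a) \<Rightarrow> nat \<Rightarrow> nat set" where
  "discoveries r K = {i \<in> {1..K}. r i \<notin> r ` {..<i}}"

lemma card_range_walk: "card (r ` {..K}) = Suc (card (discoveries r K))"
proof (induction K)
  case 0
  then show ?case by (simp add: discoveries_def)
next
  case (Suc K)
  have fin: "finite (discoveries r K)" by (simp add: discoveries_def)
  have *: "r ` {..Suc K} = insert (r (Suc K)) (r ` {..K})" by (simp add: atMost_Suc)
  show ?case
  proof (cases "r (Suc K) \<in> r ` {..K}")
    case True
    then have "discoveries r (Suc K) = discoveries r K"
      by (auto simp: discoveries_def le_Suc_eq lessThan_Suc_atMost)
    with True Suc * show ?thesis by (simp add: insert_absorb)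
  next
    case False
    then have "discoveries r (Suc K) = insert (Suc K) (discoveries r K)"
      by (auto simp: discoveries_def le_Suc_eq lessThan_Suc_atMost)
    moreover have "Suc K \<notin> discoveries r K" by (simp add: discoveries_def)
    ultimately show ?thesis using False Suc * fin by simp
  qed
qed

lemma twice_card_image_le:
  assumes "finite A" and rep: "\<And>i. i \<in> A \<Longrightarrow> \<exists>j\<in>A. j \<noteq> i \<and> e j = e i"
  shows "2 * card (e ` A) \<le> card A"
proof -
  have "2 * card (e ` A) = (\<Sum>x\<in>e ` A. 2)" by simp
  also have "\<dots> \<le> (\<Sum>x\<in>e ` A. card {i \<in> A. e i = x})"
  proof (rule sum_mono)
    fix x assume "x \<in> e ` A"
    then obtain i where i: "i \<in> A" "e i = x" by auto
    with rep obtain j where j: "j \<in> A" "j \<noteq> i" "e j = x" by metis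
    have "card {i, j} \<le> card {i \<in> A. e i = x}"
      using i j assms(1) by (intro card_mono) auto
    with j show "2 \<le> card {i \<in> A. e i = x}" by simp
  qed
  also have "\<dots> = card A"
    using sum.image_gen[OF assms(1), of "\<lambda>_. 1 :: nat" e] by simp
  finally show ?thesis .
qed

text \<open>
  A walk \<open>r 0, \<dots>, r K\<close> whose first \<open>n\<close> steps are read forwards and whose other steps are read backwards.
  If every directed edge so obtained occurs at least twice, there are at most \<open>K / 2\<close> edges. Every
  vertex but the first is discovered along an edge of its own, so \<open>K / 2 + 1\<close> is the largest possible
  number of vertices, and if it is attained, every edge is a discovery edge. The first step among
  the first \<open>n\<close> which discovers nothing would then repeat the edge of a discovery, which is impossible
  for each possible position of that discovery: thus the forward part visits no vertex twice.
\<close>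

lemma extremal_walk_inj:
  fixes r :: "nat \<Rightarrow> 'a" and n :: nat
  defines "e \<equiv> \<lambda>i. if i \<le> n then (r (i - 1), r i) else (r i, r (i - 1))"
  assumes rep: "\<And>i. i \<in> {1..K} \<Longrightarrow> \<exists>j\<in>{1..K}. j \<noteq> i \<and> e j = e i"
    and ext: "K + 2 \<le> 2 * card (r ` {..K})" and nK: "n \<le> K"
  shows "inj_on r {..n}"
proof -
  let ?D = "discoveries r K"
  have D_new: "r i \<noteq> r j" if "i \<in> ?D" "j < i" for i j
    using that by (auto simp: discoveries_def)
  have D_pos: "i \<ge> 1" "i \<le> K" if "i \<in> ?D" for i
    using that by (auto simp: discoveries_def)
  have inj_D: "inj_on e ?D"
  proof (rule linorder_inj_onI)
    fix i j assume "i < j" "i \<in> ?D" "j \<in> ?D"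
    then have "r j \<noteq> r i" "r j \<noteq> r (i - 1)" using D_new[of j] by auto
    then show "e i \<noteq> e j" by (auto simp: e_def)
  qed auto
  have "e ` ?D = e ` {1..K}"
  proof (rule card_seteq)
    show "e ` ?D \<subseteq> e ` {1..K}" by (auto simp: discoveries_def)
    have "2 * card (e ` {1..K}) \<le> K" using twice_card_image_le[of "{1..K}" e] rep by simp
    also have "K \<le> 2 * card ?D" using ext card_range_walk[of r K] by simp
    finally show "card (e ` {1..K}) \<le> card (e ` ?D)" using inj_D by (simp add: card_image)
  qed simp
  then have cover: "\<exists>j\<in>?D. e j = e i" if "i \<in> {1..K}" for i
    using that by (metis (no_types, lifting) image_iff)
  have all_D: "i \<in> ?D" if "1 \<le> i" "i \<le> n" for i
    using that
  proof (induction i rule: less_induct)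
    case (less i)
    have inj: "r a \<noteq> r b" if "b < a" "a < i" for a b
      using D_new[OF less.IH[of a]] that less.prems by auto
    show ?case
    proof (rule ccontr)
      assume i: "i \<notin> ?D"
      obtain j where j: "j \<in> ?D" "e j = e i" using cover[of i] less.prems nK by auto
      note pos = D_pos[OF j(1)]
      consider "j < i" | "i < j" "j \<le> n" | "n < j" using i j(1) by force
      then show False
      proof cases
        case 1
        then have "r (j - 1) = r (i - 1)" using j(2) less.prems by (auto simp: e_def)
        then show False using inj[of "j - 1" "i - 1"] 1 pos by (simp add: diff_less_mono)
      next
        case 2
        then have "r j = r i" using j(2) less.prems by (auto simp: e_def)
        then show False using D_new[OF j(1) 2(1)] by simp
      next
        case 3
        then have "r j = r (i - 1)" using j(2) less.prems by (auto simp: e_def)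
        moreover have "i - 1 < j" using 3 less.prems by linarith
        ultimately show False using D_new[OF j(1)] by metis
      qed
    qed
  qed
  show ?thesis
  proof (rule linorder_inj_onI)
    fix i j assume "i < j" "i \<in> {..n}" "j \<in> {..n}"
    then show "r i \<noteq> r j" using D_new[OF all_D, of j i] by auto
  qed auto
qed

text \<open>
  The edges of two vertex lists \<open>p\<close> and \<open>q\<close>, enumerated one list after the other; \<open>n\<close> is the number of
  edges of \<open>p\<close>.
\<close>

definition pair_edge :: "nat \<Rightarrow> 'a list \<Rightarrow> 'a list \<Rightarrow> nat \<Rightarrow> 'a \<times> 'a" where
  "pair_edge n p q k =
     (if k < n then (p ! k, p ! Suc k) else (q ! (k - n), q ! Suc (k - n)))"

definition edges_repeated :: "nat \<Rightarrow> nat \<Rightarrow> 'a list \<Rightarrow> 'a list \<Rightarrow> bool" where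
  "edges_repeated n m p q \<longleftrightarrow>
     (\<forall>k<n + m. \<exists>k'<n + m. k' \<noteq> k \<and> pair_edge n p q k' = pair_edge n p q k)"

lemma edges_repeated_swap:
  assumes "edges_repeated n m p q"
  shows "edges_repeated m n q p"
  unfolding edges_repeated_def
proof (intro allI impI)
  have *: "pair_edge m q p k = pair_edge n p q (if k < m then n + k else k - m)" if "k < m + n" for k
    using that by (auto simp: pair_edge_def)
  fix k assume k: "k < m + n"
  let ?s = "if k < m then n + k else k - m"
  have "?s < n + m" using k by auto
  then obtain k' where k': "k' < n + m" "k' \<noteq> ?s" "pair_edge n p q k' = pair_edge n p q ?s"
    using assms unfolding edges_repeated_def by blast
  let ?t = "if k' < n then m + k' else k' - n"
  have t: "?t < m + n" "(if ?t < m then n + ?t else ?t - m) = k'" using k' by auto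
  then have "pair_edge m q p ?t = pair_edge m q p k"
    using *[OF t(1)] *[OF k] k'(3) by simp
  moreover have "?t \<noteq> k" using k' t(2) by (auto split: if_splits)
  ultimately show "\<exists>k'<m + n. k' \<noteq> k \<and> pair_edge m q p k' = pair_edge m q p k"
    using t(1) by blast
qed

text \<open>
  The walk \<open>r\<close> runs along \<open>p\<close> and returns along \<open>q\<close>; \<open>\<tau> i\<close> is the place of its \<open>i\<close>-th step in the enumeration
  \<open>pair_edge\<close>.
\<close>

lemma extremal_pair_distinct:
  assumes len: "length p = Suc n" "length q = Suc m"
    and ends: "hd p = hd q" "last p = last q"
    and rep: "edges_repeated n m p q"
    and ext: "n + m + 2 \<le> 2 * card (set p \<union> set q)"
  shows "distinct p"
proof -
  define r where "r i = (if i \<le> n then p ! i else q ! (n + m - i))" for i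
  define e where "e = (\<lambda>i. if i \<le> n then (r (i - 1), r i) else (r i, r (i - 1)))"
  define \<tau> where "\<tau> i = (if i \<le> n then i - 1 else n + (n + m - i))" for i
  have last: "p ! n = q ! m"
    using ends(2) len by (metis diff_Suc_1 last_conv_nth length_0_conv nat.distinct(1))
  have e_\<tau>: "e i = pair_edge n p q (\<tau> i)" if "i \<in> {1..n + m}" for i
  proof (cases "i \<le> n")
    case True
    then show ?thesis using that by (auto simp: e_def \<tau>_def pair_edge_def r_def)
  next
    case False
    then have "i - 1 \<le> n \<longleftrightarrow> i = Suc n" "n + m - (i - 1) = Suc (n + m - i)" using that by auto
    then show ?thesis using False that last by (auto simp: e_def \<tau>_def pair_edge_def r_def)
  qed
  have \<tau>_bij: "bij_betw \<tau> {1..n + m} {..<n + m}"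
    by (rule bij_betw_byWitness[where f' = "\<lambda>k. if k < n then Suc k else n + (n + m - k)"])
      (auto simp: \<tau>_def)
  have "set p = r ` {..n}"
    using len by (auto simp: r_def set_conv_nth less_Suc_eq_le image_iff) 
  moreover have "set q = r ` {n..n + m}"
  proof -
    have "q ! j \<in> r ` {n..n + m}" if "j < Suc m" for j
      using that last by (cases "j = m"; intro image_eqI[of _ _ "n + m - j"]) (auto simp: r_def)
    moreover have "r i \<in> set q" if "i \<in> {n..n + m}" for i
      using that last len nth_mem[of m q] by (auto simp: r_def)
    ultimately show ?thesis using len by (auto simp: set_conv_nth)
  qed
  ultimately have "set p \<union> set q = r ` {..n + m}"
    by (auto simp: image_Un[symmetric]) 
  have "inj_on r {..n}"
  proof (rule extremal_walk_inj[of "n + m"])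
    fix i assume i: "i \<in> {1..n + m}"
    then have "\<tau> i < n + m" using \<tau>_bij by (auto simp: bij_betw_def)
    then obtain k where k: "k < n + m" "k \<noteq> \<tau> i" "pair_edge n p q k = pair_edge n p q (\<tau> i)"
      using rep unfolding edges_repeated_def by blast
    obtain j where j: "j \<in> {1..n + m}" "\<tau> j = k" using k(1) \<tau>_bij by (metis bij_betw_iff_bijections lessThan_iff)
    have "e j = e i" "j \<noteq> i" using j k e_\<tau> i by auto
    with j show "\<exists>j\<in>{1..n + m}. j \<noteq> i \<and> (if j \<le> n then (r (j - 1), r j) else (r j, r (j - 1)))
        = (if i \<le> n then (r (i - 1), r i) else (r i, r (i - 1)))"
      unfolding e_def by blast
  next
    show "n + m + 2 \<le> 2 * card (r ` {..n + m})"
      using ext \<open>set p \<union> set q = r ` {..n + m}\<close> by simp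
  qed simp
  then show "distinct p"
    using len by (auto simp: distinct_conv_nth inj_on_def r_def less_Suc_eq_le)
qed

text \<open>
  Starting from the common first vertex, \<open>p\<close> has to follow \<open>q\<close>: each edge of \<open>p\<close> is an edge of \<open>q\<close> leaving
  the same vertex, and only one edge of \<open>q\<close> leaves it because \<open>q\<close> is distinct.
\<close>

lemma distinct_edges_prefix:
  assumes len: "length p = Suc n" "length q = Suc m" and hd: "p ! 0 = q ! 0" and q: "distinct q"
    and sub: "\<And>k. k < n \<Longrightarrow> \<exists>j<m. (p ! k, p ! Suc k) = (q ! j, q ! Suc j)"
  shows "i \<le> n \<Longrightarrow> i \<le> m \<and> p ! i = q ! i"
proof (induction i)
  case (Suc i)
  then obtain j where j: "j < m" "p ! i = q ! j" "p ! Suc i = q ! Suc j" using sub[of i] by auto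
  have "q ! i = q ! j" using Suc j by simp
  then have "i = j" using q len j Suc by (simp add: nth_eq_iff_index_eq)
  then show ?case using j by simp
qed (use hd in simp)

text \<open>
  In the extremal case both lists are distinct, so that each edge of one list can only be repeated in
  the other list. Two distinct lists with the same edges and the same first vertex are equal.
\<close>

proposition repeated_edges_dichotomy:
  assumes len: "length p = Suc n" "length q = Suc m"
    and ends: "hd p = hd q" "last p = last q"
    and rep: "edges_repeated n m p q"
  shows "2 * card (set p \<union> set q) \<le> n + m + 1 \<or> (p = q \<and> distinct p)"
proof (rule disjCI)
  assume "\<not> (p = q \<and> distinct p)"
  show "2 * card (set p \<union> set q) \<le> n + m + 1"
  proof (rule ccontr)
    assume "\<not> ?thesis"
    then have ext: "n + m + 2 \<le> 2 * card (set p \<union> set q)" by simp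
    have p: "distinct p" by (rule extremal_pair_distinct[OF len ends rep ext])
    have q: "distinct q"
      using extremal_pair_distinct[OF len(2,1) ends(1,2)[symmetric] edges_repeated_swap[OF rep]] ext
      by (simp add: Un_commute add.commute)
    have hd: "p ! 0 = q ! 0" using ends(1) len by (metis hd_conv_nth length_0_conv nat.distinct(1))
    have pq: "\<exists>j<m. (p ! k, p ! Suc k) = (q ! j, q ! Suc j)"
      if len: "length p = Suc n" "length q = Suc m" and rep: "edges_repeated n m p q"
        and p: "distinct p" and k: "k < n" for p q :: "'a list" and n m k
    proof -
      obtain k' where k': "k' < n + m" "k' \<noteq> k" "pair_edge n p q k' = pair_edge n p q k"
        using rep k unfolding edges_repeated_def by (meson trans_less_add1)
      have "\<not> k' < n"
        using k' k p len by (auto simp: pair_edge_def nth_eq_iff_index_eq)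
      then show ?thesis using k' k by (intro exI[of _ "k' - n"]) (auto simp: pair_edge_def)
    qed
    have "i \<le> n \<Longrightarrow> i \<le> m \<and> p ! i = q ! i" for i
      by (rule distinct_edges_prefix[OF len hd q pq[OF len rep p]])
    moreover have "i \<le> m \<Longrightarrow> i \<le> n" for i
      using distinct_edges_prefix[OF len(2,1) hd[symmetric] p pq[OF len(2,1) edges_repeated_swap[OF rep] q]]
      by blast
    ultimately have "p = q"
      using len by (intro nth_equalityI) (auto simp: less_Suc_eq_le le_antisym)
    with p \<open>\<not> (p = q \<and> distinct p)\<close> show False by simp
  qed
qed

text \<open>A list with at most \<open>V\<close> distinct entries is a list of \<open>V\<close> values read along a list of indices.\<close>

lemma card_lists_few_entries_le:
  assumes "N \<ge> 1"
  shows "card {xs. length xs = K \<and> set xs \<subseteq> {..<N} \<and> card (set xs) \<le> V} \<le> N ^ V * V ^ K"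
proof -
  let ?F = "{f. set f \<subseteq> {..<N} \<and> length f = V}" and ?G = "{g. set g \<subseteq> {..<V} \<and> length g = K}"
  have fin: "finite ?F" "finite ?G" by (auto intro: finite_lists_length_eq)
  have "{xs. length xs = K \<and> set xs \<subseteq> {..<N} \<and> card (set xs) \<le> V}
      \<subseteq> (\<lambda>(f, g). map ((!) f) g) ` (?F \<times> ?G)"
  proof clarify
    fix xs :: "nat list" assume xs: "K = length xs" "set xs \<subseteq> {..<N}" "card (set xs) \<le> V"
    obtain ys where ys: "set ys = set xs" "distinct ys"
      using finite_distinct_list[of "set xs"] by auto
    define f where "f = ys @ replicate (V - length ys) 0"
    have "length ys \<le> V" using ys xs(3) by (metis distinct_card)
    then have f: "f \<in> ?F" using xs(2) ys assms by (auto simp: f_def)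
    have "\<exists>i<V. f ! i = x" if "x \<in> set xs" for x
    proof -
      obtain i where "i < length ys" "ys ! i = x" using \<open>x \<in> set xs\<close> ys(1) by (metis in_set_conv_nth)
      with \<open>length ys \<le> V\<close> show ?thesis by (intro exI[of _ i]) (auto simp: f_def nth_append)
    qed
    then obtain idx where idx: "\<And>x. x \<in> set xs \<Longrightarrow> idx x < V \<and> f ! idx x = x" by metis
    have "map idx xs \<in> {g. set g \<subseteq> {..<V} \<and> length g = length xs}" "xs = map ((!) f) (map idx xs)"
      using idx by (auto intro: map_idI[symmetric])
    with f show "xs \<in> (\<lambda>(f, g). map ((!) f) g) ` (?F \<times> {g. set g \<subseteq> {..<V} \<and> length g = length xs})"
      by (intro image_eqI[of _ _ "(f, map idx xs)"]) auto
  qed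
  then have "card {xs. length xs = K \<and> set xs \<subseteq> {..<N} \<and> card (set xs) \<le> V} \<le> card (?F \<times> ?G)"
    using fin by (intro surj_card_le) auto
  also have "\<dots> = N ^ V * V ^ K"
    by (simp add: card_cartesian_product card_lists_length_eq)
  finally show ?thesis .
qed

section \<open>Expectations along pairs of paths\<close>

definition vertex_paths :: "nat \<Rightarrow> nat \<Rightarrow> nat \<Rightarrow> nat \<Rightarrow> nat list set" where
  "vertex_paths N n j k = {p. length p = Suc n \<and> set p \<subseteq> {..<N} \<and> hd p = j \<and> last p = k}"

lemma finite_vertex_paths: "finite (vertex_paths N n j k)"
  by (rule finite_subset[OF _ finite_lists_length_eq[of "{..<N}" "Suc n"]]) (auto simp: vertex_paths_def)

lemma word_entry_paths:
  assumes "j < N" "k < N"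
  shows "word_entry N M w j k =
    (\<Sum>p\<in>vertex_paths N (length w) j k. \<Prod>i<length w. M (w ! i) (p ! i) (p ! Suc i))"
  using assms(1)
proof (induction w arbitrary: j)
  case Nil
  have "vertex_paths N 0 j k = (if j = k then {[j]} else {})"
    using Nil by (auto simp: vertex_paths_def length_Suc_conv)
  then show ?case by simp
next
  case (Cons a w)
  let ?n = "length w"
  have "word_entry N M (a # w) j k =
      (\<Sum>l<N. \<Sum>p\<in>vertex_paths N ?n l k. M a j l * (\<Prod>i<?n. M (w ! i) (p ! i) (p ! Suc i)))"
    using Cons.IH by (simp add: sum_distrib_left)
  also have "\<dots> = (\<Sum>(l, p)\<in>(SIGMA l:{..<N}. vertex_paths N ?n l k).
      M a j l * (\<Prod>i<?n. M (w ! i) (p ! i) (p ! Suc i)))"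
    by (subst sum.Sigma) (auto simp: finite_vertex_paths)
  also have "\<dots> = (\<Sum>p\<in>vertex_paths N (Suc ?n) j k. \<Prod>i<Suc ?n. M ((a # w) ! i) (p ! i) (p ! Suc i))"
  proof (rule sum.reindex_bij_witness[of _ "\<lambda>p. (p ! 1, tl p)" "\<lambda>(l, p). j # p"])
    fix x assume "x \<in> (SIGMA l:{..<N}. vertex_paths N ?n l k)"
    then obtain l p where x: "x = (l, p)" "l < N" "p \<in> vertex_paths N ?n l k" by auto
    then have p: "p \<noteq> []" "hd p = l" by (auto simp: vertex_paths_def)
    then have p0: "p ! 0 = l" by (simp add: hd_conv_nth)
    show "((case x of (l, p) \<Rightarrow> j # p) ! 1, tl (case x of (l, p) \<Rightarrow> j # p)) = x" using x p0 by simp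
    show "(case x of (l, p) \<Rightarrow> j # p) \<in> vertex_paths N (Suc ?n) j k"
      using x p Cons.prems by (auto simp: vertex_paths_def)
    show "(\<Prod>i<Suc ?n. M ((a # w) ! i) ((case x of (l, p) \<Rightarrow> j # p) ! i) ((case x of (l, p) \<Rightarrow> j # p) ! Suc i)) =
        (case x of (l, p) \<Rightarrow> M a j l * (\<Prod>i<?n. M (w ! i) (p ! i) (p ! Suc i)))"
      using x p0 by (simp add: prod.lessThan_Suc_shift del: prod.lessThan_Suc)
  next
    fix p assume p: "p \<in> vertex_paths N (Suc ?n) j k"
    then obtain l p' where p': "p = j # l # p'" by (auto simp: vertex_paths_def length_Suc_conv)
    show "(case (p ! 1, tl p) of (l, p) \<Rightarrow> j # p) = p" using p' by simp
    show "(p ! 1, tl p) \<in> (SIGMA l:{..<N}. vertex_paths N ?n l k)"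
      using p p' by (auto simp: vertex_paths_def)
  qed
  finally show ?case by simp
qed

definition path_pairs :: "nat \<Rightarrow> nat \<Rightarrow> nat \<Rightarrow> (nat list \<times> nat list) set" where
  "path_pairs N n m = {(p, q). length p = Suc n \<and> length q = Suc m \<and> set p \<subseteq> {..<N} \<and> set q \<subseteq> {..<N} \<and>
     hd p = hd q \<and> last p = last q}"

text \<open>
  The \<open>k\<close>-th scalar factor of a summand of \<open>word_hs\<close>, evaluated at the edge \<open>e\<close>; the factors of \<open>w\<close>, which are
  conjugated, precede those of \<open>v\<close>.
\<close>

definition pair_factor ::
  "('d \<Rightarrow> nat \<Rightarrow> nat \<Rightarrow> complex) \<Rightarrow> 'd list \<Rightarrow> 'd list \<Rightarrow> nat \<Rightarrow> nat \<times> nat \<Rightarrow> complex" where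
  "pair_factor M w v k e =
     (if k < length w then cnj (M (w ! k) (fst e) (snd e)) else M (v ! (k - length w)) (fst e) (snd e))"

lemma finite_path_pairs: "finite (path_pairs N n m)"
proof (rule finite_subset)
  show "path_pairs N n m \<subseteq>
      {p. set p \<subseteq> {..<N} \<and> length p = Suc n} \<times> {q. set q \<subseteq> {..<N} \<and> length q = Suc m}"
    by (auto simp: path_pairs_def)
qed (auto intro!: finite_lists_length_eq)

lemma prod_lessThan_add:
  fixes f g :: "nat \<Rightarrow> 'a::comm_monoid_mult"
  shows "(\<Prod>k<n + m. if k < n then f k else g (k - n)) = (\<Prod>k<n. f k) * (\<Prod>k<m. g k)"
  by (induction m) (auto simp: mult.assoc)

lemma word_hs_paths:
  assumes n: "length w = n" and m: "length v = m"
  shows "word_hs N M w v =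
    (\<Sum>(p, q)\<in>path_pairs N n m. \<Prod>k<n + m. pair_factor M w v k (pair_edge n p q k))"
proof -
  let ?f = "\<lambda>p. \<Prod>i<n. cnj (M (w ! i) (p ! i) (p ! Suc i))" and ?g = "\<lambda>q. \<Prod>i<m. M (v ! i) (q ! i) (q ! Suc i)"
  have "word_hs N M w v =
      (\<Sum>(j, k)\<in>{..<N} \<times> {..<N}. \<Sum>(p, q)\<in>vertex_paths N n j k \<times> vertex_paths N m j k. ?f p * ?g q)"
  proof -
    have "cnj (word_entry N M w j k) * word_entry N M v j k =
        (\<Sum>(p, q)\<in>vertex_paths N n j k \<times> vertex_paths N m j k. ?f p * ?g q)" if jk: "j < N" "k < N" for j k
      by (simp add: word_entry_paths[OF jk] n m cnj_sum cnj_prod sum_product sum.cartesian_product)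
    then have "word_hs N M w v =
        (\<Sum>j<N. \<Sum>k<N. \<Sum>(p, q)\<in>vertex_paths N n j k \<times> vertex_paths N m j k. ?f p * ?g q)"
      unfolding word_hs_def by (intro sum.cong refl) auto
    then show ?thesis by (simp only: sum.cartesian_product)
  qed
  also have "\<dots> = (\<Sum>(jk, pq)\<in>(SIGMA jk:{..<N} \<times> {..<N}. vertex_paths N n (fst jk) (snd jk) \<times> vertex_paths N m (fst jk) (snd jk)).
      ?f (fst pq) * ?g (snd pq))"
    by (subst sum.Sigma[symmetric]) (auto simp: finite_vertex_paths case_prod_unfold intro!: finite_SigmaI)
  also have "\<dots> = (\<Sum>pq\<in>path_pairs N n m. ?f (fst pq) * ?g (snd pq))"
  proof (rule sum.reindex_bij_witness[of _ "\<lambda>pq. ((hd (fst pq), last (fst pq)), pq)" snd])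
    fix pq assume "pq \<in> path_pairs N n m"
    then obtain p q where pq: "pq = (p, q)" "length p = Suc n" "length q = Suc m" "set p \<subseteq> {..<N}" "set q \<subseteq> {..<N}"
      "hd p = hd q" "last p = last q" by (auto simp: path_pairs_def)
    then have "hd p \<in> {..<N}" "last p \<in> {..<N}"
      by (metis hd_in_set last_in_set length_0_conv nat.distinct(1) subset_iff)+
    then show "((hd (fst pq), last (fst pq)), pq) \<in>
        (SIGMA jk:{..<N} \<times> {..<N}. vertex_paths N n (fst jk) (snd jk) \<times> vertex_paths N m (fst jk) (snd jk))"
      using pq by (auto simp: vertex_paths_def)
  qed (auto simp: vertex_paths_def path_pairs_def)
  also have "\<dots> = (\<Sum>(p, q)\<in>path_pairs N n m. \<Prod>k<n + m. pair_factor M w v k (pair_edge n p q k))"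
  proof (intro sum.cong refl, clarify)
    fix p q
    have "(\<Prod>k<n + m. pair_factor M w v k (pair_edge n p q k)) =
        (\<Prod>k<n + m. if k < n then cnj (M (w ! k) (p ! k) (p ! Suc k))
          else M (v ! (k - n)) (q ! (k - n)) (q ! Suc (k - n)))"
      by (intro prod.cong) (auto simp: pair_factor_def pair_edge_def n)
    then show "?f (fst (p, q)) * ?g (snd (p, q)) = (\<Prod>k<n + m. pair_factor M w v k (pair_edge n p q k))"
      by (simp add: prod_lessThan_add[where n = n and m = m and f = "\<lambda>k. cnj (M (w ! k) (p ! k) (p ! Suc k))" and g = "\<lambda>k. M (v ! k) (q ! k) (q ! Suc k)"])
  qed
  finally show ?thesis .
qed

lemma pair_edge_range:
  assumes "(p, q) \<in> path_pairs N n m" "k < n + m"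
  shows "pair_edge n p q k \<in> {..<N} \<times> {..<N}"
proof -
  have "p ! i < N" if "i \<le> n" for i
    using assms that by (auto simp: path_pairs_def subset_iff)
  moreover have "q ! i < N" if "i \<le> m" for i
    using assms that by (auto simp: path_pairs_def subset_iff)
  ultimately show ?thesis using assms(2) by (auto simp: pair_edge_def)
qed

text \<open>
  As \<open>prod_list_le_sum_power\<close>, for an indexed product; the summand \<open>1\<close> covers the empty product.
\<close>

lemma prod_le_sum_power:
  fixes a :: "'a \<Rightarrow> real"
  assumes "finite S" and a: "\<And>k. k \<in> S \<Longrightarrow> a k \<ge> 0"
  shows "(\<Prod>k\<in>S. a k) \<le> 1 + (\<Sum>k\<in>S. a k ^ card S)"
proof (cases "S = {}")
  case False
  have "Max (a ` S) \<in> a ` S" using False assms by (intro Max_in) auto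
  then obtain i where i: "i \<in> S" "Max (a ` S) = a i" by auto
  have "a k \<le> a i" if "k \<in> S" for k using Max_ge[of "a ` S" "a k"] assms(1) that i(2) by simp
  then have "(\<Prod>k\<in>S. a k) \<le> (\<Prod>k\<in>S. a i)" using a by (intro prod_mono) auto
  also have "\<dots> = a i ^ card S" by simp
  also have "\<dots> \<le> (\<Sum>k\<in>S. a k ^ card S)"
    using assms i a by (intro member_le_sum[of i S "\<lambda>k. a k ^ card S"]) auto
  finally show ?thesis by simp
qed simp

lemma borel_measurable_cnj:
  "f \<in> borel_measurable M \<Longrightarrow> (\<lambda>x. cnj (f x)) \<in> borel_measurable M"
  by (rule borel_measurable_continuous_on[OF continuous_on_cnj[OF continuous_on_id]])

text \<open>
  The assumptions on the random matrices at one fixed size \<open>N\<close>.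
\<close>

locale independent_entries = prob_space P for P :: "'w measure" +
  fixes N :: nat and A :: "'d::finite \<Rightarrow> 'w \<Rightarrow> complex mat"
  assumes meas: "\<And>i m l. m < N \<Longrightarrow> l < N \<Longrightarrow> (\<lambda>\<omega>. A i \<omega> $$ (m, l)) \<in> borel_measurable P"
    and integrable_power: "\<And>i m l k. m < N \<Longrightarrow> l < N \<Longrightarrow> integrable P (\<lambda>\<omega>. cmod (A i \<omega> $$ (m, l)) ^ k)"
    and mean: "\<And>i m l. m < N \<Longrightarrow> l < N \<Longrightarrow> (\<integral>\<omega>. A i \<omega> $$ (m, l) \<partial>P) = 0"
    and second_moment: "\<And>i m l. m < N \<Longrightarrow> l < N \<Longrightarrow> (\<integral>\<omega>. (cmod (A i \<omega> $$ (m, l)))\<^sup>2 \<partial>P) = 1"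
    and indep: "indep_sets (entry_sigma P A) ({..<N} \<times> {..<N})"
    and uncorrelated: "\<And>i j m l. i \<noteq> j \<Longrightarrow> m < N \<Longrightarrow> l < N \<Longrightarrow>
      (\<integral>\<omega>. cnj (A i \<omega> $$ (m, l)) * A j \<omega> $$ (m, l) \<partial>P) = 0"
begin

abbreviation (input) factor :: "'d list \<Rightarrow> 'd list \<Rightarrow> nat \<Rightarrow> nat \<times> nat \<Rightarrow> 'w \<Rightarrow> complex" where
  "factor w v k e \<omega> \<equiv> pair_factor (\<lambda>i j l. A i \<omega> $$ (j, l)) w v k e"

text \<open>
  The \<open>\<sigma>\<close>-algebra \<open>entry_sigma P A e\<close> in the form of a measure space, for use with measurability rules.
\<close>

definition entry_algebra :: "nat \<times> nat \<Rightarrow> 'w measure" where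
  "entry_algebra e = sigma (space P) (\<Union>i. sets (vimage_algebra (space P) (\<lambda>\<omega>. A i \<omega> $$ e) borel))"

lemma space_entry_algebra [simp]: "space (entry_algebra e) = space P"
  and sets_entry_algebra: "sets (entry_algebra e) = entry_sigma P A e"
proof -
  have "(\<Union>i. sets (vimage_algebra (space P) (\<lambda>\<omega>. A i \<omega> $$ e) borel)) \<subseteq> Pow (space P)"
    by (auto simp: sets_vimage_algebra2)
  then show "space (entry_algebra e) = space P" "sets (entry_algebra e) = entry_sigma P A e"
    by (simp_all add: entry_algebra_def entry_sigma_def space_measure_of sets_measure_of)
qed

lemma measurable_entry_algebra: "(\<lambda>\<omega>. A i \<omega> $$ e) \<in> borel_measurable (entry_algebra e)"
proof (rule measurableI)
  fix B :: "complex set" assume B: "B \<in> sets borel"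
  have "(\<lambda>\<omega>. A i \<omega> $$ e) -` B \<inter> space P \<in> sets (vimage_algebra (space P) (\<lambda>\<omega>. A i \<omega> $$ e) borel)"
    by (rule in_vimage_algebra[OF B])
  then show "(\<lambda>\<omega>. A i \<omega> $$ e) -` B \<inter> space (entry_algebra e) \<in> sets (entry_algebra e)"
    unfolding sets_entry_algebra entry_sigma_def by (auto intro: sigma_sets.Basic)
qed simp

lemma measurable_factor_entry_algebra: "factor w v k e \<in> borel_measurable (entry_algebra e)"
  unfolding pair_factor_def prod.collapse
  by (cases "k < length w") (simp_all add: measurable_entry_algebra borel_measurable_cnj)

lemma measurable_factor: "e \<in> {..<N} \<times> {..<N} \<Longrightarrow> factor w v k e \<in> borel_measurable P"
  unfolding pair_factor_def
  by (cases "k < length w") (auto intro!: borel_measurable_cnj meas)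

lemma integrable_factor_power:
  "e \<in> {..<N} \<times> {..<N} \<Longrightarrow> integrable P (\<lambda>\<omega>. cmod (factor w v k e \<omega>) ^ r)"
  unfolding pair_factor_def using integrable_power by (cases "k < length w") auto

lemma integrable_prod_factor:
  assumes "finite S" and e: "\<And>k. k \<in> S \<Longrightarrow> e k \<in> {..<N} \<times> {..<N}"
  shows "integrable P (\<lambda>\<omega>. \<Prod>k\<in>S. factor w v k (e k) \<omega>)"
proof (rule Bochner_Integration.integrable_bound)
  show "integrable P (\<lambda>\<omega>. 1 + (\<Sum>k\<in>S. cmod (factor w v k (e k) \<omega>) ^ card S))"
    using e by (intro Bochner_Integration.integrable_add Bochner_Integration.integrable_sum integrable_factor_power) auto
  show "(\<lambda>\<omega>. \<Prod>k\<in>S. factor w v k (e k) \<omega>) \<in> borel_measurable P"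
    using e by (intro borel_measurable_prod measurable_factor) auto
  show "AE \<omega> in P. cmod (\<Prod>k\<in>S. factor w v k (e k) \<omega>) \<le> norm (1 + (\<Sum>k\<in>S. cmod (factor w v k (e k) \<omega>) ^ card S))"
  proof (intro AE_I2)
    fix \<omega>
    have "cmod (\<Prod>k\<in>S. factor w v k (e k) \<omega>) \<le> 1 + (\<Sum>k\<in>S. cmod (factor w v k (e k) \<omega>) ^ card S)"
      unfolding prod_norm[symmetric] by (intro prod_le_sum_power assms(1)) auto
    then show "cmod (\<Prod>k\<in>S. factor w v k (e k) \<omega>) \<le> norm (1 + (\<Sum>k\<in>S. cmod (factor w v k (e k) \<omega>) ^ card S))"
      by simp
  qed
qed

lemma expectation_prod_factor_le:
  assumes "finite S" and e: "\<And>k. k \<in> S \<Longrightarrow> e k \<in> {..<N} \<times> {..<N}"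
    and c: "\<And>i m l. m < N \<Longrightarrow> l < N \<Longrightarrow> (\<integral>\<omega>. cmod (A i \<omega> $$ (m, l)) ^ card S \<partial>P) \<le> c"
  shows "cmod (\<integral>\<omega>. (\<Prod>k\<in>S. factor w v k (e k) \<omega>) \<partial>P) \<le> 1 + real (card S) * c"
proof -
  have fc: "(\<integral>\<omega>. cmod (factor w v k (e k) \<omega>) ^ card S \<partial>P) \<le> c" if "k \<in> S" for k
    using c e[OF that] unfolding pair_factor_def by (cases "k < length w") auto
  have "cmod (\<integral>\<omega>. (\<Prod>k\<in>S. factor w v k (e k) \<omega>) \<partial>P)
      \<le> (\<integral>\<omega>. 1 + (\<Sum>k\<in>S. cmod (factor w v k (e k) \<omega>) ^ card S) \<partial>P)"
  proof (rule order_trans[OF integral_norm_bound integral_mono])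
    show "integrable P (\<lambda>\<omega>. cmod (\<Prod>k\<in>S. factor w v k (e k) \<omega>))"
      by (intro integrable_norm integrable_prod_factor assms)
    show "integrable P (\<lambda>\<omega>. 1 + (\<Sum>k\<in>S. cmod (factor w v k (e k) \<omega>) ^ card S))"
      using e by (intro Bochner_Integration.integrable_add Bochner_Integration.integrable_sum integrable_factor_power) auto
    show "cmod (\<Prod>k\<in>S. factor w v k (e k) \<omega>) \<le> 1 + (\<Sum>k\<in>S. cmod (factor w v k (e k) \<omega>) ^ card S)" for \<omega>
      unfolding prod_norm[symmetric] by (intro prod_le_sum_power assms(1)) auto
  qed
  also have "\<dots> = 1 + (\<Sum>k\<in>S. \<integral>\<omega>. cmod (factor w v k (e k) \<omega>) ^ card S \<partial>P)"
  proof -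
    have int: "integrable P (\<lambda>\<omega>. cmod (factor w v k (e k) \<omega>) ^ card S)" if "k \<in> S" for k
      using integrable_factor_power[OF e[OF that]] .
    then show ?thesis
      by (subst Bochner_Integration.integral_add)
        (auto simp: prob_space intro!: Bochner_Integration.integrable_sum)
  qed
  also have "\<dots> \<le> 1 + real (card S) * c"
    using sum_mono[OF fc] by simp
  finally show ?thesis .
qed

text \<open>Independence lets the expectation factor over the positions that occur.\<close>

lemma expectation_prod_factor:
  assumes "finite S" and e: "\<And>k. k \<in> S \<Longrightarrow> e k \<in> {..<N} \<times> {..<N}"
  shows "(\<integral>\<omega>. (\<Prod>k\<in>S. factor w v k (e k) \<omega>) \<partial>P) =
    (\<Prod>x\<in>e ` S. \<integral>\<omega>. (\<Prod>k\<in>{k \<in> S. e k = x}. factor w v k x \<omega>) \<partial>P)"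
proof -
  define Y where "Y x \<omega> = (\<Prod>k\<in>{k \<in> S. e k = x}. factor w v k x \<omega>)" for x \<omega>
  have Y_entry: "Y x \<in> borel_measurable (entry_algebra x)" for x
    unfolding Y_def by (intro borel_measurable_prod measurable_factor_entry_algebra)
  have Y_int: "integrable P (Y x)" if "x \<in> e ` S" for x
  proof -
    have "integrable P (\<lambda>\<omega>. \<Prod>k\<in>{k \<in> S. e k = x}. factor w v k ((\<lambda>_. x) k) \<omega>)"
      using assms(1) e that by (intro integrable_prod_factor) auto
    then show ?thesis by (simp add: Y_def[abs_def])
  qed
  have "indep_vars (\<lambda>_. borel) Y (e ` S)"
    unfolding indep_vars_def2
  proof (intro conjI ballI)
    fix x assume "x \<in> e ` S"
    then show "Y x \<in> borel_measurable P" by (rule borel_measurable_integrable[OF Y_int])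
  next
    show "indep_sets (\<lambda>x. {Y x -` B \<inter> space P |B. B \<in> sets borel}) (e ` S)"
    proof (rule indep_sets_mono[OF indep])
      show "e ` S \<subseteq> {..<N} \<times> {..<N}" by (rule image_subsetI) (rule e)
      fix x assume "x \<in> e ` S"
      show "{Y x -` B \<inter> space P |B. B \<in> sets borel} \<subseteq> entry_sigma P A x"
        using measurable_sets[OF Y_entry[of x]] by (auto simp: sets_entry_algebra)
    qed
  qed
  then have "(\<integral>\<omega>. (\<Prod>x\<in>e ` S. Y x \<omega>) \<partial>P) = (\<Prod>x\<in>e ` S. \<integral>\<omega>. Y x \<omega> \<partial>P)"
    using assms(1) Y_int by (intro indep_vars_lebesgue_integral) auto
  moreover have "(\<Prod>x\<in>e ` S. Y x \<omega>) = (\<Prod>k\<in>S. factor w v k (e k) \<omega>)" for \<omega>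
  proof -
    have "(\<Prod>k\<in>S. factor w v k (e k) \<omega>) = (\<Prod>x\<in>e ` S. \<Prod>k\<in>{k \<in> S. e k = x}. factor w v k (e k) \<omega>)"
      by (rule prod.image_gen[OF assms(1)])
    also have "\<dots> = (\<Prod>x\<in>e ` S. Y x \<omega>)" unfolding Y_def by (intro prod.cong) auto
    finally show ?thesis ..
  qed
  ultimately show ?thesis by (simp add: Y_def)
qed

lemma expectation_factor: "e \<in> {..<N} \<times> {..<N} \<Longrightarrow> (\<integral>\<omega>. factor w v k e \<omega> \<partial>P) = 0"
  unfolding pair_factor_def using mean by (cases "k < length w") (auto simp: integral_cnj)

lemma expectation_covariance:
  assumes "m < N" "l < N"
  shows "(\<integral>\<omega>. cnj (A i \<omega> $$ (m, l)) * A j \<omega> $$ (m, l) \<partial>P) = (if i = j then 1 else 0)"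
proof (cases "i = j")
  case True
  have "cnj (A i \<omega> $$ (m, l)) * A i \<omega> $$ (m, l) = complex_of_real ((cmod (A i \<omega> $$ (m, l)))\<^sup>2)" for \<omega>
    by (subst complex_norm_square) (simp add: mult.commute)
  then show ?thesis using True second_moment[OF assms, of i] by (simp del: of_real_power)
qed (use uncorrelated assms in simp)

definition pair_expectation :: "'d list \<Rightarrow> 'd list \<Rightarrow> nat list \<Rightarrow> nat list \<Rightarrow> complex" where
  "pair_expectation w v p q =
     (\<integral>\<omega>. (\<Prod>k<length w + length v. factor w v k (pair_edge (length w) p q k) \<omega>) \<partial>P)"

text \<open>
  An edge that occurs only once contributes the factor \<open>E (A i \<omega> $$ e) = 0\<close>.
\<close>

lemma pair_expectation_eq_0:
  assumes pq: "(p, q) \<in> path_pairs N (length w) (length v)" and "\<not> edges_repeated (length w) (length v) p q"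
  shows "pair_expectation w v p q = 0"
proof -
  let ?S = "{..<length w + length v}" and ?e = "pair_edge (length w) p q"
  obtain k where k: "k \<in> ?S" "\<And>k'. k' \<in> ?S \<Longrightarrow> ?e k' = ?e k \<Longrightarrow> k' = k"
    using assms(2) unfolding edges_repeated_def by auto
  have "{k' \<in> ?S. ?e k' = ?e k} = {k}" using k by auto
  moreover have "(\<integral>\<omega>. factor w v k (?e k) \<omega> \<partial>P) = 0"
    using pair_edge_range[OF pq, of k] k(1) by (intro expectation_factor) auto
  ultimately have "\<exists>x\<in>?e ` ?S. (\<integral>\<omega>. (\<Prod>k\<in>{k \<in> ?S. ?e k = x}. factor w v k x \<omega>) \<partial>P) = 0"
    using k(1) by (intro bexI[of _ "?e k"]) auto
  then show ?thesis
    unfolding pair_expectation_def using pair_edge_range[OF pq]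
    by (subst expectation_prod_factor) (auto intro!: prod_zero)
qed

text \<open>
  Each edge of \<open>p\<close> occurs once with a letter of \<open>w\<close> and once with the corresponding letter of \<open>v\<close>, and
  contributes their covariance.
\<close>

lemma pair_expectation_distinct:
  assumes pp: "(p, p) \<in> path_pairs N (length w) (length v)" and p: "distinct p"
  shows "pair_expectation w v p p = (if w = v then 1 else 0)"
proof -
  let ?n = "length w"
  have len: "length v = ?n" "length p = Suc ?n" using pp by (auto simp: path_pairs_def)
  let ?S = "{..<?n + ?n}" and ?e = "pair_edge ?n p p" and ?x = "\<lambda>i. (p ! i, p ! Suc i)"
  have inj: "inj_on ?x {..<?n}" using p len by (auto simp: inj_on_def nth_eq_iff_index_eq)
  have img: "?e ` ?S = ?x ` {..<?n}"
  proof
    show "?e ` ?S \<subseteq> ?x ` {..<?n}" by (auto simp: pair_edge_def)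
    show "?x ` {..<?n} \<subseteq> ?e ` ?S"
    proof clarify
      fix i assume "i < ?n"
      then show "?x i \<in> ?e ` ?S" by (intro image_eqI[of _ _ i]) (auto simp: pair_edge_def)
    qed
  qed
  have one: "(\<integral>\<omega>. (\<Prod>k\<in>{k \<in> ?S. ?e k = ?x i}. factor w v k (?x i) \<omega>) \<partial>P) = (if w ! i = v ! i then 1 else 0)"
    if i: "i < ?n" for i
  proof -
    have "{k \<in> ?S. ?e k = ?x i} = {i, ?n + i}"
      using i p len by (auto simp: pair_edge_def nth_eq_iff_index_eq split: if_splits)
    moreover have "p ! i < N" "p ! Suc i < N" using pp i len by (auto simp: path_pairs_def subset_iff)
    moreover have "(\<Prod>k\<in>{i, ?n + i}. factor w v k (?x i) \<omega>) = cnj (A (w ! i) \<omega> $$ ?x i) * A (v ! i) \<omega> $$ ?x i" for \<omega>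
      using i by (subst prod.insert) (auto simp: pair_factor_def)
    ultimately show ?thesis
      using expectation_covariance[of "p ! i" "p ! Suc i" "w ! i" "v ! i"] by simp
  qed
  have "pair_expectation w v p p = (\<Prod>x\<in>?e ` ?S. \<integral>\<omega>. (\<Prod>k\<in>{k \<in> ?S. ?e k = x}. factor w v k x \<omega>) \<partial>P)"
    unfolding pair_expectation_def len(1) using pair_edge_range[OF pp] len(1)
    by (subst expectation_prod_factor) auto
  also have "\<dots> = (\<Prod>i<?n. if w ! i = v ! i then 1 else 0)"
    unfolding img prod.reindex[OF inj] o_def by (rule prod.cong[OF refl], rule one) simp
  also have "\<dots> = (if w = v then 1 else 0)"
  proof (cases "w = v")
    case False
    then obtain i where "i < ?n" "w ! i \<noteq> v ! i" using len(1) by (metis nth_equalityI)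
    then have "(\<Prod>i<?n. if w ! i = v ! i then 1 else 0 :: complex) = 0"
      by (intro prod_zero) auto
    with False show ?thesis by simp
  qed simp
  finally show ?thesis .
qed

lemma pair_expectation_le:
  assumes pq: "(p, q) \<in> path_pairs N (length w) (length v)"
    and c: "\<And>i m l. m < N \<Longrightarrow> l < N \<Longrightarrow> (\<integral>\<omega>. cmod (A i \<omega> $$ (m, l)) ^ (length w + length v) \<partial>P) \<le> c"
  shows "cmod (pair_expectation w v p q) \<le> 1 + real (length w + length v) * c"
  unfolding pair_expectation_def
  using expectation_prod_factor_le[of "{..<length w + length v}" "pair_edge (length w) p q" c w v]
    pair_edge_range[OF pq] c by simp

lemma word_hs_scaled_paths:
  "word_hs N (\<lambda>i j l. A i \<omega> $$ (j, l) / of_real r) w v =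
    (\<Sum>(p, q)\<in>path_pairs N (length w) (length v).
      \<Prod>k<length w + length v. factor w v k (pair_edge (length w) p q k) \<omega>) / of_real r ^ (length w + length v)"
proof -
  have "pair_factor (\<lambda>i j l. A i \<omega> $$ (j, l) / of_real r) w v k e = factor w v k e \<omega> / of_real r" for k e
    by (simp add: pair_factor_def)
  then show ?thesis
    by (simp add: word_hs_paths[OF refl refl] prod_dividef sum_divide_distrib case_prod_unfold)
qed

lemma integrable_path_pair_prod:
  assumes "(p, q) \<in> path_pairs N (length w) (length v)"
  shows "integrable P (\<lambda>\<omega>. \<Prod>k<length w + length v. factor w v k (pair_edge (length w) p q k) \<omega>)"
  using pair_edge_range[OF assms] by (intro integrable_prod_factor) auto

lemma integrable_word_hs:
  "integrable P (\<lambda>\<omega>. word_hs N (\<lambda>i j l. A i \<omega> $$ (j, l) / of_real r) w v)"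
  unfolding word_hs_scaled_paths
  by (intro integrable_divide_zero Bochner_Integration.integrable_sum)
    (auto intro: integrable_path_pair_prod)

lemma expectation_word_hs:
  "(\<integral>\<omega>. word_hs N (\<lambda>i j l. A i \<omega> $$ (j, l) / of_real r) w v \<partial>P) =
    (\<Sum>(p, q)\<in>path_pairs N (length w) (length v). pair_expectation w v p q) / of_real r ^ (length w + length v)"
proof -
  have "(\<integral>\<omega>. (\<Sum>(p, q)\<in>path_pairs N (length w) (length v).
      \<Prod>k<length w + length v. factor w v k (pair_edge (length w) p q k) \<omega>) \<partial>P) =
    (\<Sum>(p, q)\<in>path_pairs N (length w) (length v). pair_expectation w v p q)"
    unfolding case_prod_unfold pair_expectation_def
    by (rule Bochner_Integration.integral_sum) (auto intro: integrable_path_pair_prod)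
  then show ?thesis by (simp add: word_hs_scaled_paths)
qed

text \<open>
  At leading order only the pairs \<open>p = q\<close> without repeated vertex survive; there are about
  \<open>N\<^sup>n\<^sup>+\<^sup>1\<close> of them, each contributing \<open>1\<close> if \<open>w = v\<close> and \<open>0\<close> otherwise. Every other pair with nonzero
  expectation has at most \<open>(n + m + 1) / 2\<close> vertices, which is half a power of \<open>N\<close> too few.
\<close>

lemma expectation_word_hs_approx:
  fixes w v :: "'d list"
  defines "n \<equiv> length w" and "m \<equiv> length v"
  assumes N: "N \<ge> 1"
    and c: "\<And>i a l. a < N \<Longrightarrow> l < N \<Longrightarrow> (\<integral>\<omega>. cmod (A i \<omega> $$ (a, l)) ^ (n + m) \<partial>P) \<le> c"
  shows "cmod ((\<integral>\<omega>. word_hs N (\<lambda>i j l. A i \<omega> $$ (j, l) / of_real (sqrt N)) w v \<partial>P) / of_nat N - (if w = v then 1 else 0))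
    \<le> ((1 + real (n + m) * c) * real (((n + m + 1) div 2) ^ (n + m + 2)) + real (n ^ (n + 1))) / sqrt N"
proof -
  define R where "R = sqrt (real N)"
  have R: "R \<ge> 1" "R\<^sup>2 = real N" using N by (auto simp: R_def)
  define V where "V = (n + m + 1) div 2"
  let ?PQ = "path_pairs N n m" and ?U = "pair_expectation w v"
  define G where "G = {(p, q) \<in> ?PQ. p = q \<and> distinct p}"
  define B where "B = {(p, q) \<in> ?PQ. edges_repeated n m p q \<and> \<not> (p = q \<and> distinct p)}"
  have fin: "finite ?PQ" "finite G" "finite B"
    using finite_path_pairs[of N n m] by (auto simp: G_def B_def elim: rev_finite_subset)
  have "0 \<le> c"
  proof -
    have "0 \<le> (\<integral>\<omega>. cmod (A undefined \<omega> $$ (0, 0)) ^ (n + m) \<partial>P)" by (rule integral_nonneg_AE) simp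
    also have "\<dots> \<le> c" using N by (intro c) auto
    finally show ?thesis .
  qed
  have split: "(\<Sum>(p, q)\<in>?PQ. ?U p q) = (\<Sum>(p, q)\<in>G. ?U p q) + (\<Sum>(p, q)\<in>B. ?U p q)"
  proof -
    have "(\<Sum>(p, q)\<in>?PQ. ?U p q) = (\<Sum>(p, q)\<in>G \<union> B. ?U p q)"
    proof (rule sum.mono_neutral_right)
      show "\<forall>x\<in>?PQ - (G \<union> B). (case x of (p, q) \<Rightarrow> ?U p q) = 0"
        using pair_expectation_eq_0 by (auto simp: G_def B_def n_def m_def)
    qed (use fin in \<open>auto simp: G_def B_def\<close>)
    also have "\<dots> = (\<Sum>(p, q)\<in>G. ?U p q) + (\<Sum>(p, q)\<in>B. ?U p q)"
      by (rule sum.union_disjoint) (use fin in \<open>auto simp: G_def B_def\<close>)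
    finally show ?thesis .
  qed
  have G_sum: "(\<Sum>(p, q)\<in>G. ?U p q) = of_nat (card G) * (if w = v then 1 else 0)"
  proof -
    have "(\<Sum>(p, q)\<in>G. ?U p q) = (\<Sum>x\<in>G. if w = v then 1 else 0)"
      by (rule sum.cong) (auto simp: G_def n_def m_def pair_expectation_distinct)
    then show ?thesis by simp
  qed
  have card_B: "card B \<le> N ^ V * V ^ (n + m + 2)"
  proof -
    have "card B \<le> card {xs. length xs = n + m + 2 \<and> set xs \<subseteq> {..<N} \<and> card (set xs) \<le> V}"
    proof (rule card_inj_on_le[where f = "\<lambda>(p, q). p @ q"])
      show "inj_on (\<lambda>(p, q). p @ q) B" by (auto simp: inj_on_def B_def path_pairs_def)
      show "(\<lambda>(p, q). p @ q) ` B \<subseteq> {xs. length xs = n + m + 2 \<and> set xs \<subseteq> {..<N} \<and> card (set xs) \<le> V}"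
        using repeated_edges_dichotomy[of _ n _ m] by (fastforce simp: B_def path_pairs_def V_def)
      show "finite {xs. length xs = n + m + 2 \<and> set xs \<subseteq> {..<N} \<and> card (set xs) \<le> V}"
        by (rule finite_subset[OF _ finite_lists_length_eq[of "{..<N}" "n + m + 2"]]) auto
    qed
    also have "\<dots> \<le> N ^ V * V ^ (n + m + 2)" by (rule card_lists_few_entries_le[OF N])
    finally show ?thesis .
  qed
  have B_sum: "cmod (\<Sum>(p, q)\<in>B. ?U p q) \<le> R ^ (n + m + 1) * ((1 + real (n + m) * c) * real (V ^ (n + m + 2)))"
  proof -
    have "cmod (\<Sum>(p, q)\<in>B. ?U p q) \<le> (\<Sum>x\<in>B. 1 + real (n + m) * c)"
    proof (rule sum_norm_le)
      fix x assume "x \<in> B"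
      then show "cmod (case x of (p, q) \<Rightarrow> ?U p q) \<le> 1 + real (n + m) * c"
        using pair_expectation_le[of _ _ w v c] c by (auto simp: B_def n_def m_def)
    qed
    also have "\<dots> = real (card B) * (1 + real (n + m) * c)" by simp
    also have "\<dots> \<le> (R ^ (n + m + 1) * real (V ^ (n + m + 2))) * (1 + real (n + m) * c)"
    proof (rule mult_right_mono)
      have "real (card B) \<le> real (N ^ V * V ^ (n + m + 2))" using card_B of_nat_le_iff by blast
      also have "\<dots> = R ^ (2 * V) * real (V ^ (n + m + 2))" by (simp add: power_mult R(2))
      also have "\<dots> \<le> R ^ (n + m + 1) * real (V ^ (n + m + 2))"
        using R(1) by (intro mult_right_mono power_increasing) (auto simp: V_def)
      finally show "real (card B) \<le> R ^ (n + m + 1) * real (V ^ (n + m + 2))" .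
    qed (use \<open>0 \<le> c\<close> in simp)
    finally show ?thesis by (simp add: mult_ac)
  qed
  have G_part: "cmod (of_nat (card G) * (if w = v then 1 else 0) / of_real (R ^ (n + m + 2)) - (if w = v then 1 else 0))
      \<le> real (n ^ (n + 1)) / R"
  proof (cases "w = v")
    case True
    then have nm: "m = n" by (simp add: n_def m_def)
    let ?all = "{p. set p \<subseteq> {..<N} \<and> length p = n + 1}"
    let ?bad = "{p. length p = n + 1 \<and> set p \<subseteq> {..<N} \<and> card (set p) \<le> n}"
    have fin_all: "finite ?all" by (rule finite_lists_length_eq) simp
    have card_all: "card ?all = N ^ (n + 1)" by (subst card_lists_length_eq) auto
    have few: "card (set p) \<le> n \<longleftrightarrow> \<not> distinct p" if "length p = n + 1" for p :: "nat list"
    proof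
      assume "card (set p) \<le> n" then show "\<not> distinct p" using that distinct_card[of p] by auto
    next
      assume "\<not> distinct p"
      then show "card (set p) \<le> n" using that card_distinct[of p] card_length[of p] by linarith
    qed
    have "?all - ?bad = {p. length p = n + 1 \<and> set p \<subseteq> {..<N} \<and> distinct p}" using few by blast
    moreover have "G = (\<lambda>p. (p, p)) ` {p. length p = n + 1 \<and> set p \<subseteq> {..<N} \<and> distinct p}"
      by (auto simp: G_def path_pairs_def nm)
    ultimately have "G = (\<lambda>p. (p, p)) ` (?all - ?bad)" by simp
    then have "card G = card (?all - ?bad)" by (simp add: card_image inj_on_def)
    also have "\<dots> = card ?all - card ?bad"
      using fin_all by (intro card_Diff_subset) (auto elim: rev_finite_subset)
    finally have "N ^ (n + 1) \<le> card G + card ?bad" "card G \<le> N ^ (n + 1)" using card_all by auto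
    moreover have "card ?bad \<le> N ^ n * n ^ (n + 1)" by (rule card_lists_few_entries_le[OF N])
    ultimately have "real (N ^ (n + 1)) \<le> real (card G + N ^ n * n ^ (n + 1))" "real (card G) \<le> real (N ^ (n + 1))"
      unfolding of_nat_le_iff by linarith+
    then have "\<bar>real (card G) - real N ^ (n + 1)\<bar> \<le> real N ^ n * real (n ^ (n + 1))" by simp
    then have "\<bar>real (card G) - real N ^ (n + 1)\<bar> / real N ^ (n + 1) \<le> real N ^ n * real (n ^ (n + 1)) / real N ^ (n + 1)"
      by (rule divide_right_mono) simp
    also have "\<dots> = real (n ^ (n + 1)) / real N" using N by simp
    also have "\<dots> \<le> real (n ^ (n + 1)) / R"
    proof (rule divide_left_mono)
      show "R \<le> real N" using R by (metis mult_left_mono[of 1 R R] mult.right_neutral power2_eq_square order_trans zero_le_one)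
    qed (use R N in auto)
    finally have est: "\<bar>real (card G) - real N ^ (n + 1)\<bar> / real N ^ (n + 1) \<le> real (n ^ (n + 1)) / R" .
    have "R ^ (n + m + 2) = real N ^ (n + 1)"
    proof -
      have "n + m + 2 = 2 * (n + 1)" using nm by simp
      then show ?thesis by (simp only: power_mult R(2))
    qed
    then have "of_nat (card G) * (if w = v then 1 else 0) / of_real (R ^ (n + m + 2)) - (if w = v then 1 else 0)
        = complex_of_real ((real (card G) - real N ^ (n + 1)) / real N ^ (n + 1))"
      using True N by (simp add: diff_divide_distrib)
    then have "cmod (of_nat (card G) * (if w = v then 1 else 0) / of_real (R ^ (n + m + 2)) - (if w = v then 1 else 0))
        = \<bar>real (card G) - real N ^ (n + 1)\<bar> / real N ^ (n + 1)"
      by (simp only: norm_of_real abs_divide) simp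
    with est show ?thesis by simp
  qed (use R in simp)
  have "(\<integral>\<omega>. word_hs N (\<lambda>i j l. A i \<omega> $$ (j, l) / of_real (sqrt N)) w v \<partial>P) / of_nat N =
      (\<Sum>(p, q)\<in>?PQ. ?U p q) / of_real (R ^ (n + m + 2))"
  proof -
    have "complex_of_real (R\<^sup>2) = of_nat N" unfolding R(2) by simp
    then have "complex_of_real (R ^ (n + m + 2)) = of_real R ^ (n + m) * of_nat N"
      by (simp only: power_add of_real_mult of_real_power)
    then show ?thesis
      by (simp only: expectation_word_hs R_def[symmetric] n_def[symmetric] m_def[symmetric] divide_divide_eq_left)
  qed
  also have "\<dots> = of_nat (card G) * (if w = v then 1 else 0) / of_real (R ^ (n + m + 2))
      + (\<Sum>(p, q)\<in>B. ?U p q) / of_real (R ^ (n + m + 2))"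
    unfolding split G_sum by (rule add_divide_distrib)
  finally have "cmod ((\<integral>\<omega>. word_hs N (\<lambda>i j l. A i \<omega> $$ (j, l) / of_real (sqrt N)) w v \<partial>P) / of_nat N - (if w = v then 1 else 0))
     = cmod ((of_nat (card G) * (if w = v then 1 else 0) / of_real (R ^ (n + m + 2)) - (if w = v then 1 else 0))
      + (\<Sum>(p, q)\<in>B. ?U p q) / of_real (R ^ (n + m + 2)))"
    by (simp only: add_diff_eq diff_add_eq)
  also have "\<dots> \<le> real (n ^ (n + 1)) / R + cmod ((\<Sum>(p, q)\<in>B. ?U p q) / of_real (R ^ (n + m + 2)))"
    by (intro order_trans[OF norm_triangle_ineq] add_right_mono G_part)
  also have "cmod ((\<Sum>(p, q)\<in>B. ?U p q) / of_real (R ^ (n + m + 2))) \<le>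
      (1 + real (n + m) * c) * real (V ^ (n + m + 2)) / R"
  proof -
    have "cmod ((\<Sum>(p, q)\<in>B. ?U p q) / of_real (R ^ (n + m + 2))) = cmod (\<Sum>(p, q)\<in>B. ?U p q) / R ^ (n + m + 2)"
      unfolding norm_divide norm_of_real using R(1) by simp
    also have "\<dots> \<le> R ^ (n + m + 1) * ((1 + real (n + m) * c) * real (V ^ (n + m + 2))) / R ^ (n + m + 2)"
      using R(1) by (intro divide_right_mono B_sum) auto
    also have "\<dots> = (1 + real (n + m) * c) * real (V ^ (n + m + 2)) / R"
      using R(1) by (simp add: field_simps)
    finally show ?thesis .
  qed
  finally show ?thesis unfolding R_def V_def by (simp add: add_divide_distrib add.commute)
qed

end

section \<open>Passage to the limit\<close>

lemma has_rs_integral_cong: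
  assumes "has_rs_integral f g I a b" "\<And>x. x \<in> {a..b} \<Longrightarrow> f x = f' x"
  shows "has_rs_integral f' g I a b"
proof -
  have "rs_sum f' g p = rs_sum f g p" if "p tagged_division_of {a..b}" for p
  proof (intro sum.cong refl, clarify)
    fix x K assume "(x, K) \<in> p"
    then have "x \<in> {a..b}" using tagged_division_ofD(2,3)[OF that] by blast
    then show "(g (Sup K) - g (Inf K)) *\<^sub>R f' x = (g (Sup K) - g (Inf K)) *\<^sub>R f x"
      using assms(2) by simp
  qed
  then show ?thesis using assms(1) unfolding has_rs_integral_def by (simp cong: conj_cong imp_cong)
qed

text \<open>
  The matrix equation in the entrywise form of \<open>picard_series\<close>. The integrands have to be compared on the
  interval of integration only, since \<open>Z\<close> is arbitrary outside \<open>{0..T}\<close>.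
\<close>

lemma (in controlled_path) solves_cde_picard_series:
  assumes sol: "solves_cde T N A \<gamma> Z" and A: "\<And>i. A i \<in> carrier_mat N N"
    and t: "0 \<le> t" "t \<le> T" and jk: "j < N" "k < N"
  shows "(\<lambda>m. picard_term \<gamma> N (\<lambda>i j l. A i $$ (j, l) / of_real (sqrt N)) t m j k) sums Z t $$ (j, k)"
proof (rule picard_series[where Z = "\<lambda>t j k. Z t $$ (j, k)", OF _ _ t jk])
  show cont: "continuous_on {0..T} (\<lambda>t. Z t $$ (j, k))" if "j < N" "k < N" for j k
    using sol that unfolding solves_cde_def by blast
  fix t j k assume t: "0 \<le> t" "t \<le> T" and jk: "j < N" "k < N"
  have Z: "Z u \<in> carrier_mat N N" if "u \<in> {0..T}" for u using sol that unfolding solves_cde_def by blast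
  have "1 / complex_of_real (sqrt N) * rs_integral 0 t (\<lambda>u. (Z u * A i) $$ (j, k)) (\<lambda>u. vec_nth (\<gamma> u) i) =
      rs_integral 0 t (\<lambda>u. \<Sum>l<N. Z u $$ (j, l) * (A i $$ (l, k) / of_real (sqrt N))) (\<lambda>u. vec_nth (\<gamma> u) i)" for i
  proof -
    have entry: "(\<Sum>l<N. Z u $$ (j, l) * A i $$ (l, k)) = (Z u * A i) $$ (j, k)" if "u \<in> {0..t}" for u
      using Z[of u] A[of i] that t jk by (simp add: scalar_prod_def lessThan_atLeast0)
    have "has_rs_integral (\<lambda>u. \<Sum>l<N. Z u $$ (j, l) * A i $$ (l, k)) (\<lambda>u. vec_nth (\<gamma> u) i)
        (rs_integral 0 t (\<lambda>u. \<Sum>l<N. Z u $$ (j, l) * A i $$ (l, k)) (\<lambda>u. vec_nth (\<gamma> u) i)) 0 t" (is "has_rs_integral ?f ?g ?I 0 t")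
      using jk by (intro has_rs_integral_on_initial_segment t continuous_intros cont) auto
    note I = this
    have "rs_integral 0 t (\<lambda>u. (Z u * A i) $$ (j, k)) ?g = ?I"
      by (rule rs_integral_eq[OF has_rs_integral_cong[OF I entry]])
    moreover have "rs_integral 0 t (\<lambda>u. 1 / complex_of_real (sqrt N) * ?f u) ?g = 1 / complex_of_real (sqrt N) * ?I"
      by (rule rs_integral_eq[OF has_rs_integral_bounded_linear[OF bounded_linear_mult_right I]])
    ultimately show ?thesis by (simp add: sum_divide_distrib)
  qed
  moreover have "Z t $$ (j, k) = (if j = k then 1 else 0) + 1 / complex_of_real (sqrt N) *
      (\<Sum>i\<in>UNIV. rs_integral 0 t (\<lambda>u. (Z u * A i) $$ (j, k)) (\<lambda>u. vec_nth (\<gamma> u) i))"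
  proof -
    have "Z 0 = 1\<^sub>m N" using sol by (simp only: solves_cde_def)
    then have "Z 0 $$ (j, k) = (if j = k then 1 else 0)" using jk by simp
    then show ?thesis
      using sol[unfolded solves_cde_def, THEN conjunct2, THEN conjunct2, THEN conjunct2, rule_format, of t j k] t jk
      by simp
  qed
  ultimately show "Z t $$ (j, k) = (if j = k then 1 else 0) +
      (\<Sum>i\<in>UNIV. rs_integral 0 t (\<lambda>u. \<Sum>l<N. Z u $$ (j, l) * (A i $$ (l, k) / of_real (sqrt N))) (\<lambda>u. vec_nth (\<gamma> u) i))"
    by (simp only: sum_distrib_left)
qed

lemma path_space_controlled_path:
  fixes \<gamma> :: "real \<Rightarrow> real ^ 'd::finite"
  assumes "\<gamma> \<in> path_space T"
  obtains L where "controlled_path T L \<gamma>"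
proof -
  obtain L where "L 0 = 0" "\<And>i. controlled_by 0 T L (\<lambda>u. vec_nth (\<gamma> u) i)"
    using path_space_controlled[OF assms] by blast
  moreover have "continuous_on {0..T} \<gamma>" using assms by (simp add: path_space_def)
  ultimately show ?thesis using that controlled_path.intro by blast
qed

text \<open>
  Log-convexity of \<open>\<Gamma>\<close> at the midpoint \<open>k / 2 + 1\<close> of \<open>1\<close> and \<open>k + 1\<close>.
\<close>

lemma Gamma_half_le_sqrt_fact: "Gamma (real k / 2 + 1) \<le> sqrt (fact k)"
proof -
  have "(ln \<circ> Gamma) ((1 - 1/2) *\<^sub>R 1 + (1/2) *\<^sub>R (1 + real k)) \<le>
      (1 - 1/2) * (ln \<circ> Gamma) 1 + 1/2 * (ln \<circ> Gamma) (1 + real k)"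
    by (rule convex_onD[OF log_convex_Gamma_real]) auto
  then have "ln (Gamma (real k / 2 + 1)) \<le> ln (fact k) / 2"
    by (simp add: Gamma_fact add_divide_distrib add.commute)
  also have "\<dots> = ln (sqrt (fact k))" by (simp add: ln_sqrt)
  finally show ?thesis by (subst (asm) ln_le_cancel_iff) (auto intro: Gamma_real_pos)
qed

lemma summable_power_div_fact_Gamma:
  fixes x :: real
  assumes x: "x \<ge> 0"
  shows "summable (\<lambda>k. x ^ k / fact k * Gamma (real k / 2 + 1))"
proof (rule summable_comparison_test')
  show "summable (\<lambda>k. x ^ k / sqrt (fact k))"
  proof (rule summable_ratio_test)
    fix n assume n: "n \<ge> nat \<lceil>4 * x\<^sup>2\<rceil>"
    have "(2 * x)\<^sup>2 \<le> real (Suc n)" using n by (simp add: power2_eq_square)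
    then have "2 * x \<le> sqrt (real (Suc n))" by (rule real_le_rsqrt)
    then have "x / sqrt (real (Suc n)) \<le> 1 / 2" by (simp add: divide_simps)
    then have "x ^ n / sqrt (fact n) * (x / sqrt (real (Suc n))) \<le> x ^ n / sqrt (fact n) * (1 / 2)"
      using x by (intro mult_left_mono) auto
    moreover have "x ^ Suc n / sqrt (fact (Suc n)) = x ^ n / sqrt (fact n) * (x / sqrt (real (Suc n)))"
      by (simp add: real_sqrt_mult mult_ac)
    ultimately show "norm (x ^ Suc n / sqrt (fact (Suc n))) \<le> 1 / 2 * norm (x ^ n / sqrt (fact n))"
      using x by simp
  qed simp
  fix k
  have "x ^ k / fact k * Gamma (real k / 2 + 1) \<le> x ^ k / fact k * sqrt (fact k)"
    using x by (intro mult_left_mono Gamma_half_le_sqrt_fact) auto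
  also have "\<dots> = x ^ k / sqrt (fact k)"
    by (simp add: divide_simps)
  finally show "norm (x ^ k / fact k * Gamma (real k / 2 + 1)) \<le> x ^ k / sqrt (fact k)"
    using x Gamma_real_pos[of "real k / 2 + 1"] by (simp add: abs_mult)
qed

lemma integrable_of_nn_bound:
  fixes f :: "'a \<Rightarrow> real"
  assumes f: "f \<in> borel_measurable P" "\<And>x. x \<in> space P \<Longrightarrow> f x \<ge> 0" and c: "c \<ge> 0"
    and le: "(\<integral>\<^sup>+x. ennreal (f x) \<partial>P) \<le> ennreal c"
  shows "integrable P f" "(\<integral>x. f x \<partial>P) \<le> c"
proof -
  show int: "integrable P f"
    using f le by (intro integrableI_nonneg) (auto intro: order_le_less_trans)
  have "(\<integral>\<^sup>+x. ennreal (f x) \<partial>P) = ennreal (\<integral>x. f x \<partial>P)"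
    using f by (intro nn_integral_eq_integral[OF int]) auto
  then show "(\<integral>x. f x \<partial>P) \<le> c" using le c by simp
qed

text \<open>
  Equal words have equal length, so only even total degrees \<open>k = 2 n\<close> survive, with \<open>n\<close> letters on either
  side.
\<close>

lemma diagonal_word_sum:
  "(\<Sum>n\<le>k. \<Sum>w | length w = n. \<Sum>v | length v = k - n.
      complex_of_real (signature n \<gamma> 0 s w * signature (k - n) \<sigma> 0 t v) * (if w = v then 1 else 0)) =
    (if even k then complex_of_real (tensor_hs (k div 2) (signature (k div 2) \<gamma> 0 s) (signature (k div 2) \<sigma> 0 t)) else 0)"
  for \<gamma> \<sigma> :: "real \<Rightarrow> real ^ 'd::finite"
proof -
  define g where "g n = (\<Sum>w :: 'd list | length w = n. \<Sum>v | length v = k - n.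
      complex_of_real (signature n \<gamma> 0 s w * signature (k - n) \<sigma> 0 t v) * (if w = v then 1 else 0))" for n
  have zero: "g n = 0" if "n \<noteq> k - n" for n
    unfolding g_def using that by (intro sum.neutral ballI) auto
  have diag: "g n = complex_of_real (tensor_hs n (signature n \<gamma> 0 s) (signature n \<sigma> 0 t))" if "n = k - n" for n
  proof -
    have "(\<Sum>v | length v = n. complex_of_real (signature n \<gamma> 0 s w * signature n \<sigma> 0 t v) * (if w = v then 1 else 0)) =
        complex_of_real (signature n \<gamma> 0 s w * signature n \<sigma> 0 t w)" if "length w = n" for w
      using that by (simp add: if_distrib[of "\<lambda>x. _ * x"] finite_words cong: if_cong)
    then show ?thesis unfolding g_def that[symmetric] tensor_hs_def by simp
  qed
  have lhs: "(\<Sum>n\<le>k. \<Sum>w | length w = n. \<Sum>v | length v = k - n.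
      complex_of_real (signature n \<gamma> 0 s w * signature (k - n) \<sigma> 0 t v) * (if w = v then 1 else 0)) = (\<Sum>n\<le>k. g n)"
    unfolding g_def ..
  show ?thesis
  proof (cases "even k")
    case True
    then have "(\<Sum>n\<le>k. g n) = (\<Sum>n\<in>{k div 2}. g n)"
      by (intro sum.mono_neutral_right) (auto intro!: zero)
    also have "\<dots> = g (k div 2)" by simp
    also have "\<dots> = complex_of_real (tensor_hs (k div 2) (signature (k div 2) \<gamma> 0 s) (signature (k div 2) \<sigma> 0 t))"
      using True by (intro diag) presburger
    finally show ?thesis unfolding lhs using True by simp
  next
    case False
    then have "n \<noteq> k - n" if "n \<le> k" for n using that by presburger
    then have "(\<Sum>n\<le>k. g n) = 0" using zero by (intro sum.neutral) auto
    then show ?thesis unfolding lhs using False by simp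
  qed
qed

lemma integral_triple_sum:
  fixes g :: "'b \<Rightarrow> 'c \<Rightarrow> 'a \<Rightarrow> complex"
  assumes g: "\<And>w v. integrable P (g w v)"
  shows "(\<integral>\<omega>. (\<Sum>n\<in>I. \<Sum>w\<in>W n. \<Sum>v\<in>V n. c n w v * g w v \<omega>) \<partial>P) =
    (\<Sum>n\<in>I. \<Sum>w\<in>W n. \<Sum>v\<in>V n. c n w v * (\<integral>\<omega>. g w v \<omega> \<partial>P))"
proof -
  have 1: "integrable P (\<lambda>\<omega>. c n w v * g w v \<omega>)" for n w v
    by (intro integrable_mult_right g)
  have 2: "integrable P (\<lambda>\<omega>. \<Sum>v\<in>V n. c n w v * g w v \<omega>)" for n w
    by (intro Bochner_Integration.integrable_sum 1)
  have 3: "integrable P (\<lambda>\<omega>. \<Sum>w\<in>W n. \<Sum>v\<in>V n. c n w v * g w v \<omega>)" for n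
    by (intro Bochner_Integration.integrable_sum 2)
  show ?thesis
    by (simp only: Bochner_Integration.integral_sum[OF 1] Bochner_Integration.integral_sum[OF 2]
        Bochner_Integration.integral_sum[OF 3] integral_mult_right_zero)
qed

theorem theorem2p1:
  fixes T :: real
    and P :: "'w measure"
    and A :: "nat \<Rightarrow> 'd::finite \<Rightarrow> 'w \<Rightarrow> complex mat"
    and \<gamma> \<sigma> :: "real \<Rightarrow> real ^ 'd"
    and Z\<gamma> Z\<sigma> :: "nat \<Rightarrow> 'w \<Rightarrow> real \<Rightarrow> complex mat"
  assumes T_pos: "T > 0"
    and prob: "prob_space P"
    and dim: "\<And>N i \<omega>. N \<ge> 1 \<Longrightarrow> \<omega> \<in> space P \<Longrightarrow> A N i \<omega> \<in> carrier_mat N N"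
    and meas: "\<And>N i m l. N \<ge> 1 \<Longrightarrow> m < N \<Longrightarrow> l < N \<Longrightarrow>
                 (\<lambda>\<omega>. A N i \<omega> $$ (m, l)) \<in> borel_measurable P"
    and moments: "\<And>k::nat. \<exists>c::real. \<forall>N\<ge>1. \<forall>i. \<forall>m<N. \<forall>l<N.
                 (\<integral>\<^sup>+\<omega>. ennreal (cmod (A N i \<omega> $$ (m, l)) ^ k) \<partial>P) \<le> ennreal c"
    and mean: "\<And>N i m l. N \<ge> 1 \<Longrightarrow> m < N \<Longrightarrow> l < N \<Longrightarrow>
                 (\<integral>\<omega>. A N i \<omega> $$ (m, l) \<partial>P) = 0"
    and second_moment: "\<And>N i m l. N \<ge> 1 \<Longrightarrow> m < N \<Longrightarrow> l < N \<Longrightarrow>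
                 (\<integral>\<omega>. (cmod (A N i \<omega> $$ (m, l)))\<^sup>2 \<partial>P) = 1"
    and op_norm_moments: "\<exists>\<kappa>>0. \<forall>p::nat. \<forall>N\<ge>1. \<forall>i.
                 (\<integral>\<^sup>+\<omega>. ennreal (real N powr (- real p / 2) * op_norm (A N i \<omega>) ^ p) \<partial>P)
                   \<le> ennreal (\<kappa> ^ p * Gamma (real p / 2 + 1))"
    and indep: "\<And>N. N \<ge> 1 \<Longrightarrow>
                 prob_space.indep_sets P (entry_sigma P (A N)) ({..<N} \<times> {..<N})"
    and uncorrelated: "\<And>N i j m l. N \<ge> 1 \<Longrightarrow> i \<noteq> j \<Longrightarrow> m < N \<Longrightarrow> l < N \<Longrightarrow>
                 (\<integral>\<omega>. cnj (A N i \<omega> $$ (m, l)) * A N j \<omega> $$ (m, l) \<partial>P) = 0"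
    and \<gamma>: "\<gamma> \<in> path_space T"
    and \<sigma>: "\<sigma> \<in> path_space T"
    and Z\<gamma>: "\<And>N \<omega>. N \<ge> 1 \<Longrightarrow> \<omega> \<in> space P \<Longrightarrow> solves_cde T N (\<lambda>i. A N i \<omega>) \<gamma> (Z\<gamma> N \<omega>)"
    and Z\<sigma>: "\<And>N \<omega>. N \<ge> 1 \<Longrightarrow> \<omega> \<in> space P \<Longrightarrow> solves_cde T N (\<lambda>i. A N i \<omega>) \<sigma> (Z\<sigma> N \<omega>)"
  shows "\<forall>s\<in>{0..T}. \<forall>t\<in>{0..T}.
           (\<forall>N\<ge>1. integrable P (\<lambda>\<omega>. mat_hs (Z\<gamma> N \<omega> s) (Z\<sigma> N \<omega> t))) \<and>
           ((\<lambda>N. 1 / of_nat N * (\<integral>\<omega>. mat_hs (Z\<gamma> N \<omega> s) (Z\<sigma> N \<omega> t) \<partial>P))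
              \<longlonglongrightarrow> complex_of_real (sig_kernel \<gamma> \<sigma> s t))"
proof (intro ballI)
  fix s t assume "s \<in> {0..T}" "t \<in> {0..T}"
  then have s: "0 \<le> s" "s \<le> T" and t: "0 \<le> t" "t \<le> T" by auto
  obtain L where L: "controlled_path T L \<gamma>" using path_space_controlled_path[OF \<gamma>] .
  obtain K where K: "controlled_path T K \<sigma>" using path_space_controlled_path[OF \<sigma>] .
  obtain \<kappa> where \<kappa>: "\<kappa> > 0" and op: "\<And>p N i. N \<ge> 1 \<Longrightarrow>
      (\<integral>\<^sup>+\<omega>. ennreal (real N powr (- real p / 2) * op_norm (A N i \<omega>) ^ p) \<partial>P) \<le> ennreal (\<kappa> ^ p * Gamma (real p / 2 + 1))"
    using op_norm_moments by blast
  define x where "x = real CARD('d) * (L s + K t)"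
  have x: "x \<ge> 0"
    using controlled_path.control_nonneg[OF L s] controlled_path.control_nonneg[OF K t] by (simp add: x_def)
  \<comment> \<open>The real constants in the moment hypothesis may be negative, hence the maximum with \<open>0\<close> below.\<close>
  define c where "c k = (SOME c. \<forall>N\<ge>1. \<forall>i. \<forall>m<N. \<forall>l<N.
      (\<integral>\<^sup>+\<omega>. ennreal (cmod (A N i \<omega> $$ (m, l)) ^ k) \<partial>P) \<le> ennreal c)" for k
  have moment: "integrable P (\<lambda>\<omega>. cmod (A N i \<omega> $$ (m, l)) ^ k)"
    "(\<integral>\<omega>. cmod (A N i \<omega> $$ (m, l)) ^ k \<partial>P) \<le> max 0 (c k)"
    if "N \<ge> 1" "m < N" "l < N" for N i m l k
  proof -
    have "(\<integral>\<^sup>+\<omega>. ennreal (cmod (A N i \<omega> $$ (m, l)) ^ k) \<partial>P) \<le> ennreal (c k)"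
      using someI_ex[OF moments[of k]] that unfolding c_def by blast
    also have "\<dots> \<le> ennreal (max 0 (c k))" by (intro ennreal_leI) simp
    finally have le: "(\<integral>\<^sup>+\<omega>. ennreal (cmod (A N i \<omega> $$ (m, l)) ^ k) \<partial>P) \<le> ennreal (max 0 (c k))" .
    have [measurable]: "(\<lambda>\<omega>. A N i \<omega> $$ (m, l)) \<in> borel_measurable P" by (rule meas[OF that])
    have "(\<lambda>\<omega>. cmod (A N i \<omega> $$ (m, l)) ^ k) \<in> borel_measurable P" by measurable
    from integrable_of_nn_bound[OF this _ _ le]
    show "integrable P (\<lambda>\<omega>. cmod (A N i \<omega> $$ (m, l)) ^ k)"
      "(\<integral>\<omega>. cmod (A N i \<omega> $$ (m, l)) ^ k \<partial>P) \<le> max 0 (c k)" by simp_all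
  qed
  have ens: "independent_entries P N (A N)" if N: "N \<ge> 1" for N
  proof -
    interpret prob_space P by (rule prob)
    show ?thesis
      by unfold_locales
        (use meas mean second_moment uncorrelated indep moment N in \<open>simp_all\<close>)
  qed
  \<comment> \<open>The normalised matrices, their operator norms, and the part of degree \<open>k\<close> of the inner product.\<close>
  define M where "M N \<omega> i j l = A N i \<omega> $$ (j, l) / complex_of_real (sqrt (real N))" for N \<omega> i j l
  have M_eq: "M N \<omega> = (\<lambda>i j l. A N i \<omega> $$ (j, l) / complex_of_real (sqrt (real N)))" for N \<omega>
    by (intro ext) (simp add: M_def)
  define b where "b N \<omega> i = op_norm (A N i \<omega>) / sqrt (real N)" for N \<omega> i
  define F where "F N k \<omega> = hs_term \<gamma> \<sigma> s t N (M N \<omega>) k" for N k \<omega>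
  have b_nonneg: "b N \<omega> i \<ge> 0" if "N \<ge> 1" "\<omega> \<in> space P" for N \<omega> i
    using op_norm_nonneg[OF dim[OF that]] by (simp add: b_def)
  have M_le: "L2_set (\<lambda>j. cmod (\<Sum>l<N. M N \<omega> i j l * y l)) {..<N} \<le> b N \<omega> i * L2_set (\<lambda>l. cmod (y l)) {..<N}"
    if N: "N \<ge> 1" "\<omega> \<in> space P" for N \<omega> i y
  proof -
    have "(\<Sum>l<N. M N \<omega> i j l * y l) = (\<Sum>l<N. A N i \<omega> $$ (j, l) * y l) / of_real (sqrt N)" for j
      by (simp add: M_def sum_divide_distrib)
    then have "L2_set (\<lambda>j. cmod (\<Sum>l<N. M N \<omega> i j l * y l)) {..<N} =
        L2_set (\<lambda>j. cmod (\<Sum>l<N. A N i \<omega> $$ (j, l) * y l) * (1 / sqrt N)) {..<N}"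
      by (simp add: norm_divide)
    also have "\<dots> = L2_set (\<lambda>j. cmod (\<Sum>l<N. A N i \<omega> $$ (j, l) * y l)) {..<N} * (1 / sqrt N)"
      by (rule L2_set_left_distrib[symmetric]) simp
    also have "\<dots> \<le> op_norm (A N i \<omega>) * L2_set (\<lambda>l. cmod (y l)) {..<N} * (1 / sqrt N)"
      by (intro mult_right_mono L2_set_mult_vec_le dim that) simp
    finally show ?thesis by (simp add: b_def)
  qed
  have F_le: "cmod (F N k \<omega>) \<le> real N * (x ^ k / fact k) * (\<Sum>i\<in>UNIV. b N \<omega> i ^ k)"
    if "N \<ge> 1" "\<omega> \<in> space P" for N k \<omega>
    unfolding F_def x_def by (rule hs_term_le[OF L K b_nonneg[OF that] M_le[OF that] s t])
  have F_sums: "(\<lambda>k. F N k \<omega>) sums mat_hs (Z\<gamma> N \<omega> s) (Z\<sigma> N \<omega> t)" if N: "N \<ge> 1" "\<omega> \<in> space P" for N \<omega>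
  proof -
    have car: "Z\<gamma> N \<omega> s \<in> carrier_mat N N" "Z\<sigma> N \<omega> t \<in> carrier_mat N N"
      using Z\<gamma>[OF N] Z\<sigma>[OF N] s t unfolding solves_cde_def by auto
    show ?thesis
      unfolding mat_hs_eq[OF car] F_def
    proof (rule hs_term_sums[OF L K b_nonneg[OF N] M_le[OF N] s t])
      show "(\<lambda>m. picard_term \<gamma> N (M N \<omega>) s m j l) sums Z\<gamma> N \<omega> s $$ (j, l)" if "j < N" "l < N" for j l
        unfolding M_eq by (rule controlled_path.solves_cde_picard_series[OF L Z\<gamma>[OF N] dim[OF N] s that])
      show "(\<lambda>m. picard_term \<sigma> N (M N \<omega>) t m j l) sums Z\<sigma> N \<omega> t $$ (j, l)" if "j < N" "l < N" for j l
        unfolding M_eq by (rule controlled_path.solves_cde_picard_series[OF K Z\<sigma>[OF N] dim[OF N] t that])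
    qed
  qed
  have b_moment: "integrable P (\<lambda>\<omega>. b N \<omega> i ^ k)" "(\<integral>\<omega>. b N \<omega> i ^ k \<partial>P) \<le> \<kappa> ^ k * Gamma (real k / 2 + 1)"
    if N: "N \<ge> 1" for N i k
  proof -
    have pw: "b N \<omega> i ^ k = real N powr (- real k / 2) * op_norm (A N i \<omega>) ^ k" for \<omega>
    proof -
      have "real N powr (- real k / 2) = 1 / (real N powr (1 / 2)) powr real k"
        by (simp add: powr_powr powr_minus_divide)
      also have "\<dots> = 1 / sqrt (real N) ^ k" using N by (simp add: powr_half_sqrt powr_realpow)
      finally show ?thesis by (simp add: b_def power_divide)
    qed
    have le: "(\<integral>\<^sup>+\<omega>. ennreal (b N \<omega> i ^ k) \<partial>P) \<le> ennreal (\<kappa> ^ k * Gamma (real k / 2 + 1))"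
      unfolding pw by (rule op[OF N])
    have bm: "(\<lambda>\<omega>. b N \<omega> i ^ k) \<in> borel_measurable P"
      unfolding b_def by (intro borel_measurable_power borel_measurable_divide borel_measurable_const
          borel_measurable_op_norm[where N = N] dim meas N)
    have nonneg: "0 \<le> b N \<omega> i ^ k" if "\<omega> \<in> space P" for \<omega> using b_nonneg[OF N that] by simp
    have c: "0 \<le> \<kappa> ^ k * Gamma (real k / 2 + 1)"
      using \<kappa> Gamma_real_pos[of "real k / 2 + 1"] by simp
    show "integrable P (\<lambda>\<omega>. b N \<omega> i ^ k)" "(\<integral>\<omega>. b N \<omega> i ^ k \<partial>P) \<le> \<kappa> ^ k * Gamma (real k / 2 + 1)"
      by (rule integrable_of_nn_bound[OF bm nonneg c le], assumption)+
  qed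
  have word_int: "integrable P (\<lambda>\<omega>. word_hs N (M N \<omega>) w v)" if "N \<ge> 1" for N w v
    unfolding M_eq by (rule independent_entries.integrable_word_hs[OF ens[OF that]])
  have F_int: "integrable P (F N k)" if "N \<ge> 1" for N k
    unfolding F_def[abs_def] hs_term_def using word_int[OF that]
    by (intro Bochner_Integration.integrable_sum integrable_mult_right) auto
  \<comment> \<open>The dominating sequence: it is summable and independent of \<open>N\<close>.\<close>
  define B where "B k = real CARD('d) * ((\<kappa> * x) ^ k / fact k * Gamma (real k / 2 + 1))" for k
  have B_summable: "summable B"
    unfolding B_def using \<kappa> x by (intro summable_mult summable_power_div_fact_Gamma) auto
  have F_norm: "(\<integral>\<omega>. cmod (F N k \<omega>) \<partial>P) \<le> real N * B k" if N: "N \<ge> 1" for N k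
  proof -
    have "(\<integral>\<omega>. cmod (F N k \<omega>) \<partial>P) \<le> (\<integral>\<omega>. real N * (x ^ k / fact k) * (\<Sum>i\<in>UNIV. b N \<omega> i ^ k) \<partial>P)"
      using F_le[OF N] F_int[OF N] b_moment(1)[OF N]
      by (intro integral_mono integrable_norm integrable_mult_right Bochner_Integration.integrable_sum) auto
    also have "\<dots> = real N * (x ^ k / fact k) * (\<Sum>i\<in>UNIV. \<integral>\<omega>. b N \<omega> i ^ k \<partial>P)"
      using b_moment(1)[OF N] by simp
    also have "\<dots> \<le> real N * (x ^ k / fact k) * (\<Sum>i\<in>(UNIV :: 'd set). \<kappa> ^ k * Gamma (real k / 2 + 1))"
      using b_moment(2)[OF N] x by (intro mult_left_mono sum_mono) auto
    also have "\<dots> = real N * B k" by (simp add: B_def power_mult_distrib)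
    finally show ?thesis .
  qed
  have int: "integrable P (\<lambda>\<omega>. mat_hs (Z\<gamma> N \<omega> s) (Z\<sigma> N \<omega> t))"
    "(\<integral>\<omega>. mat_hs (Z\<gamma> N \<omega> s) (Z\<sigma> N \<omega> t) \<partial>P) = (\<Sum>k. \<integral>\<omega>. F N k \<omega> \<partial>P)" if N: "N \<ge> 1" for N
  proof -
    have abs: "AE \<omega> in P. summable (\<lambda>k. norm (F N k \<omega>))"
    proof (rule AE_I2)
      fix \<omega> assume \<omega>: "\<omega> \<in> space P"
      have "summable (\<lambda>k. (x * b N \<omega> i) ^ k / fact k)" for i
        using summable_exp[of "x * b N \<omega> i"] by (simp add: divide_inverse mult.commute)
      then have "summable (\<lambda>k. real N * (\<Sum>i\<in>UNIV. (x * b N \<omega> i) ^ k / fact k))"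
        by (intro summable_mult summable_sum)
      then show "summable (\<lambda>k. norm (F N k \<omega>))"
      proof (rule summable_comparison_test')
        fix k
        show "norm (norm (F N k \<omega>)) \<le> real N * (\<Sum>i\<in>UNIV. (x * b N \<omega> i) ^ k / fact k)"
          using F_le[OF N \<omega>, of k] by (simp add: power_mult_distrib sum_divide_distrib sum_distrib_left mult.assoc)
      qed
    qed
    have tot: "summable (\<lambda>k. \<integral>\<omega>. norm (F N k \<omega>) \<partial>P)"
    proof (rule summable_comparison_test')
      show "summable (\<lambda>k. real N * B k)" by (intro summable_mult B_summable)
      show "norm (\<integral>\<omega>. norm (F N k \<omega>) \<partial>P) \<le> real N * B k" for k
        using F_norm[OF N, of k] by (simp add: integral_nonneg_AE)
    qed
    have eq: "mat_hs (Z\<gamma> N \<omega> s) (Z\<sigma> N \<omega> t) = (\<Sum>k. F N k \<omega>)" if "\<omega> \<in> space P" for \<omega>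
      using F_sums[OF N that] by (simp add: sums_iff)
    have "integrable P (\<lambda>\<omega>. \<Sum>k. F N k \<omega>)" by (rule integrable_suminf[OF F_int[OF N] abs tot])
    then show "integrable P (\<lambda>\<omega>. mat_hs (Z\<gamma> N \<omega> s) (Z\<sigma> N \<omega> t))"
      using eq Bochner_Integration.integrable_cong[of P P "\<lambda>\<omega>. mat_hs (Z\<gamma> N \<omega> s) (Z\<sigma> N \<omega> t)" "\<lambda>\<omega>. \<Sum>k. F N k \<omega>"] by simp
    show "(\<integral>\<omega>. mat_hs (Z\<gamma> N \<omega> s) (Z\<sigma> N \<omega> t) \<partial>P) = (\<Sum>k. \<integral>\<omega>. F N k \<omega> \<partial>P)"
      using eq Bochner_Integration.integral_cong[of P P "\<lambda>\<omega>. mat_hs (Z\<gamma> N \<omega> s) (Z\<sigma> N \<omega> t)" "\<lambda>\<omega>. \<Sum>k. F N k \<omega>"]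
        integral_suminf[OF F_int[OF N] abs tot] by simp
  qed
  \<comment> \<open>Tannery's theorem is applied to \<open>a\<close>, whose terms converge to \<open>S\<close>.\<close>
  define a where "a k N = (\<integral>\<omega>. F N k \<omega> \<partial>P) / of_nat N" for k N
  define S where "S k = (if even k then complex_of_real (tensor_hs (k div 2) (signature (k div 2) \<gamma> 0 s) (signature (k div 2) \<sigma> 0 t)) else 0)" for k
  have word_lim: "(\<lambda>N. (\<integral>\<omega>. word_hs N (M N \<omega>) w v \<partial>P) / of_nat N) \<longlonglongrightarrow> (if w = v then 1 else 0)" for w v
  proof -
    define C where "C = (1 + real (length w + length v) * max 0 (c (length w + length v))) *
        real (((length w + length v + 1) div 2) ^ (length w + length v + 2)) + real (length w ^ (length w + 1))"
    have bd: "cmod ((\<integral>\<omega>. word_hs N (M N \<omega>) w v \<partial>P) / of_nat N - (if w = v then 1 else 0)) \<le> C / sqrt N" if N: "N \<ge> 1" for N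
      unfolding M_eq C_def by (rule independent_entries.expectation_word_hs_approx[OF ens[OF N] N moment(2)[OF N]])
    have lim: "(\<lambda>N. C / sqrt (real N)) \<longlonglongrightarrow> 0"
      by (intro tendsto_divide_0[OF tendsto_const] filterlim_at_top_imp_at_infinity
          filterlim_compose[OF sqrt_at_top filterlim_real_sequentially])
    have "(\<lambda>N. (\<integral>\<omega>. word_hs N (M N \<omega>) w v \<partial>P) / of_nat N - (if w = v then 1 else 0)) \<longlonglongrightarrow> 0"
      by (rule Lim_null_comparison[OF eventually_sequentiallyI[OF bd] lim])
    then show ?thesis by (rule LIM_zero_cancel)
  qed
  have a_lim: "a k \<longlonglongrightarrow> S k" for k
  proof -
    have a_eq: "a k N = (\<Sum>n\<le>k. \<Sum>w | length w = n. \<Sum>v | length v = k - n.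
        complex_of_real (signature n \<gamma> 0 s w * signature (k - n) \<sigma> 0 t v) * ((\<integral>\<omega>. word_hs N (M N \<omega>) w v \<partial>P) / of_nat N))"
      if N: "N \<ge> 1" for N
      unfolding a_def F_def hs_term_def integral_triple_sum[OF word_int[OF N]] sum_divide_distrib times_divide_eq_right ..
    have ev: "eventually (\<lambda>N. (\<Sum>n\<le>k. \<Sum>w | length w = n. \<Sum>v | length v = k - n.
        complex_of_real (signature n \<gamma> 0 s w * signature (k - n) \<sigma> 0 t v) * ((\<integral>\<omega>. word_hs N (M N \<omega>) w v \<partial>P) / of_nat N)) = a k N) sequentially"
      by (intro eventually_sequentiallyI[of 1]) (rule a_eq[symmetric])
    have "(\<lambda>N. \<Sum>n\<le>k. \<Sum>w | length w = n. \<Sum>v | length v = k - n.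
        complex_of_real (signature n \<gamma> 0 s w * signature (k - n) \<sigma> 0 t v) * ((\<integral>\<omega>. word_hs N (M N \<omega>) w v \<partial>P) / of_nat N)) \<longlonglongrightarrow>
      (\<Sum>n\<le>k. \<Sum>w | length w = n. \<Sum>v | length v = k - n.
        complex_of_real (signature n \<gamma> 0 s w * signature (k - n) \<sigma> 0 t v) * (if w = v then 1 else 0))"
      by (intro tendsto_sum tendsto_mult tendsto_const word_lim)
    then have "a k \<longlonglongrightarrow> (\<Sum>n\<le>k. \<Sum>w | length w = n. \<Sum>v | length v = k - n.
        complex_of_real (signature n \<gamma> 0 s w * signature (k - n) \<sigma> 0 t v) * (if w = v then 1 else 0))"
      by (rule Lim_transform_eventually) (rule ev)
    then show ?thesis unfolding diagonal_word_sum S_def .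
  qed
  have a_le: "norm (a k N) \<le> B k" if N: "N \<ge> 1" for k N
  proof -
    have "norm (a k N) \<le> (\<integral>\<omega>. cmod (F N k \<omega>) \<partial>P) / real N"
      unfolding a_def norm_divide by (simp add: divide_right_mono)
    also have "\<dots> \<le> B k" using F_norm[OF N, of k] N by (simp add: field_simps)
    finally show ?thesis .
  qed
  have "eventually (\<lambda>(k, N). norm (a k N) \<le> B k) (at_top \<times>\<^sub>F sequentially)"
    unfolding eventually_prod_filter
    by (intro exI[of _ "\<lambda>_. True"] exI[of _ "\<lambda>N. N \<ge> 1"]) (auto simp: a_le eventually_ge_at_top)
  then have tan: "summable (\<lambda>k. norm (S k))" "(\<lambda>N. \<Sum>k. a k N) \<longlonglongrightarrow> (\<Sum>k. S k)"
    using tannerys_theorem[of a S sequentially B, OF a_lim _ B_summable] by auto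
  have "(\<Sum>k. S k) = complex_of_real (sig_kernel \<gamma> \<sigma> s t)"
  proof -
    have mono: "strict_mono ((*) 2 :: nat \<Rightarrow> nat)" by (auto simp: strict_mono_def)
    have odd: "S k = 0" if "k \<notin> range ((*) 2)" for k
      using that by (auto simp: S_def elim: evenE)
    have S2: "S (2 * m) = complex_of_real (tensor_hs m (signature m \<gamma> 0 s) (signature m \<sigma> 0 t))" for m
      by (simp add: S_def)
    have "summable (\<lambda>m. S (2 * m))"
      using summable_mono_reindex[of "(*) 2" S, OF mono odd] summable_norm_cancel[OF tan(1)] by simp
    then have "summable (\<lambda>m. tensor_hs m (signature m \<gamma> 0 s) (signature m \<sigma> 0 t))"
      unfolding S2 using summable_complex_of_real by blast
    then have "complex_of_real (sig_kernel \<gamma> \<sigma> s t) = (\<Sum>m. S (2 * m))"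
      unfolding sig_kernel_def S2 by (rule suminf_of_real)
    then show ?thesis using suminf_mono_reindex[of "(*) 2" S, OF mono odd] by simp
  qed
  moreover have "eventually (\<lambda>N. (\<Sum>k. a k N) = 1 / of_nat N * (\<integral>\<omega>. mat_hs (Z\<gamma> N \<omega> s) (Z\<sigma> N \<omega> t) \<partial>P)) sequentially"
  proof (rule eventually_sequentiallyI)
    fix N :: nat assume N: "1 \<le> N"
    have "summable (\<lambda>k. \<integral>\<omega>. F N k \<omega> \<partial>P)"
    proof (rule summable_comparison_test')
      show "summable (\<lambda>k. real N * B k)" by (intro summable_mult B_summable)
      show "norm (\<integral>\<omega>. F N k \<omega> \<partial>P) \<le> real N * B k" for k
        by (rule order_trans[OF integral_norm_bound F_norm[OF N]])
    qed
    then show "(\<Sum>k. a k N) = 1 / of_nat N * (\<integral>\<omega>. mat_hs (Z\<gamma> N \<omega> s) (Z\<sigma> N \<omega> t) \<partial>P)"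
      unfolding int(2)[OF N] a_def by (simp add: suminf_divide)
  qed
  ultimately have "(\<lambda>N. 1 / of_nat N * (\<integral>\<omega>. mat_hs (Z\<gamma> N \<omega> s) (Z\<sigma> N \<omega> t) \<partial>P))
      \<longlonglongrightarrow> complex_of_real (sig_kernel \<gamma> \<sigma> s t)"
    using Lim_transform_eventually[OF tan(2)] by simp
  then show "(\<forall>N\<ge>1. integrable P (\<lambda>\<omega>. mat_hs (Z\<gamma> N \<omega> s) (Z\<sigma> N \<omega> t))) \<and>
      ((\<lambda>N. 1 / of_nat N * (\<integral>\<omega>. mat_hs (Z\<gamma> N \<omega> s) (Z\<sigma> N \<omega> t) \<partial>P))
        \<longlonglongrightarrow> complex_of_real (sig_kernel \<gamma> \<sigma> s t))"
    using int(1) by blast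
qed

end
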